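(* Let $\theta\neq 2$ be a Pisot number, let $\mu_\theta$ be the Bernoulli convolution parameterized by $\theta$, let $r\in\mathbb{Q}(\theta)$ with $r>0$, and put $\mathcal{F}_{\mu_\theta,r}=\{\widehat{\mu_\theta}(rn): n\in\mathbb{Z}\}\subset\mathbb{R}$. Then for each $n\ge 1$ the $n$-th derived set $\mathcal{F}_{\mu_\theta,r}^{(n)}$ is countable (countably infinite).
   Context: A Pisot number is an algebraic integer greater than $1$ whose other conjugates are all less than $1$ in modulus (rational integers $\ge 2$ are included). For $\theta>1$, the Bernoulli convolution $\mu_\theta$ is the Borel probability measure on $\mathbb{R}$ given by the infinite convolution product over $k\ge 0$ of the measures $\frac12\delta_{-\theta^{-k}}+\frac12\delta_{\theta^{-k}}$, where $\delta_x$ is the Dirac measure at $x$. Its Fourier transform is $\widehat{\mu_\theta}(t)=\prod_{k=0}^\infty\cos(2\pi\theta^{-k}t)$, $t\in\mathbb{R}$. For $E\subset\mathbb{R}$, $E'$ denotes the derived set of $E$ (the set of its limit points), $E^{(1)}=E'$, and $E^{(n+1)}=(E^{(n)})'$. *)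

theory Defs
  imports "HOL-Probability.Probability" "HOL-Computational_Algebra.Computational_Algebra"
begin

definition conjugate_over_rat :: "real \<Rightarrow> complex \<Rightarrow> bool" where
  "conjugate_over_rat x z \<longleftrightarrow>
     (\<exists>p :: rat poly. irreducible p \<and> poly (map_poly of_rat p) x = 0
                                   \<and> poly (map_poly of_rat p) z = 0)"

definition pisot :: "real \<Rightarrow> bool" where
  "pisot \<theta> \<longleftrightarrow> algebraic_int \<theta> \<and> \<theta> > 1 \<and>
     (\<forall>z. conjugate_over_rat \<theta> z \<and> z \<noteq> complex_of_real \<theta> \<longrightarrow> norm z < 1)"

definition real_subfield :: "real set \<Rightarrow> bool" where
  "real_subfield K \<longleftrightarrow> 0 \<in> K \<and> 1 \<in> K \<and> (\<forall>x\<in>K. \<forall>y\<in>K. x - y \<in> K \<and> x * y \<in> K) \<and>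
     (\<forall>x\<in>K. x \<noteq> 0 \<longrightarrow> inverse x \<in> K)"

definition rat_adjoin :: "real \<Rightarrow> real set" where
  "rat_adjoin \<theta> = real_subfield hull (insert \<theta> \<rat>)"

text \<open>For \<open>a \<noteq> 0\<close> this is the measure giving mass \<open>1/2\<close> to each of \<open>-a\<close> and \<open>a\<close>.\<close>

definition two_point_measure :: "real \<Rightarrow> real measure" where
  "two_point_measure a = distr (measure_pmf (pmf_of_set {- a, a})) borel (\<lambda>x. x)"

lemma emeasure_two_point_measure:
  assumes "a \<noteq> 0" "A \<in> sets borel"
  shows "emeasure (two_point_measure a) A =
           ennreal (1/2) * emeasure (return borel (- a)) A + ennreal (1/2) * emeasure (return borel a) A"
proof -
  have half: "inverse 2 + inverse 2 = (1 :: ennreal)"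
    using ennreal_plus[of "1/2" "1/2"] by simp
  have "emeasure (two_point_measure a) A = emeasure (measure_pmf (pmf_of_set {- a, a})) A"
    unfolding two_point_measure_def using assms(2) by (subst emeasure_distr) auto
  also have "\<dots> = ennreal (real (card ({- a, a} \<inter> A)) / 2)"
    using assms(1) by (subst emeasure_pmf_of_set) (auto simp: card_insert_if)
  also have "\<dots> = ennreal (1/2) * indicator A (- a) + ennreal (1/2) * indicator A a"
    using assms(1) by (auto simp: indicator_def card_insert_if Int_insert_left half)
  finally show ?thesis using assms(2) by simp
qed

text \<open>
  The convolution of the two-point measures for \<open>k < n\<close>; the empty convolution is the
  Dirac measure at \<open>0\<close>, the neutral element.
\<close>

primrec partial_bernoulli_convolution :: "real \<Rightarrow> nat \<Rightarrow> real measure" where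
  "partial_bernoulli_convolution \<theta> 0 = return borel 0"
| "partial_bernoulli_convolution \<theta> (Suc n) =
     convolution (partial_bernoulli_convolution \<theta> n) (two_point_measure (1 / \<theta> ^ n))"

text \<open>
  The infinite convolution product is the weak limit of the finite ones. It exists for
  \<open>\<theta> > 1\<close> and is unique among the Borel probability measures on the line.
\<close>

definition bernoulli_convolution :: "real \<Rightarrow> real measure" where
  "bernoulli_convolution \<theta> =
     (THE \<mu>. real_distribution \<mu> \<and> weak_conv_m (partial_bernoulli_convolution \<theta>) \<mu>)"

text \<open>
  The library's \<^const>\<open>char\<close> has no factor \<open>2\<pi>\<close> in the exponent. With the factor
  below, the transform of the Bernoulli convolution is \<open>\<Prod>k. cos (2 * pi * t / \<theta> ^ k)\<close>.
\<close>

definition fourier_transform :: "real measure \<Rightarrow> real \<Rightarrow> complex" where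
  "fourier_transform \<mu> t = char \<mu> (2 * pi * t)"

text \<open>
  The values of the transform of a Bernoulli convolution are real (the measure is symmetric),
  so nothing is lost by collecting them as a set of real numbers.
\<close>

definition fourier_values :: "real measure \<Rightarrow> real \<Rightarrow> real set" where
  "fourier_values \<mu> r =
     {y. \<exists>n :: int. complex_of_real y = fourier_transform \<mu> (r * of_int n)}"

definition iterated_derived_set :: "nat \<Rightarrow> real set \<Rightarrow> real set" where
  "iterated_derived_set n E = ((\<lambda>S. euclidean derived_set_of S) ^^ n) E"

end

theory Submission
  imports Defs
begin

text \<open>
  Write \<open>\<nu>(n)\<close> for the absolute value of the transform at \<open>rn\<close>, i.e. the product of
  \<open>\<bar>cos (\<pi> y\<^sub>k)\<bar>\<close> with \<open>y\<^sub>k = 2rn\<theta>\<^sup>-\<^sup>k\<close>, \<open>k \<ge> 0\<close>. If \<open>\<nu>(n) > \<epsilon>\<close>, then \<open>y\<^sub>k\<close> is close to an integer for all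
  but boundedly many \<open>k\<close>, so the nearest integers satisfy the recurrence of the minimal polynomial of
  \<open>\<theta>\<close> up to boundedly many bounded integer charges. Since \<open>\<theta>\<close> is Pisot, the recurrence has an
  exponentially decaying two-sided Green function, and \<open>r \<in> \<rat>(\<theta>)\<close> makes the one remaining degree of
  freedom at \<open>k = 0\<close> a bounded integer. Hence \<open>\<nu>(n)\<close> is a function of a finite configuration of charges, and
  it is nearly multiplicative over distant clusters of charges. Induction on the number of charges
  shows that the closure of these values is countable: a configuration either has bounded
  diameter (finitely many cases) or splits at a large gap.

  For the infinitude, let \<open>\<Lambda>(c)\<close> be the product of \<open>\<bar>cos (2\<pi> c \<theta>\<^sup>-\<^sup>k)\<bar>\<close> over all integers \<open>k\<close>, for those \<open>c\<close> for
  which \<open>c\<theta>\<^sup>j\<close> is exponentially close both to \<open>\<int>\<close> and to \<open>r\<int>\<close> as \<open>j \<rightarrow> \<infinity>\<close>. Then multiplication by \<open>\<Lambda>(c)\<close> maps the closure of the values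
  into itself. For \<open>\<theta> \<noteq> 2\<close> some \<open>\<Lambda>(c)\<close> is nonzero, and the numbers
  \<open>\<Lambda>(c\<theta>\<^sup>j \<plusminus> c)\<close> converge to \<open>L = \<Lambda>(c)\<^sup>2\<close> without being eventually equal to it, so that
  multiplication by \<open>L\<close> raises the Cantor-Bendixson rank.
\<close>

section \<open>Unordered products of factors in the unit interval\<close>

text \<open>Absolute values make the integer parts of the numbers \<open>y\<^sub>k\<close>
  irrelevant, since the modulus of cos (pi x) has period 1; only rounding errors matter. A threshold
  bounds the number of charges but not their positions, so infinitely many configurations remain. A
  group of charges far from the end k = 0 of the ray is governed, in the limit, by a kernel that
  depends on differences of positions only. Hence two families of products: half-line configurations
  with a boundary term, and free configurations on all integers. The half-line family with m charges
  needs the free family with at most m charges; the free family with m charges is, once its leftmost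
  charge is moved to 0, a half-line family with m - 1 charges whose boundary term is that charge.
  This breaks the circle. One countable closure serves every n, because all iterated derived sets
  lie in it. Passing to moduli costs only a reflection: a derived set of the moduli lies in the
  union of the derived set of the values and its negative.\<close>

definition inf_prod :: "('a \<Rightarrow> real) \<Rightarrow> real" where
  "inf_prod f = (INF F\<in>{F. finite F}. prod f F)"

lemma bdd_below_prod:
  fixes f :: "'a \<Rightarrow> real"
  assumes "\<And>k. 0 \<le> f k" shows "bdd_below (prod f ` {F. finite F})"
  by (rule bdd_belowI[of _ 0]) (auto intro: prod_nonneg assms)

lemma inf_prod_le:
  assumes "\<And>k. 0 \<le> f k" "finite F" shows "inf_prod f \<le> prod f F"
  unfolding inf_prod_def by (rule cINF_lower[OF bdd_below_prod]) (use assms in auto)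

lemma inf_prod_le_factor:
  assumes "\<And>k. 0 \<le> f k" shows "inf_prod f \<le> f k"
  using inf_prod_le[of f "{k}"] assms by simp

lemma inf_prod_ge:
  assumes "\<And>F. finite F \<Longrightarrow> c \<le> prod f F" shows "c \<le> inf_prod f"
  unfolding inf_prod_def by (rule cINF_greatest) (use assms in auto)

lemma inf_prod_nonneg:
  assumes "\<And>k. 0 \<le> f k" shows "0 \<le> inf_prod f"
  by (rule inf_prod_ge) (auto intro: prod_nonneg assms)

lemma inf_prod_le_1:
  assumes "\<And>k. 0 \<le> f k" "\<And>k. f k \<le> 1" shows "inf_prod f \<le> 1"
  using inf_prod_le[of f "{}"] assms by simp

lemma prod_antimono:
  fixes f :: "'a \<Rightarrow> real"
  assumes "\<And>k. 0 \<le> f k" "\<And>k. f k \<le> 1" "A \<subseteq> B" "finite B"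
  shows "prod f B \<le> prod f A"
proof -
  have "prod f B = prod f (B - A) * prod f A" using assms by (simp add: prod.subset_diff)
  also have "\<dots> \<le> 1 * prod f A"
    by (intro mult_right_mono prod_le_1 prod_nonneg) (use assms in auto)
  finally show ?thesis by simp
qed

text \<open>Finite subproducts decrease as the index set grows, so their infimum is their limit
  along finite sets. The infimum exists without a convergence hypothesis and ignores any order of
  the indices, which suits products over all integers that get translated.\<close>

lemma inf_prod_tendsto:
  assumes "\<And>k. 0 \<le> f k" "\<And>k. f k \<le> 1"
  shows "(prod f \<longlongrightarrow> inf_prod f) (finite_subsets_at_top UNIV)"
proof (rule tendstoI)
  fix e :: real assume "e > 0"
  then have "\<not> inf_prod f + e \<le> inf_prod f" by simp
  then obtain F where F: "finite F" "prod f F < inf_prod f + e"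
    using inf_prod_ge[of "inf_prod f + e" f] by force
  have "dist (prod f G) (inf_prod f) < e" if "finite G" "F \<subseteq> G" for G
    using prod_antimono[of f, OF assms that(2,1)] F inf_prod_le[of f, OF assms(1) that(1)]
    by (simp add: dist_real_def)
  then show "\<forall>\<^sub>F G in finite_subsets_at_top UNIV. dist (prod f G) (inf_prod f) < e"
    unfolding eventually_finite_subsets_at_top using F by auto
qed

lemma inf_prod_mult:
  assumes "\<And>k. 0 \<le> f k" "\<And>k. f k \<le> 1" "\<And>k. 0 \<le> g k" "\<And>k. g k \<le> 1"
  shows "inf_prod (\<lambda>k. f k * g k) = inf_prod f * inf_prod g"
proof (rule tendsto_unique)
  show "(prod (\<lambda>k. f k * g k) \<longlongrightarrow> inf_prod (\<lambda>k. f k * g k)) (finite_subsets_at_top UNIV)"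
    by (rule inf_prod_tendsto) (auto simp: assms mult_le_one)
  show "(prod (\<lambda>k. f k * g k) \<longlongrightarrow> inf_prod f * inf_prod g) (finite_subsets_at_top UNIV)"
  proof -
    have "prod (\<lambda>k. f k * g k) = (\<lambda>F. prod f F * prod g F)"
      by (simp add: fun_eq_iff prod.distrib)
    then show ?thesis
      using tendsto_mult[OF inf_prod_tendsto[of f] inf_prod_tendsto[of g]] assms by simp
  qed
qed auto

lemma inf_prod_reindex:
  assumes "bij h" shows "inf_prod (\<lambda>k. f (h k)) = inf_prod f"
proof -
  have "prod (\<lambda>k. f (h k)) F = prod f (h ` F)" for F
    by (subst prod.reindex) (use assms in \<open>auto simp: bij_def intro: inj_on_subset\<close>)
  moreover have "(\<lambda>F. h ` F) ` {F. finite F} = {F. finite F}"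
  proof -
    have "F \<in> (`) h ` {F. finite F}" if "finite F" for F
      using that assms by (intro image_eqI[of _ _ "inv h ` F"]) (auto simp: image_image bij_is_surj surj_f_inv_f)
    then show ?thesis by auto
  qed
  moreover have "prod (\<lambda>k. f (h k)) ` {F. finite F} = prod f ` ((\<lambda>F. h ` F) ` {F. finite F})"
    unfolding image_image by (rule image_cong) (simp_all add: calculation(1))
  ultimately show ?thesis unfolding inf_prod_def by simp
qed

lemma abs_prod_diff_le_sum:
  fixes f g :: "'a \<Rightarrow> real"
  assumes "finite F" "\<And>k. 0 \<le> f k" "\<And>k. f k \<le> 1" "\<And>k. 0 \<le> g k" "\<And>k. g k \<le> 1"
  shows "\<bar>prod f F - prod g F\<bar> \<le> (\<Sum>k\<in>F. \<bar>f k - g k\<bar>)"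
  using assms norm_prod_diff[of F f g] by simp

lemma abs_inf_prod_diff_le:
  assumes "\<And>k. 0 \<le> f k" "\<And>k. f k \<le> 1" "\<And>k. 0 \<le> g k" "\<And>k. g k \<le> 1"
    and "\<And>F. finite F \<Longrightarrow> (\<Sum>k\<in>F. \<bar>f k - g k\<bar>) \<le> \<eta>"
  shows "\<bar>inf_prod f - inf_prod g\<bar> \<le> \<eta>"
proof (rule tendsto_upperbound)
  show "((\<lambda>F. \<bar>prod f F - prod g F\<bar>) \<longlongrightarrow> \<bar>inf_prod f - inf_prod g\<bar>) (finite_subsets_at_top UNIV)"
    by (intro tendsto_intros inf_prod_tendsto assms)
  have "\<bar>prod f F - prod g F\<bar> \<le> \<eta>" if "finite F" for F
    using abs_prod_diff_le_sum[of F f g, OF that assms(1-4)] assms(5)[OF that] by (rule order_trans)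
  then show "\<forall>\<^sub>F F in finite_subsets_at_top UNIV. \<bar>prod f F - prod g F\<bar> \<le> \<eta>"
    by (intro eventually_finite_subsets_at_top_weakI)
qed auto

text \<open>Outside a finite set F the deficits 1 - f sum to at most 1/2, so any finitely many
  factors from there multiply to at least 1/2; the finitely many factors in F are positive.\<close>

lemma inf_prod_pos:
  assumes f: "\<And>k. 0 < f k" "\<And>k. f k \<le> 1" and s: "(\<lambda>k. 1 - f k) summable_on UNIV"
  shows "0 < inf_prod f"
proof -
  define L where "L = infsum (\<lambda>k. 1 - f k) UNIV"
  have "(sum (\<lambda>k. 1 - f k) \<longlongrightarrow> L) (finite_subsets_at_top UNIV)"
    using s has_sum_infsum unfolding L_def has_sum_def by blast
  then have "\<forall>\<^sub>F F in finite_subsets_at_top UNIV. dist (sum (\<lambda>k. 1 - f k) F) L < 1/4"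
    by (rule tendstoD) simp
  then obtain F where F: "finite F" "\<And>G. finite G \<Longrightarrow> F \<subseteq> G \<Longrightarrow> dist (sum (\<lambda>k. 1 - f k) G) L < 1/4"
    unfolding eventually_finite_subsets_at_top by auto
  have tail: "(\<Sum>k\<in>H. 1 - f k) \<le> 1/2" if "finite H" "H \<inter> F = {}" for H
    using F(2)[of F] F(2)[of "F \<union> H"] that F(1)
    unfolding sum.union_disjoint[OF F(1) that(1) that(2)[unfolded Int_commute[of H]]] dist_real_def
    by fastforce
  have "prod f F * (1/2) \<le> inf_prod f"
  proof (rule inf_prod_ge)
    fix G :: "'a set" assume G: "finite G"
    define H where "H = G - F"
    have H: "finite H" "H \<inter> F = {}" using G by (auto simp: H_def)
    have "1/2 \<le> (\<Prod>k\<in>H. f k)"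
      using abs_prod_diff_le_sum[of H f "\<lambda>_. 1"] tail[OF H] f H
      by (simp add: less_imp_le abs_minus_commute)
    then have "prod f F * (1/2) \<le> prod f F * prod f H"
      by (intro mult_left_mono prod_nonneg) (auto simp: f less_imp_le)
    also have "\<dots> = prod f (F \<union> H)" using H F by (simp add: prod.union_disjoint Int_commute)
    also have "\<dots> \<le> prod f G"
      by (rule prod_antimono) (use f G F in \<open>auto simp: H_def less_imp_le\<close>)
    finally show "prod f F * (1/2) \<le> prod f G" .
  qed
  moreover have "0 < prod f F * (1/2)" by (simp add: prod_pos f)
  ultimately show ?thesis by linarith
qed

text \<open>Divide: the product of the quotients f / g is at most its factor at k0, which is below
  1. Positivity of the product of g makes every quotient meaningful and keeps the inequality
  strict.\<close>

lemma inf_prod_less: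
  assumes f: "\<And>k. 0 \<le> f k" "\<And>k. f k \<le> g k" and g: "\<And>k. g k \<le> 1"
    and pos: "0 < inf_prod g" and strict: "f k0 < g k0"
  shows "inf_prod f < inf_prod g"
proof -
  have g0: "0 \<le> g k" for k using f order_trans by blast
  have gpos: "0 < g k" for k using inf_prod_le_factor[of g, OF g0, of k] pos by linarith
  define w where "w k = f k / g k" for k
  have w: "0 \<le> w k" "w k \<le> 1" for k using f gpos[of k] by (auto simp: w_def)
  have "f = (\<lambda>k. w k * g k)" using gpos by (auto simp: w_def fun_eq_iff less_imp_neq[symmetric])
  then have "inf_prod f = inf_prod w * inf_prod g"
    using inf_prod_mult[of w g] w g0 g by simp
  moreover have "w k0 < 1" using strict gpos[of k0] by (simp add: w_def)
  then have "inf_prod w < 1" using inf_prod_le_factor[of w k0] w by fastforce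
  ultimately show ?thesis using pos by simp
qed

text \<open>M factors bounded by c would push the product down to c^M < e. The bound M depends on c
  and e alone, not on f; this uniformity later limits the number of charges for all n at
  once.\<close>

lemma card_le_of_inf_prod_gt:
  fixes c e :: real
  assumes c: "0 \<le> c" "c < 1" and e: "0 < e"
  obtains M :: nat where "\<And>f F. (\<And>k. 0 \<le> f k) \<Longrightarrow> (\<And>k::'a. f k \<le> 1) \<Longrightarrow> e < inf_prod f \<Longrightarrow>
      (\<And>k. k \<in> F \<Longrightarrow> f k \<le> c) \<Longrightarrow> finite F \<and> card F \<le> M"
proof -
  obtain M where M: "c ^ M < e" using real_arch_pow_inv[OF e c(2)] by auto
  show thesis
  proof (rule that[of M])
    fix f :: "'a \<Rightarrow> real" and F
    assume f: "\<And>k. 0 \<le> f k" "\<And>k. f k \<le> 1" "e < inf_prod f" "\<And>k. k \<in> F \<Longrightarrow> f k \<le> c"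
    have *: False if G: "finite G" "G \<subseteq> F" "card G = M" for G
    proof -
      have "prod f G \<le> (\<Prod>k\<in>G. c)" by (rule prod_mono) (use f G in auto)
      moreover have "inf_prod f \<le> prod f G" by (rule inf_prod_le) (use f G in auto)
      ultimately show False using M f(3) G by simp
    qed
    show "finite F \<and> card F \<le> M"
    proof (rule ccontr)
      assume "\<not> (finite F \<and> card F \<le> M)"
      then consider "infinite F" | "M \<le> card F" by linarith
      then have "\<exists>G. finite G \<and> card G = M \<and> G \<subseteq> F"
      proof cases
        case 1 then show ?thesis by (rule infinite_arbitrarily_large)
      next
        case 2 then show ?thesis by (rule obtain_subset_with_card_n) blast
      qed
      then show False using * by blast
    qed
  qed
qed

section \<open>Products of cosines\<close>

text \<open>Indexed by all integers so that translations act on it; a one-sided product is padded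
  with x k = 0, whose factor is 1.\<close>

definition cosprod :: "(int \<Rightarrow> real) \<Rightarrow> real" where
  "cosprod x = inf_prod (\<lambda>k. \<bar>cos (pi * x k)\<bar>)"

lemma cosprod_nonneg: "0 \<le> cosprod x" and cosprod_le_1: "cosprod x \<le> 1"
  unfolding cosprod_def by (auto intro!: inf_prod_nonneg inf_prod_le_1)

lemma cosprod_shift: "cosprod (\<lambda>k. x (k + j)) = cosprod x"
proof -
  have "bij (\<lambda>k::int. k + j)" by (rule bij_betw_byWitness[of _ "\<lambda>k. k - j"]) auto
  from inf_prod_reindex[OF this, of "\<lambda>k. \<bar>cos (pi * x k)\<bar>"] show ?thesis
    unfolding cosprod_def by simp
qed

lemma abs_cos_add_pi_of_int: "\<bar>cos (pi * (x + of_int n))\<bar> = \<bar>cos (pi * x)\<bar>"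
proof -
  have "\<bar>cos (pi * of_int n)\<bar> = 1"
  proof -
    have "cos (pi * of_int n) ^ 2 = 1"
      using sin_cos_squared_add[of "pi * of_int n"] by (simp add: sin_integer_2pi sin_int_times_real mult.commute)
    then show ?thesis by (auto simp: power2_eq_1_iff)
  qed
  moreover have "cos (pi * (x + of_int n)) = cos (pi * x) * cos (pi * of_int n)"
    by (simp add: distrib_left cos_add sin_int_times_real mult.commute)
  ultimately show ?thesis by (simp add: abs_mult)
qed

lemma cosprod_cong_int:
  assumes "\<And>k. \<exists>n. x k = y k + of_int n" shows "cosprod x = cosprod y"
proof -
  have "\<bar>cos (pi * x k)\<bar> = \<bar>cos (pi * y k)\<bar>" for k
    using assms[of k] by (metis abs_cos_add_pi_of_int)
  then show ?thesis unfolding cosprod_def by simp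
qed

text \<open>The sine, unlike the distance of a and b, is insensitive to multiples of pi, so
  arguments that are close only modulo the period can be compared.\<close>

lemma abs_cos_diff_le_sin: "\<bar>\<bar>cos a\<bar> - \<bar>cos b\<bar>\<bar> \<le> \<bar>sin (a - b)\<bar>" for a b :: real
proof -
  have *: "\<bar>cos a\<bar> \<le> \<bar>cos b\<bar> + \<bar>sin (a - b)\<bar>" for a b :: real
  proof -
    have "cos a = cos b * cos (a - b) - sin b * sin (a - b)"
      using cos_add[of b "a - b"] by simp
    then have "\<bar>cos a\<bar> \<le> \<bar>cos b\<bar> * \<bar>cos (a - b)\<bar> + \<bar>sin b\<bar> * \<bar>sin (a - b)\<bar>"
      by (metis abs_mult abs_triangle_ineq4)
    moreover have "\<bar>cos b\<bar> * \<bar>cos (a - b)\<bar> \<le> \<bar>cos b\<bar>" "\<bar>sin b\<bar> * \<bar>sin (a - b)\<bar> \<le> \<bar>sin (a - b)\<bar>"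
      by (simp_all add: mult_left_le mult_left_le_one_le)
    ultimately show ?thesis by linarith
  qed
  have "\<bar>sin (b - a)\<bar> = \<bar>sin (a - b)\<bar>" by (metis abs_minus_cancel minus_diff_eq sin_minus)
  then show ?thesis using *[of a b] *[of b a] by linarith
qed

lemma cosprod_diff_le:
  assumes "\<And>F. finite F \<Longrightarrow> (\<Sum>k\<in>F. \<bar>sin (pi * (x k - y k))\<bar>) \<le> \<eta>"
  shows "\<bar>cosprod x - cosprod y\<bar> \<le> \<eta>"
  unfolding cosprod_def
proof (rule abs_inf_prod_diff_le)
  fix F :: "int set" assume "finite F"
  have "(\<Sum>k\<in>F. \<bar>\<bar>cos (pi * x k)\<bar> - \<bar>cos (pi * y k)\<bar>\<bar>) \<le> (\<Sum>k\<in>F. \<bar>sin (pi * (x k - y k))\<bar>)"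
    by (intro sum_mono) (metis abs_cos_diff_le_sin right_diff_distrib)
  then show "(\<Sum>k\<in>F. \<bar>\<bar>cos (pi * x k)\<bar> - \<bar>cos (pi * y k)\<bar>\<bar>) \<le> \<eta>"
    using assms \<open>finite F\<close> order_trans by blast
qed auto

text \<open>By the addition formula each factor deviates from the product of the two cosines by at
  most a product of two sines. This is small at every index where x or y is close to an integer, so
  fields living in distant places nearly factorize.\<close>

lemma cosprod_add_le:
  assumes "\<And>F. finite F \<Longrightarrow> (\<Sum>k\<in>F. \<bar>sin (pi * x k)\<bar> * \<bar>sin (pi * y k)\<bar>) \<le> \<eta>"
  shows "\<bar>cosprod (\<lambda>k. x k + y k) - cosprod x * cosprod y\<bar> \<le> \<eta>"
proof -
  have "cosprod x * cosprod y = inf_prod (\<lambda>k. \<bar>cos (pi * x k)\<bar> * \<bar>cos (pi * y k)\<bar>)"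
    unfolding cosprod_def by (rule inf_prod_mult[symmetric]) auto
  moreover have "\<bar>inf_prod (\<lambda>k. \<bar>cos (pi * (x k + y k))\<bar>) - inf_prod (\<lambda>k. \<bar>cos (pi * x k)\<bar> * \<bar>cos (pi * y k)\<bar>)\<bar> \<le> \<eta>"
  proof (rule abs_inf_prod_diff_le)
    fix F :: "int set" assume "finite F"
    have "\<bar>\<bar>cos (a + b)\<bar> - \<bar>cos a\<bar> * \<bar>cos b\<bar>\<bar> \<le> \<bar>sin a\<bar> * \<bar>sin b\<bar>" for a b :: real
      by (simp add: cos_add flip: abs_mult)
    then have "(\<Sum>k\<in>F. \<bar>\<bar>cos (pi * (x k + y k))\<bar> - \<bar>cos (pi * x k)\<bar> * \<bar>cos (pi * y k)\<bar>\<bar>)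
        \<le> (\<Sum>k\<in>F. \<bar>sin (pi * x k)\<bar> * \<bar>sin (pi * y k)\<bar>)"
      by (intro sum_mono) (simp add: distrib_left)
    then show "(\<Sum>k\<in>F. \<bar>\<bar>cos (pi * (x k + y k))\<bar> - \<bar>cos (pi * x k)\<bar> * \<bar>cos (pi * y k)\<bar>\<bar>) \<le> \<eta>"
      using assms \<open>finite F\<close> order_trans by blast
  qed (auto intro: mult_le_one)
  ultimately show ?thesis by (simp add: cosprod_def)
qed

section \<open>Sums of localized exponential bumps\<close>

text \<open>On each side of l the distance to l is injective, so two geometric series dominate the
  sum.\<close>

lemma sum_geometric_int_le:
  fixes t :: real
  assumes t: "0 < t" "t < 1" and F: "finite F"
  shows "(\<Sum>k\<in>F. t ^ nat \<bar>k - l\<bar>) \<le> 2 / (1 - t)"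
proof -
  have *: "(\<Sum>k\<in>H. t ^ nat \<bar>k - l\<bar>) \<le> 1 / (1 - t)"
    if H: "finite H" "inj_on (\<lambda>k. nat \<bar>k - l\<bar>) H" for H
  proof -
    have "(\<Sum>k\<in>H. t ^ nat \<bar>k - l\<bar>) = (\<Sum>n\<in>(\<lambda>k. nat \<bar>k - l\<bar>) ` H. t ^ n)"
      using H by (simp add: sum.reindex)
    also have "\<dots> \<le> (\<Sum>n. t ^ n)"
      by (rule sum_le_suminf) (use t H in auto)
    also have "\<dots> = 1 / (1 - t)" using t by (simp add: suminf_geometric)
    finally show ?thesis .
  qed
  have "(\<Sum>k\<in>F. t ^ nat \<bar>k - l\<bar>)
      = (\<Sum>k\<in>F \<inter> {l..}. t ^ nat \<bar>k - l\<bar>) + (\<Sum>k\<in>F - {l..}. t ^ nat \<bar>k - l\<bar>)"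
    using F by (rule sum.Int_Diff)
  also have "\<dots> \<le> 1 / (1 - t) + 1 / (1 - t)"
    by (intro add_mono *) (use F in \<open>auto simp: inj_on_def nat_eq_iff2\<close>)
  finally show ?thesis by simp
qed

text \<open>Half of the exponent pays, by the triangle inequality, for the distance between the
  centres; the other half keeps the sum over k finite. This is why decay rates are written as
  squares, with t the square root of the actual rate.\<close>

lemma sum_geometric_int_product_le:
  fixes t :: real
  assumes t: "0 < t" "t < 1" and F: "finite F"
  shows "(\<Sum>k\<in>F. (t\<^sup>2) ^ nat \<bar>k - l\<bar> * (t\<^sup>2) ^ nat \<bar>k - l'\<bar>) \<le> 2 / (1 - t) * t ^ nat \<bar>l - l'\<bar>"
proof -
  have "(\<Sum>k\<in>F. (t\<^sup>2) ^ nat \<bar>k - l\<bar> * (t\<^sup>2) ^ nat \<bar>k - l'\<bar>)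
      \<le> (\<Sum>k\<in>F. t ^ nat \<bar>k - l\<bar> * t ^ nat \<bar>l - l'\<bar>)"
  proof (rule sum_mono)
    fix k
    have "(t\<^sup>2) ^ nat \<bar>k - l\<bar> * (t\<^sup>2) ^ nat \<bar>k - l'\<bar> = t ^ (2 * nat \<bar>k - l\<bar> + 2 * nat \<bar>k - l'\<bar>)"
      by (simp add: power_add power_mult)
    also have "\<dots> \<le> t ^ (nat \<bar>k - l\<bar> + nat \<bar>l - l'\<bar>)"
      by (rule power_decreasing) (use t in auto)
    finally show "(t\<^sup>2) ^ nat \<bar>k - l\<bar> * (t\<^sup>2) ^ nat \<bar>k - l'\<bar> \<le> t ^ nat \<bar>k - l\<bar> * t ^ nat \<bar>l - l'\<bar>"
      by (simp add: power_add)
  qed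
  also have "\<dots> = (\<Sum>k\<in>F. t ^ nat \<bar>k - l\<bar>) * t ^ nat \<bar>l - l'\<bar>"
    by (simp add: sum_distrib_right)
  also have "\<dots> \<le> 2 / (1 - t) * t ^ nat \<bar>l - l'\<bar>"
    by (intro mult_right_mono sum_geometric_int_le assms) (use t in auto)
  finally show ?thesis .
qed

lemma power_two_bumps_le:
  fixes t :: real
  assumes "0 < t" "t < 1"
  shows "(t\<^sup>2) ^ (nat \<bar>k\<bar> + nat \<bar>l\<bar>) \<le> (t\<^sup>2) ^ nat \<bar>k - l\<bar>"
  by (rule power_decreasing) (use assms in \<open>auto simp: power_le_one\<close>)

section \<open>Configurations of integer charges\<close>

definition supp :: "(int \<Rightarrow> int) \<Rightarrow> int set" where
  "supp a = {l. a l \<noteq> 0}"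

text \<open>A superposition: \<open>K k l\<close> is the field at k of a unit charge at l. The
  kernel has two arguments because the endpoint of the ray breaks translation invariance.\<close>

definition response :: "(int \<Rightarrow> int \<Rightarrow> real) \<Rightarrow> (int \<Rightarrow> int) \<Rightarrow> int \<Rightarrow> real" where
  "response K a k = (\<Sum>l\<in>supp a. of_int (a l) * K k l)"

definition charges :: "int \<Rightarrow> nat \<Rightarrow> (int \<Rightarrow> int) set" where
  "charges b m = {a. finite (supp a) \<and> card (supp a) \<le> m \<and> (\<forall>l. \<bar>a l\<bar> \<le> b)}"

lemma response_superset:
  assumes "finite S" "supp a \<subseteq> S"
  shows "response K a k = (\<Sum>l\<in>S. of_int (a l) * K k l)"
  unfolding response_def by (rule sum.mono_neutral_left) (use assms in \<open>auto simp: supp_def\<close>)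

lemma response_empty: "supp a = {} \<Longrightarrow> response K a = (\<lambda>_. 0)"
  by (simp add: response_def fun_eq_iff)

lemma abs_response_le:
  assumes "a \<in> charges b m" "\<And>l. l \<in> supp a \<Longrightarrow> \<bar>K k l\<bar> \<le> B l"
  shows "\<bar>response K a k\<bar> \<le> of_int b * (\<Sum>l\<in>supp a. B l)"
proof -
  have "\<bar>response K a k\<bar> \<le> (\<Sum>l\<in>supp a. \<bar>of_int (a l) * K k l\<bar>)"
    unfolding response_def by (rule sum_abs)
  also have "\<dots> \<le> (\<Sum>l\<in>supp a. of_int b * B l)"
  proof (rule sum_mono)
    fix l assume l: "l \<in> supp a"
    have "\<bar>a l\<bar> \<le> b" using assms(1) by (simp add: charges_def)
    then have "\<bar>of_int (a l) :: real\<bar> \<le> of_int b" by linarith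
    then show "\<bar>of_int (a l) * K k l\<bar> \<le> of_int b * B l"
      unfolding abs_mult by (intro mult_mono assms l) auto
  qed
  finally show ?thesis by (simp add: sum_distrib_left)
qed

locale decay_kernel =
  fixes t c\<^sub>0 :: real and G :: "int \<Rightarrow> real"
  assumes t: "0 < t" "t < 1" and c\<^sub>0: "0 \<le> c\<^sub>0"
    and G: "\<And>k. \<bar>G k\<bar> \<le> c\<^sub>0 * (t\<^sup>2) ^ nat \<bar>k\<bar>"
begin

text \<open>What a group of charges contributes once it is infinitely far from the boundary at 0.
  Positions are arbitrary integers.\<close>

definition free_values :: "int \<Rightarrow> nat \<Rightarrow> real set" where
  "free_values b m = (\<lambda>a. cosprod (response (\<lambda>k l. G (k - l)) a)) ` charges b m"

text \<open>A gap of length D above g separates the field of \<beta> and \<open>a\<^sub>1\<close>,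
  concentrated near [0, g], from that of \<open>a\<^sub>2\<close>, concentrated beyond g + D. The
  constant has two summands: the interaction of the two groups, one term per pair of sites, and the
  cost of replacing K by its translation-invariant limit on the far group, where the correction
  localized at 0 has size t^D.\<close>

lemma cosprod_split:
  fixes \<beta> :: "int \<Rightarrow> real" and K :: "int \<Rightarrow> int \<Rightarrow> real" and D :: nat
  assumes c\<^sub>1: "0 \<le> c\<^sub>1" and b: "0 \<le> b"
    and \<beta>: "\<And>k. \<bar>\<beta> k\<bar> \<le> c\<^sub>1 * (t\<^sup>2) ^ nat \<bar>k\<bar>"
    and K: "\<And>k l. 0 \<le> l \<Longrightarrow> \<bar>K k l - G (k - l)\<bar> \<le> c\<^sub>1 * (t\<^sup>2) ^ (nat \<bar>k\<bar> + nat \<bar>l\<bar>)"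
    and a: "a \<in> charges b m" "supp a \<subseteq> {0..}" and g: "0 \<le> g"
    and gap: "\<And>l. l \<in> supp a \<Longrightarrow> l \<le> g \<or> g + int D \<le> l"
  defines "a\<^sub>1 \<equiv> \<lambda>l. if l \<le> g then a l else 0" and "a\<^sub>2 \<equiv> \<lambda>l. if l \<le> g then 0 else a l"
  defines "c\<^sub>2 \<equiv> c\<^sub>1 + b * (c\<^sub>0 + c\<^sub>1)"
  shows "\<bar>cosprod (\<lambda>k. \<beta> k + response K a k)
            - cosprod (\<lambda>k. \<beta> k + response K a\<^sub>1 k) * cosprod (response (\<lambda>k l. G (k - l)) a\<^sub>2)\<bar>
         \<le> (pi\<^sup>2 * c\<^sub>2\<^sup>2 * real (m + 1) * real m + pi * b * c\<^sub>1 * m) * (2 / (1 - t)) * t ^ D"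
proof -
  let ?B = "2 / (1 - t)"
  have supps: "supp a\<^sub>1 = supp a \<inter> {..g}" "supp a\<^sub>2 = supp a - {..g}"
    by (auto simp: supp_def a\<^sub>1_def a\<^sub>2_def)
  have fin: "finite (supp a)" "card (supp a) \<le> m" using a by (auto simp: charges_def)
  have a12: "a\<^sub>1 \<in> charges b m" "a\<^sub>2 \<in> charges b m"
    using a b card_mono[OF fin(1), of "supp a\<^sub>1"] card_mono[OF fin(1), of "supp a\<^sub>2"] fin
    unfolding charges_def by (auto simp: supps) (auto simp: a\<^sub>1_def a\<^sub>2_def)
  have fin12: "finite (supp a\<^sub>1)" "finite (supp a\<^sub>2)" "card (supp a\<^sub>1) \<le> m" "card (supp a\<^sub>2) \<le> m"
    using a12 by (auto simp: charges_def)
  have Kbd: "\<bar>K k l\<bar> \<le> (c\<^sub>0 + c\<^sub>1) * (t\<^sup>2) ^ nat \<bar>k - l\<bar>" if "0 \<le> l" for k l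
  proof -
    have "\<bar>K k l\<bar> \<le> \<bar>G (k - l)\<bar> + \<bar>K k l - G (k - l)\<bar>" by linarith
    also have "\<dots> \<le> c\<^sub>0 * (t\<^sup>2) ^ nat \<bar>k - l\<bar> + c\<^sub>1 * (t\<^sup>2) ^ (nat \<bar>k\<bar> + nat \<bar>l\<bar>)"
      by (intro add_mono G K that)
    also have "\<dots> \<le> c\<^sub>0 * (t\<^sup>2) ^ nat \<bar>k - l\<bar> + c\<^sub>1 * (t\<^sup>2) ^ nat \<bar>k - l\<bar>"
      by (intro add_mono mult_left_mono power_two_bumps_le c\<^sub>1 t order_refl)
    finally show ?thesis by (simp add: distrib_right)
  qed
  have c2: "0 \<le> c\<^sub>2" "c\<^sub>1 \<le> c\<^sub>2" "b * (c\<^sub>0 + c\<^sub>1) \<le> c\<^sub>2" using c\<^sub>0 c\<^sub>1 b by (auto simp: c\<^sub>2_def)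
  have resp: "\<bar>response K a' k\<bar> \<le> b * (c\<^sub>0 + c\<^sub>1) * (\<Sum>l\<in>supp a'. (t\<^sup>2) ^ nat \<bar>k - l\<bar>)"
    if "a' \<in> charges b m" "supp a' \<subseteq> {0..}" for a' k
    using abs_response_le[OF that(1), of K k "\<lambda>l. (c\<^sub>0 + c\<^sub>1) * (t\<^sup>2) ^ nat \<bar>k - l\<bar>"] Kbd that(2)
    by (force simp: sum_distrib_left[symmetric] mult.assoc)
  let ?X = "\<lambda>k. \<beta> k + response K a\<^sub>1 k" and ?Y = "response K a\<^sub>2"
  \<comment> \<open>The site 0 stands for \<beta>, whose decay is centred there; hence m + 1 sites
    in the left group.\<close>
  let ?S = "insert 0 (supp a\<^sub>1)"
  have X: "\<bar>?X k\<bar> \<le> c\<^sub>2 * (\<Sum>l\<in>?S. (t\<^sup>2) ^ nat \<bar>k - l\<bar>)" for k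
  proof -
    have "\<bar>\<beta> k\<bar> \<le> c\<^sub>1 * (t\<^sup>2) ^ nat \<bar>k - 0\<bar>" using \<beta> by simp
    also have "\<dots> \<le> c\<^sub>1 * (\<Sum>l\<in>?S. (t\<^sup>2) ^ nat \<bar>k - l\<bar>)"
      by (intro mult_left_mono member_le_sum c\<^sub>1) (use fin12 in auto)
    finally have 1: "\<bar>\<beta> k\<bar> \<le> c\<^sub>1 * (\<Sum>l\<in>?S. (t\<^sup>2) ^ nat \<bar>k - l\<bar>)" .
    have "\<bar>response K a\<^sub>1 k\<bar> \<le> b * (c\<^sub>0 + c\<^sub>1) * (\<Sum>l\<in>supp a\<^sub>1. (t\<^sup>2) ^ nat \<bar>k - l\<bar>)"
      by (rule resp) (use a12 a supps in auto)
    also have "\<dots> \<le> b * (c\<^sub>0 + c\<^sub>1) * (\<Sum>l\<in>?S. (t\<^sup>2) ^ nat \<bar>k - l\<bar>)"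
      by (intro mult_left_mono sum_mono2) (use fin12 b c\<^sub>0 c\<^sub>1 in auto)
    finally show ?thesis using 1 by (simp add: c\<^sub>2_def distrib_right)
  qed
  have Y: "\<bar>?Y k\<bar> \<le> c\<^sub>2 * (\<Sum>l\<in>supp a\<^sub>2. (t\<^sup>2) ^ nat \<bar>k - l\<bar>)" for k
  proof -
    have "\<bar>?Y k\<bar> \<le> b * (c\<^sub>0 + c\<^sub>1) * (\<Sum>l\<in>supp a\<^sub>2. (t\<^sup>2) ^ nat \<bar>k - l\<bar>)"
      by (rule resp) (use a12 a supps in auto)
    also have "\<dots> \<le> c\<^sub>2 * (\<Sum>l\<in>supp a\<^sub>2. (t\<^sup>2) ^ nat \<bar>k - l\<bar>)"
      by (intro mult_right_mono c2 sum_nonneg) auto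
    finally show ?thesis .
  qed
  have sinle: "\<bar>sin (pi * x)\<bar> \<le> pi * \<bar>x\<bar>" for x
    using abs_sin_x_le_abs_x[of "pi * x"] by (simp add: abs_mult)
  have far: "t ^ nat \<bar>l - l'\<bar> \<le> t ^ D" if "l \<in> ?S" "l' \<in> supp a\<^sub>2" for l l'
  proof (rule power_decreasing)
    have "g + int D \<le> l'" "l \<le> g" using that gap[of l'] g by (auto simp: supps)
    then show "D \<le> nat \<bar>l - l'\<bar>" by linarith
  qed (use t in auto)
  have "\<bar>cosprod (\<lambda>k. ?X k + ?Y k) - cosprod ?X * cosprod ?Y\<bar> \<le> pi\<^sup>2 * c\<^sub>2\<^sup>2 * real (m + 1) * real m * ?B * t ^ D"
  proof (rule cosprod_add_le)
    fix F :: "int set" assume F: "finite F"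
    have "(\<Sum>k\<in>F. \<bar>sin (pi * ?X k)\<bar> * \<bar>sin (pi * ?Y k)\<bar>)
        \<le> (\<Sum>k\<in>F. (pi * (c\<^sub>2 * (\<Sum>l\<in>?S. (t\<^sup>2) ^ nat \<bar>k - l\<bar>))) * (pi * (c\<^sub>2 * (\<Sum>l\<in>supp a\<^sub>2. (t\<^sup>2) ^ nat \<bar>k - l\<bar>))))"
      by (intro sum_mono mult_mono order_trans[OF sinle] mult_left_mono X Y) (auto intro!: mult_nonneg_nonneg sum_nonneg c2)
    also have "\<dots> = pi\<^sup>2 * c\<^sub>2\<^sup>2 * (\<Sum>k\<in>F. (\<Sum>l\<in>?S. (t\<^sup>2) ^ nat \<bar>k - l\<bar>) * (\<Sum>l\<in>supp a\<^sub>2. (t\<^sup>2) ^ nat \<bar>k - l\<bar>))"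
      unfolding sum_distrib_left[of "pi\<^sup>2 * c\<^sub>2\<^sup>2"] by (intro sum.cong refl) (simp add: power2_eq_square mult_ac)
    also have "(\<Sum>k\<in>F. (\<Sum>l\<in>?S. (t\<^sup>2) ^ nat \<bar>k - l\<bar>) * (\<Sum>l\<in>supp a\<^sub>2. (t\<^sup>2) ^ nat \<bar>k - l\<bar>))
        = (\<Sum>l\<in>?S. \<Sum>l'\<in>supp a\<^sub>2. \<Sum>k\<in>F. (t\<^sup>2) ^ nat \<bar>k - l\<bar> * (t\<^sup>2) ^ nat \<bar>k - l'\<bar>)"
      unfolding sum_product by (subst sum.swap, rule sum.cong[OF refl], rule sum.swap)
    also have "\<dots> \<le> (\<Sum>l\<in>?S. \<Sum>l'\<in>supp a\<^sub>2. ?B * t ^ D)"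
      by (intro sum_mono order_trans[OF sum_geometric_int_product_le[OF t F]] mult_left_mono far) (use t in auto)
    also have "\<dots> = card ?S * (card (supp a\<^sub>2) * (?B * t ^ D))" by simp
    also have "\<dots> \<le> real (m + 1) * (real m * (?B * t ^ D))"
      by (intro mult_mono) (use t fin12 card_insert_le_m1[of "m + 1" "supp a\<^sub>1" 0] in auto)
    finally show "(\<Sum>k\<in>F. \<bar>sin (pi * ?X k)\<bar> * \<bar>sin (pi * ?Y k)\<bar>) \<le> pi\<^sup>2 * c\<^sub>2\<^sup>2 * real (m + 1) * real m * ?B * t ^ D"
      by (simp add: mult_left_mono mult.assoc)
  qed
  moreover have "cosprod (\<lambda>k. ?X k + ?Y k) = cosprod (\<lambda>k. \<beta> k + response K a k)"
  proof (rule arg_cong[of _ _ cosprod], rule ext)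
    fix k
    have "response K a\<^sub>1 k + response K a\<^sub>2 k = response K a k"
      using response_superset[OF fin(1), of a\<^sub>1 K k] response_superset[OF fin(1), of a\<^sub>2 K k] supps
      unfolding response_def[of K a]
      by (simp flip: sum.distrib) (intro sum.cong refl, auto simp: a\<^sub>1_def a\<^sub>2_def)
    then show "?X k + ?Y k = \<beta> k + response K a k" by simp
  qed
  moreover have "\<bar>cosprod ?Y - cosprod (response (\<lambda>k l. G (k - l)) a\<^sub>2)\<bar> \<le> pi * b * c\<^sub>1 * m * ?B * t ^ D"
  proof (rule cosprod_diff_le)
    fix F :: "int set" assume F: "finite F"
    have *: "\<bar>sin (pi * (?Y k - response (\<lambda>k l. G (k - l)) a\<^sub>2 k))\<bar> \<le> pi * b * c\<^sub>1 * m * t ^ D * t ^ nat \<bar>k - 0\<bar>" for k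
    proof -
      have "?Y k - response (\<lambda>k l. G (k - l)) a\<^sub>2 k = response (\<lambda>k l. K k l - G (k - l)) a\<^sub>2 k"
        by (simp add: response_def sum_subtractf right_diff_distrib)
      also have "\<bar>\<dots>\<bar> \<le> b * (\<Sum>l\<in>supp a\<^sub>2. c\<^sub>1 * (t ^ D * t ^ nat \<bar>k - 0\<bar>))"
      proof (rule abs_response_le[OF a12(2)])
        fix l assume l: "l \<in> supp a\<^sub>2"
        then have l': "g + int D \<le> l" "0 \<le> l" using gap[of l] a(2) by (auto simp: supps)
        have "\<bar>K k l - G (k - l)\<bar> \<le> c\<^sub>1 * t ^ (2 * (nat \<bar>k\<bar> + nat \<bar>l\<bar>))"
          using K[OF l'(2), of k] by (simp only: power_mult)
        \<comment> \<open>Since l \<ge> g + D \<ge> D, twice the sum of the moduli of k and l is at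
          least D plus the modulus of k; the part with k is kept for the sum over k.\<close>
        also have "\<dots> \<le> c\<^sub>1 * t ^ (D + nat \<bar>k\<bar>)"
          by (intro mult_left_mono power_decreasing c\<^sub>1) (use t l' g in auto)
        finally show "\<bar>K k l - G (k - l)\<bar> \<le> c\<^sub>1 * (t ^ D * t ^ nat \<bar>k - 0\<bar>)" by (simp add: power_add)
      qed
      also have "\<dots> \<le> b * (m * (c\<^sub>1 * (t ^ D * t ^ nat \<bar>k - 0\<bar>)))"
        using fin12 b c\<^sub>1 t by (auto intro!: mult_left_mono mult_right_mono)
      finally have "pi * \<bar>?Y k - response (\<lambda>k l. G (k - l)) a\<^sub>2 k\<bar> \<le> pi * (b * (m * (c\<^sub>1 * (t ^ D * t ^ nat \<bar>k - 0\<bar>))))"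
        by (rule mult_left_mono) auto
      with sinle[of "?Y k - response (\<lambda>k l. G (k - l)) a\<^sub>2 k"]
      have "\<bar>sin (pi * (?Y k - response (\<lambda>k l. G (k - l)) a\<^sub>2 k))\<bar>
          \<le> pi * (b * (m * (c\<^sub>1 * (t ^ D * t ^ nat \<bar>k - 0\<bar>))))" by (rule order_trans)
      then show ?thesis by (simp only: mult_ac)
    qed
    have "(\<Sum>k\<in>F. \<bar>sin (pi * (?Y k - response (\<lambda>k l. G (k - l)) a\<^sub>2 k))\<bar>)
        \<le> (\<Sum>k\<in>F. pi * b * c\<^sub>1 * m * t ^ D * t ^ nat \<bar>k - 0\<bar>)"
      by (intro sum_mono *)
    also have "\<dots> = pi * b * c\<^sub>1 * m * t ^ D * (\<Sum>k\<in>F. t ^ nat \<bar>k - 0\<bar>)"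
      by (simp only: sum_distrib_left)
    also have "\<dots> \<le> pi * b * c\<^sub>1 * m * t ^ D * ?B"
      by (intro mult_left_mono sum_geometric_int_le t F) (use b c\<^sub>1 t in auto)
    finally show "(\<Sum>k\<in>F. \<bar>sin (pi * (?Y k - response (\<lambda>k l. G (k - l)) a\<^sub>2 k))\<bar>) \<le> pi * b * c\<^sub>1 * m * ?B * t ^ D"
      by (simp add: mult_ac)
  qed
  then have "\<bar>cosprod ?X * cosprod ?Y - cosprod ?X * cosprod (response (\<lambda>k l. G (k - l)) a\<^sub>2)\<bar> \<le> pi * b * c\<^sub>1 * m * ?B * t ^ D"
    using cosprod_nonneg[of ?X] cosprod_le_1[of ?X]
    by (simp flip: right_diff_distrib add: abs_mult)
       (meson abs_ge_zero mult_left_le_one_le order_trans)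
  ultimately have "\<bar>cosprod (\<lambda>k. \<beta> k + response K a k) - cosprod ?X * cosprod (response (\<lambda>k l. G (k - l)) a\<^sub>2)\<bar>
      \<le> pi\<^sup>2 * c\<^sub>2\<^sup>2 * real (m + 1) * real m * ?B * t ^ D + pi * b * c\<^sub>1 * m * ?B * t ^ D" by linarith
  then show ?thesis by (simp only: distrib_right[where c = ?B] distrib_right[where c = "t ^ D"])
qed

end

section \<open>Countability of the closure of the set of products\<close>

text \<open>A finite set \<open>S D\<close> has no limit points, so a point of the closure outside
  all of them is, for every D, a limit of points within \<open>\<eta> D\<close> of Z. Since Z is
  closed, it contains that point.\<close>

lemma countable_closure_approx:
  fixes T Z :: "real set"
  assumes Z: "compact Z" "countable Z" and fin: "\<And>D. finite (S D)"
    and cover: "\<And>D y. y \<in> T \<Longrightarrow> y \<in> S D \<or> (\<exists>z\<in>Z. \<bar>y - z\<bar> \<le> \<eta> D)"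
    and \<eta>: "\<eta> \<longlonglongrightarrow> (0::real)"
  shows "countable (closure T)"
proof -
  have "closure T \<subseteq> (\<Union>D::nat. S D) \<union> Z"
  proof
    fix x assume x: "x \<in> closure T"
    show "x \<in> (\<Union>D. S D) \<union> Z"
    proof (cases "x \<in> (\<Union>D. S D)")
      case False
      have "x \<in> closure Z"
        unfolding closure_approachable
      proof (intro allI impI)
        fix e :: real assume e: "0 < e"
        obtain D where D: "\<eta> D < e / 2"
          using order_tendstoD(2)[OF \<eta>, of "e / 2"] e by (auto simp: eventually_sequentially)
        define N where "N = {y. \<exists>z\<in>Z. \<bar>y - z\<bar> \<le> \<eta> D}"
        have "T \<subseteq> S D \<union> N" using cover[of _ D] by (auto simp: N_def)
        then have "closure T \<subseteq> S D \<union> closure N"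
          by (metis closure_Un closure_closed closure_mono fin finite_imp_closed)
        then have "x \<in> closure N" using x False by auto
        then obtain y where "y \<in> N" "dist y x < e / 2"
          using e by (metis closure_approachable half_gt_zero)
        then obtain z where "z \<in> Z" "\<bar>y - z\<bar> \<le> \<eta> D" "dist y x < e / 2" by (auto simp: N_def)
        moreover have "dist z x < e" using calculation(2,3) D unfolding dist_real_def by linarith
        ultimately show "\<exists>z\<in>Z. dist z x < e" by blast
      qed
      then show ?thesis using Z by (simp add: compact_imp_closed)
    qed simp
  qed
  moreover have "countable ((\<Union>D. S D) \<union> Z)" using Z fin by (auto intro: countable_finite)
  ultimately show ?thesis by (rule countable_subset)
qed

lemma finite_bounded_charges:
  "finite {a. supp a \<subseteq> {0..n} \<and> (\<forall>l. \<bar>a l\<bar> \<le> b)}"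
proof (rule finite_subset)
  show "{a. supp a \<subseteq> {0..n} \<and> (\<forall>l. \<bar>a l\<bar> \<le> b)}
      \<subseteq> {a. \<forall>l. (l \<in> {0..n} \<longrightarrow> a l \<in> {-b..b}) \<and> (l \<notin> {0..n} \<longrightarrow> a l = 0)}"
  proof (intro subsetI CollectI allI conjI impI)
    fix a l assume "a \<in> {a. supp a \<subseteq> {0..n} \<and> (\<forall>l. \<bar>a l\<bar> \<le> b)}"
    then have a: "supp a \<subseteq> {0..n}" "\<bar>a l\<bar> \<le> b" by auto
    then show "a l \<in> {-b..b}" by auto
    assume "l \<notin> {0..n}"
    then show "a l = 0" using a by (auto simp: supp_def)
  qed
  show "finite {a. \<forall>l. (l \<in> {0..n} \<longrightarrow> a l \<in> {-b..b}) \<and> (l \<notin> {0..n} \<longrightarrow> a l = 0)}"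
    by (rule finite_set_of_finite_funs) auto
qed

text \<open>Pigeonhole: among the m + 1 consecutive blocks of length D that start at 0, one carries
  no charge, because the charge at \<open>l\<^sub>0\<close> lies beyond all of them and at most m
  others are left. The lower end of that block serves as g.\<close>

lemma exists_gap:
  fixes a :: "int \<Rightarrow> int" and D :: nat
  assumes a: "finite (supp a)" "card (supp a) \<le> Suc m" and far: "l\<^sub>0 \<in> supp a" "int ((m + 1) * D) < l\<^sub>0"
  obtains g where "0 \<le> g" "g < l\<^sub>0" "\<And>l. l \<in> supp a \<Longrightarrow> l \<le> g \<or> g + int D \<le> l"
proof -
  have "\<exists>i\<le>m. supp a \<inter> {int (i * D)<..int (Suc i * D)} = {}"
  proof (rule ccontr)
    assume "\<not> ?thesis"
    then have "\<forall>i. \<exists>l. i \<le> m \<longrightarrow> l \<in> supp a \<and> int (i * D) < l \<and> l \<le> int (Suc i * D)" by fastforce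
    then obtain f where f: "\<And>i. i \<le> m \<Longrightarrow> f i \<in> supp a \<and> int (i * D) < f i \<and> f i \<le> int (Suc i * D)"
      by metis
    have le: "int (Suc i * D) \<le> int (j * D)" if "i < j" for i j
      using that by (simp only: of_nat_le_iff) (rule mult_le_mono1, simp)
    have less: "f i < f j" if "i < j" "j \<le> m" for i j
      using f[of i] f[of j] le[OF that(1)] that by fastforce
    have "inj_on f {..m}"
      by (rule linorder_inj_onI) (use less in fastforce)+
    moreover have "f ` {..m} \<subseteq> supp a - {l\<^sub>0}"
    proof (rule image_subsetI)
      fix i assume "i \<in> {..m}"
      then have "f i \<in> supp a" "f i \<le> int (Suc i * D)" "int (Suc i * D) \<le> int ((m + 1) * D)"
        using f[of i] by (auto simp only: of_nat_le_iff atMost_iff intro!: mult_le_mono1)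
      then show "f i \<in> supp a - {l\<^sub>0}" using far(2) by auto
    qed
    ultimately have "card {..m} \<le> card (supp a - {l\<^sub>0})"
      using a(1) by (metis card_image card_mono finite_Diff)
    then show False using a far(1) by simp
  qed
  then obtain i where i: "i \<le> m" "supp a \<inter> {int (i * D)<..int (Suc i * D)} = {}" by blast
  show thesis
  proof (rule that[of "int (i * D)"])
    have "i * D \<le> (m + 1) * D" using i by (intro mult_le_mono1) auto
    then show "int (i * D) < l\<^sub>0" using far by linarith
    fix l assume "l \<in> supp a"
    then have "l \<notin> {int (i * D)<..int (Suc i * D)}" using i(2) by blast
    then show "l \<le> int (i * D) \<or> int (i * D) + int D \<le> l" by auto
  qed simp
qed

section \<open>Induction on the number of charges\<close>

context decay_kernel
begin

lemma compact_closure_free_values: "compact (closure (free_values b m))"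
proof -
  have "free_values b m \<subseteq> {0..1}" by (auto simp: free_values_def cosprod_nonneg cosprod_le_1)
  then show ?thesis by (simp add: bounded_subset[OF bounded_closed_interval])
qed

text \<open>Either all charges sit in a window fixed by D, which leaves finitely many
  configurations, or \<open>cosprod_split\<close> applies. The left group has then lost the charge
  at \<open>l\<^sub>0\<close> and falls under the induction hypothesis; the right group may keep all
  charges, but it is free and covered by the assumption on \<open>free_values\<close>. The family
  \<beta> is left abstract because the boundary term is a single charge in one use and a multiple of
  the mode \<theta>^(-k) in the other.\<close>

lemma countable_closure_values:
  fixes \<beta> :: "'p \<Rightarrow> int \<Rightarrow> real" and K :: "int \<Rightarrow> int \<Rightarrow> real"
  assumes P: "finite P" and c\<^sub>1: "0 \<le> c\<^sub>1" and b: "0 \<le> b"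
    and \<beta>: "\<And>p k. p \<in> P \<Longrightarrow> \<bar>\<beta> p k\<bar> \<le> c\<^sub>1 * (t\<^sup>2) ^ nat \<bar>k\<bar>"
    and K: "\<And>k l. 0 \<le> l \<Longrightarrow> \<bar>K k l - G (k - l)\<bar> \<le> c\<^sub>1 * (t\<^sup>2) ^ (nat \<bar>k\<bar> + nat \<bar>l\<bar>)"
    and free: "\<And>j. j \<le> m \<Longrightarrow> countable (closure (free_values b j))"
  shows "countable (closure {cosprod (\<lambda>k. \<beta> p k + response K a k) |p a.
           p \<in> P \<and> a \<in> charges b m \<and> supp a \<subseteq> {0..}})" (is "countable (closure (?T m))")
  using free
proof (induction m)
  case 0
  have "?T 0 \<subseteq> (\<lambda>p. cosprod (\<beta> p)) ` P"
    by (auto simp: charges_def response_def)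
  then have "finite (?T 0)" using P finite_surj by blast
  then show ?case by (simp add: finite_imp_closed countable_finite)
next
  case (Suc m)
  define Z where "Z = (\<lambda>(u, v). u * v) ` (closure (?T m) \<times> closure (free_values b (Suc m)))"
  define S where "S D = (\<lambda>(p, a). cosprod (\<lambda>k. \<beta> p k + response K a k)) `
      (P \<times> {a. supp a \<subseteq> {0..int ((m + 1) * D)} \<and> (\<forall>l. \<bar>a l\<bar> \<le> b)})" for D :: nat
  define c\<^sub>2 where "c\<^sub>2 = c\<^sub>1 + b * (c\<^sub>0 + c\<^sub>1)"
  define C where "C = (pi\<^sup>2 * c\<^sub>2\<^sup>2 * real (Suc m + 1) * real (Suc m) + pi * b * c\<^sub>1 * Suc m) * (2 / (1 - t))"
  have "?T m \<subseteq> {0..1}" by (auto simp: cosprod_nonneg cosprod_le_1)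
  then have "compact (closure (?T m))" by (simp add: bounded_subset[OF bounded_closed_interval])
  then have "compact Z"
    unfolding Z_def by (intro compact_continuous_image compact_Times compact_closure_free_values)
      (auto intro!: continuous_intros simp: case_prod_unfold)
  moreover have "countable Z" unfolding Z_def
    by (intro countable_image countable_SIGMA Suc) (use Suc.prems in auto)
  moreover have "finite (S D)" for D
    unfolding S_def by (intro finite_imageI finite_cartesian_product P finite_bounded_charges)
  moreover have "y \<in> S D \<or> (\<exists>z\<in>Z. \<bar>y - z\<bar> \<le> C * t ^ D)" if yT: "y \<in> ?T (Suc m)" for D y
  proof -
    obtain p a where y: "y = cosprod (\<lambda>k. \<beta> p k + response K a k)" "p \<in> P"
      and a: "a \<in> charges b (Suc m)" "supp a \<subseteq> {0..}" using yT by blast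
    show ?thesis
    proof (cases "supp a \<subseteq> {0..int ((m + 1) * D)}")
      case True
      then have "y \<in> S D" unfolding S_def y(1)
        by (intro image_eqI[of _ _ "(p, a)"]) (use y a in \<open>auto simp: charges_def\<close>)
      then show ?thesis ..
    next
      case False
      then obtain l\<^sub>0 where l0: "l\<^sub>0 \<in> supp a" "int ((m + 1) * D) < l\<^sub>0" using a(2) by force
      have fin: "finite (supp a)" "card (supp a) \<le> Suc m" using a by (auto simp: charges_def)
      obtain g where g: "0 \<le> g" "g < l\<^sub>0" "\<And>l. l \<in> supp a \<Longrightarrow> l \<le> g \<or> g + int D \<le> l"
        using exists_gap[OF fin l0] by blast
      define a\<^sub>1 where "a\<^sub>1 = (\<lambda>l. if l \<le> g then a l else 0)"
      define a\<^sub>2 where "a\<^sub>2 = (\<lambda>l. if l \<le> g then 0 else a l)"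
      have supps: "supp a\<^sub>1 \<subseteq> supp a - {l\<^sub>0}" "supp a\<^sub>2 \<subseteq> supp a"
        using g(2) by (auto simp: a\<^sub>1_def a\<^sub>2_def supp_def)
      have "card (supp a\<^sub>1) \<le> m" using card_mono[OF _ supps(1)] fin l0(1) by simp
      then have a1: "a\<^sub>1 \<in> charges b m"
        using a b finite_subset[OF supps(1)] fin by (auto simp: charges_def a\<^sub>1_def)
      have a2: "a\<^sub>2 \<in> charges b (Suc m)"
        using a b finite_subset[OF supps(2)] card_mono[OF _ supps(2)] fin
        by (auto simp: charges_def a\<^sub>2_def)
      let ?z = "cosprod (\<lambda>k. \<beta> p k + response K a\<^sub>1 k) * cosprod (response (\<lambda>k l. G (k - l)) a\<^sub>2)"
      have "cosprod (\<lambda>k. \<beta> p k + response K a\<^sub>1 k) \<in> closure (?T m)"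
        using y(2) a1 supps(1) a(2) by (intro subsetD[OF closure_subset]) blast
      moreover have "cosprod (response (\<lambda>k l. G (k - l)) a\<^sub>2) \<in> closure (free_values b (Suc m))"
        by (rule subsetD[OF closure_subset]) (use a2 in \<open>auto simp: free_values_def\<close>)
      ultimately have "?z \<in> Z" unfolding Z_def by force
      moreover have "\<bar>y - ?z\<bar> \<le> C * t ^ D"
        unfolding y(1) C_def c\<^sub>2_def a\<^sub>1_def a\<^sub>2_def
        by (rule cosprod_split[OF c\<^sub>1 b _ K a g(1) g(3)]) (use \<beta> y(2) in auto)
      ultimately show ?thesis by blast
    qed
  qed
  moreover have "(\<lambda>D. C * t ^ D) \<longlonglongrightarrow> 0"
    using tendsto_mult_left[OF LIMSEQ_realpow_zero[of t], of C] t by simp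
  ultimately show ?case by (rule countable_closure_approx)
qed

text \<open>After a translation the leftmost charge sits at 0. Treating it as a boundary term lowers
  the number of charges, so the half-line lemma calls on \<open>free_values\<close> only below
  m.\<close>

lemma countable_closure_free_values:
  assumes b: "0 \<le> b" shows "countable (closure (free_values b m))"
proof (induction m rule: less_induct)
  case (less m)
  show ?case
  proof (cases m)
    case 0
    then have "free_values b m \<subseteq> {cosprod (\<lambda>_. 0)}"
      by (auto simp: free_values_def charges_def response_empty)
    then have "finite (free_values b m)" by (rule finite_subset) simp
    then show ?thesis by (simp add: finite_imp_closed countable_finite)
  next
    case (Suc n)
    define T where "T = {cosprod (\<lambda>k. of_int v * G k + response (\<lambda>k l. G (k - l)) a k) |v a.
        v \<in> {-b..b} \<and> a \<in> charges b n \<and> supp a \<subseteq> {0..}}"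
    have "countable (closure T)" unfolding T_def
    proof (rule countable_closure_values[where c\<^sub>1 = "b * c\<^sub>0"])
      fix v k assume v: "v \<in> {-b..b}"
      have "\<bar>of_int v * G k\<bar> \<le> of_int b * (c\<^sub>0 * (t\<^sup>2) ^ nat \<bar>k\<bar>)"
        unfolding abs_mult by (intro mult_mono G) (use v in auto)
      then show "\<bar>of_int v * G k\<bar> \<le> of_int b * c\<^sub>0 * (t\<^sup>2) ^ nat \<bar>k\<bar>" by (simp add: mult.assoc)
    qed (use b c\<^sub>0 less Suc in auto)
    moreover have "free_values b m \<subseteq> {cosprod (\<lambda>_. 0)} \<union> T"
    proof
      fix y assume "y \<in> free_values b m"
      then obtain a where y: "y = cosprod (response (\<lambda>k l. G (k - l)) a)" and a: "a \<in> charges b m"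
        by (auto simp: free_values_def)
      have fin: "finite (supp a)" "card (supp a) \<le> Suc n" using a Suc by (auto simp: charges_def)
      show "y \<in> {cosprod (\<lambda>_. 0)} \<union> T"
      proof (cases "supp a = {}")
        case True
        then show ?thesis using y by (simp add: response_empty)
      next
        case False
        define l\<^sub>0 where "l\<^sub>0 = Min (supp a)"
        have l0: "l\<^sub>0 \<in> supp a" "\<And>l. l \<in> supp a \<Longrightarrow> l\<^sub>0 \<le> l" using fin False by (auto simp: l\<^sub>0_def)
        define a' where "a' l = (if l = 0 then 0 else a (l + l\<^sub>0))" for l
        have supp': "supp a' = (\<lambda>l. l - l\<^sub>0) ` (supp a - {l\<^sub>0})"
        proof -
          have "l \<in> (\<lambda>l. l - l\<^sub>0) ` (supp a - {l\<^sub>0})" if "l \<in> supp a'" for l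
            using that by (intro image_eqI[of _ _ "l + l\<^sub>0"]) (auto simp: a'_def supp_def split: if_splits)
          then show ?thesis by (auto simp: a'_def supp_def)
        qed
        have inj: "inj_on (\<lambda>l. l - l\<^sub>0) A" for A by (auto simp: inj_on_def)
        have "a' \<in> charges b n"
          using fin l0(1) a b by (auto simp: charges_def supp' card_image[OF inj]) (auto simp: a'_def)
        moreover have "supp a' \<subseteq> {0..}" using l0(2) by (auto simp: supp')
        moreover have "a l\<^sub>0 \<in> {-b..b}" using a unfolding charges_def
          by (auto simp: abs_le_iff) (metis minus_le_iff)
        moreover have "y = cosprod (\<lambda>k. of_int (a l\<^sub>0) * G k + response (\<lambda>k l. G (k - l)) a' k)"
        proof -
          have "of_int (a l\<^sub>0) * G k + response (\<lambda>k l. G (k - l)) a' k = response (\<lambda>k l. G (k - l)) a (k + l\<^sub>0)" for k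
          proof -
            have "response (\<lambda>k l. G (k - l)) a' k = (\<Sum>l\<in>supp a - {l\<^sub>0}. of_int (a l) * G (k + l\<^sub>0 - l))"
              unfolding response_def supp' sum.reindex[OF inj] 
              by (rule sum.cong) (auto simp: a'_def algebra_simps)
            then show ?thesis unfolding response_def
              using sum.remove[OF fin(1) l0(1), of "\<lambda>l. of_int (a l) * G (k + l\<^sub>0 - l)"] by simp
          qed
          then show ?thesis using y cosprod_shift[of "response (\<lambda>k l. G (k - l)) a" l\<^sub>0] by simp
        qed
        ultimately have "y \<in> T" unfolding T_def by blast
        then show ?thesis by simp
      qed
    qed
    then have "closure (free_values b m) \<subseteq> closure ({cosprod (\<lambda>_. 0)} \<union> T)"
      by (rule closure_mono)
    moreover have "closure ({cosprod (\<lambda>_. 0)} \<union> T) = {cosprod (\<lambda>_. 0)} \<union> closure T"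
      by (simp only: closure_Un closure_closed[OF closed_singleton])
    ultimately show ?thesis
      by (metis countable_Un countable_finite countable_subset finite.emptyI finite.insertI)
  qed
qed

end

section \<open>The minimal polynomial of a Pisot number\<close>

abbreviation rpoly :: "rat poly \<Rightarrow> 'a :: field_char_0 \<Rightarrow> 'a" where
  "rpoly p x \<equiv> poly (map_poly of_rat p) x"

lemma rpoly_add: "rpoly (p + q) x = rpoly p x + rpoly q x"
  by (induction p q rule: poly_induct2) (simp_all add: map_poly_pCons of_rat_add algebra_simps)

lemma rpoly_smult: "rpoly (smult c p) x = of_rat c * rpoly p x"
  by (induction p) (simp_all add: map_poly_pCons of_rat_mult algebra_simps)

lemma rpoly_mult: "rpoly (p * q) x = rpoly p x * rpoly q x"
  by (induction p) (simp_all add: map_poly_pCons rpoly_add rpoly_smult algebra_simps)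

lemma rpoly_diff: "rpoly (p - q) x = rpoly p x - rpoly q x"
  using rpoly_add[of "p - q" q x] by simp

lemma of_real_of_rat: "complex_of_real (of_rat w) = of_rat w"
  by (induction w) (simp add: of_rat_rat)

lemma rpoly_of_int_poly: "rpoly (map_poly of_int p) x = poly (map_poly of_int p) x"
  by (induction p) (simp_all add: map_poly_pCons)

lemma poly_of_int_poly_of_real:
  "poly (map_poly of_int p) (complex_of_real x) = complex_of_real (poly (map_poly of_int p) x)"
  by (induction p) (simp_all add: map_poly_pCons)

lemma map_poly_of_int_mult: "map_poly of_int (p * q) = map_poly of_int p * (map_poly of_int q :: rat poly)"
proof -
  have add: "map_poly of_int (p + q) = map_poly of_int p + (map_poly of_int q :: rat poly)" for p q
    by (rule poly_eqI) (simp add: coeff_map_poly)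
  have "map_poly of_int (smult c p) = smult (of_int c) (map_poly of_int p :: rat poly)" for c p
    by (rule poly_eqI) (simp add: coeff_map_poly)
  then show ?thesis by (induction p) (simp_all add: map_poly_pCons add)
qed

lemma min_rat_poly:
  assumes "rpoly g x = 0" "g \<noteq> 0"
  obtains f where "lead_coeff f = 1" "rpoly f x = 0" "\<And>h. rpoly h x = 0 \<Longrightarrow> f dvd h" "irreducible f"
proof -
  define n where "n = (LEAST n. \<exists>f. f \<noteq> 0 \<and> rpoly f x = 0 \<and> degree f = n)"
  have "\<exists>n f. f \<noteq> 0 \<and> rpoly f x = 0 \<and> degree f = n" using assms by blast
  then have "\<exists>f. f \<noteq> 0 \<and> rpoly f x = 0 \<and> degree f = n"
    unfolding n_def by (rule LeastI_ex)
  then obtain f0 where f0: "f0 \<noteq> 0" "rpoly f0 x = 0" "degree f0 = n" by blast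
  define f where "f = smult (inverse (lead_coeff f0)) f0"
  have f: "lead_coeff f = 1" "rpoly f x = 0" "degree f = n" "f \<noteq> 0"
    using f0 by (auto simp: f_def rpoly_smult)
  have least: "n \<le> degree h" if "rpoly h x = 0" "h \<noteq> 0" for h
    unfolding n_def by (rule Least_le) (use that in blast)
  have dvd: "f dvd h" if "rpoly h x = 0" for h
  proof -
    have "rpoly (h mod f) x = rpoly (h mod f + f * (h div f)) x"
      by (simp only: rpoly_add rpoly_mult f(2)) simp
    also have "\<dots> = 0" using that by simp
    finally have "rpoly (h mod f) x = 0" .
    then have "h mod f = 0" using least[of "h mod f"] degree_mod_less[OF f(4), of h] f(3) by fastforce
    then show ?thesis by auto
  qed
  have "irreducible f"
  proof (rule irreducibleI)
    show "\<not> is_unit f"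
    proof
      assume "is_unit f"
      then obtain c where "f = [:c:]" "c \<noteq> 0" by (auto simp: is_unit_poly_iff dvd_field_iff)
      then show False using f(2) by (simp add: map_poly_pCons)
    qed
    fix a b assume ab: "f = a * b"
    have *: "is_unit b" if "f = a * b" "rpoly a x = 0" for a b
    proof -
      have nz: "a \<noteq> 0" "b \<noteq> 0" using that f(4) by auto
      then have "n \<le> degree a" "n = degree a + degree b"
        using least[of a] that f(3) degree_mult_eq[of a b] by auto
      then have "degree b = 0" by simp
      then show ?thesis using nz by (simp add: is_unit_iff_degree)
    qed
    have "rpoly a x = 0 \<or> rpoly b x = 0" using f(2) by (simp add: ab rpoly_mult)
    then show "is_unit a \<or> is_unit b" using *[of a b] *[of b a] ab by (auto simp: mult.commute)
  qed (use f in auto)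
  then show thesis using that f dvd by blast
qed

lemma rat_poly_eq_smult_primitive:
  fixes f :: "rat poly"
  assumes "f \<noteq> 0"
  obtains c :: rat and F :: "int poly" where "f = smult c (map_poly of_int F)" "content F = 1"
proof -
  have "\<exists>d G. d \<noteq> 0 \<and> smult (of_int d) f = map_poly of_int G"
  proof (induction f)
    case 0
    show ?case by (intro exI[of _ 1] exI[of _ 0]) simp
  next
    case (pCons a f)
    then obtain d G where d: "d \<noteq> 0" "smult (of_int d) f = map_poly of_int G" by blast
    obtain n m where nm: "quotient_of a = (n, m)" by fastforce
    then have m: "m > 0" "a = of_int n / of_int m"
      using quotient_of_denom_pos quotient_of_div by auto
    have "smult (of_int (d * m)) (pCons a f) = pCons (of_int (d * n)) (smult (of_int m) (smult (of_int d) f))"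
      using m by (simp add: mult_ac)
    also have "\<dots> = map_poly of_int (pCons (d * n) (smult m G))"
      by (rule poly_eqI) (auto simp: d(2) coeff_map_poly coeff_pCons split: nat.splits)
    finally show ?case using d m by (intro exI[of _ "d * m"]) auto
  qed
  then obtain d G where d: "d \<noteq> 0" "smult (of_int d) f = map_poly of_int G" by blast
  have G: "G \<noteq> 0" using d assms by (metis map_poly_0 of_int_eq_0_iff smult_eq_0_iff)
  have "smult (of_int d) f = smult (of_int (content G)) (map_poly of_int (primitive_part G))"
    unfolding d(2) by (subst content_times_primitive_part[of G, symmetric], rule poly_eqI)
      (simp add: coeff_map_poly del: content_times_primitive_part)
  then have "f = smult (of_int (content G) / of_int d) (map_poly of_int (primitive_part G))"
    using d(1) by (metis (no_types, lifting) divide_inverse_commute left_inverse of_int_eq_0_iff smult_1_left smult_smult)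
  then show thesis using that content_primitive_part[OF G] by blast
qed

text \<open>Gauss's lemma: f and its cofactor are rational multiples of primitive integer
  polynomials F and H, whose product is again primitive. Comparing contents gives p = F * H up to
  sign, so both leading coefficients are units.\<close>

lemma monic_rat_factor_integral:
  fixes f :: "rat poly" and p :: "int poly"
  assumes p: "lead_coeff p = 1" and f: "lead_coeff f = 1" and dvd: "f dvd map_poly of_int p"
  obtains F where "f = map_poly of_int F" "lead_coeff F = 1"
proof -
  from dvd obtain g where g: "map_poly of_int p = f * g" by blast
  have "p \<noteq> 0" using p by auto
  then have "map_poly of_int p \<noteq> (0 :: rat poly)" by (simp add: map_poly_eq_0_iff)
  then have nz: "f \<noteq> 0" "g \<noteq> 0" using g by auto
  obtain c F where F: "f = smult c (map_poly of_int F)" "content F = 1"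
    by (rule rat_poly_eq_smult_primitive[OF nz(1)])
  obtain c' H where H: "g = smult c' (map_poly of_int H)" "content H = 1"
    by (rule rat_poly_eq_smult_primitive[OF nz(2)])
  obtain u v where uv: "quotient_of (c * c') = (u, v)" by fastforce
  then have v: "v > 0" "c * c' = of_int u / of_int v"
    using quotient_of_denom_pos quotient_of_div by auto
  have "map_poly of_int p = smult (c * c') (map_poly of_int (F * H) :: rat poly)"
    by (simp add: g F(1) H(1) map_poly_of_int_mult mult.commute)
  then have "coeff (map_poly of_int p) i = coeff (smult (c * c') (map_poly of_int (F * H) :: rat poly)) i" for i
    by simp
  then have "of_int (v * coeff p i) = (of_int (u * coeff (F * H) i) :: rat)" for i
    using v by (simp add: coeff_map_poly field_simps)
  then have "smult v p = smult u (F * H)"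
    by (intro poly_eqI) (simp only: of_int_eq_iff coeff_smult)
  moreover have "content p = 1"
    using p content_dvd_coeff[of p "degree p"] is_unit_content_iff[of p] by metis
  moreover from calculation(1) have "normalize v * content p = normalize u * (content F * content H)"
    by (metis content_mult content_smult)
  ultimately have "\<bar>v\<bar> = \<bar>u\<bar>" using F(2) H(2) by simp
  then have cases: "u = v \<or> u = - v" by auto
  have "smult v p = smult v (F * H) \<or> smult v p = smult v (- (F * H))"
    using cases \<open>smult v p = smult u (F * H)\<close> by auto
  then have "p = F * H \<or> p = - (F * H)" using v(1)
    by (metis smult_cancel less_irrefl)
  then have "lead_coeff F * lead_coeff H = 1 \<or> lead_coeff F * lead_coeff H = - 1"
    using p by (auto simp: lead_coeff_mult)
  then have "lead_coeff F = 1 \<or> lead_coeff F = - 1"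
    by (metis dvd_triv_left dvd_minus_iff zdvd1_eq abs_eq_iff' abs_1)
  moreover have "c * of_int (lead_coeff F) = 1"
  proof -
    have "c \<noteq> 0" using F(1) nz(1) by auto
    moreover have "degree (map_poly of_int F :: rat poly) = degree F"
      by (rule map_poly_degree_eq) (use F(1) nz(1) in auto)
    ultimately show ?thesis using f by (simp add: F(1) coeff_map_poly)
  qed
  ultimately have c: "c = of_int (lead_coeff F)" "lead_coeff F * lead_coeff F = 1" by auto
  show thesis
  proof (rule that[of "smult (lead_coeff F) F"])
    show "f = map_poly of_int (smult (lead_coeff F) F)"
      unfolding F(1) c(1) by (rule poly_eqI) (simp add: coeff_map_poly)
    show "lead_coeff (smult (lead_coeff F) F) = 1" using c(2) by (cases "F = 0") auto
  qed
qed

text \<open>The derivative does not vanish at \<theta>, since its degree is too small for F to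
  divide it. Simplicity of this root keeps \<theta> out of the multiset of the remaining roots,
  which must all have modulus below 1.\<close>

lemma pisot_min_poly:
  assumes "pisot \<theta>"
  obtains F :: "int poly" where "lead_coeff F = 1" "poly (map_poly of_int F) \<theta> = 0"
    "\<And>z :: complex. poly (map_poly of_int F) z = 0 \<Longrightarrow> z \<noteq> complex_of_real \<theta> \<Longrightarrow> norm z < 1"
    "poly (pderiv (map_poly of_int F)) \<theta> \<noteq> 0"
    "\<And>h. rpoly h \<theta> = 0 \<Longrightarrow> map_poly of_int F dvd h" "irreducible (map_poly of_int F :: rat poly)"
proof -
  obtain p :: "int poly" where p: "poly (map_poly of_int p) \<theta> = 0" "lead_coeff p = 1"
    using assms by (auto simp: pisot_def algebraic_int_altdef_ipoly)
  have p0: "p \<noteq> 0" using p by auto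
  have rp: "rpoly (map_poly of_int p) \<theta> = 0" using p(1) by (simp add: rpoly_of_int_poly)
  have "map_poly of_int p \<noteq> (0 :: rat poly)" using p0 by (simp add: map_poly_eq_0_iff)
  then obtain f where f: "lead_coeff f = 1" "rpoly f \<theta> = 0" "\<And>h. rpoly h \<theta> = 0 \<Longrightarrow> f dvd h" "irreducible f"
    using min_rat_poly[OF rp] by metis
  obtain F where F: "f = map_poly of_int F" "lead_coeff F = 1"
    by (rule monic_rat_factor_integral[OF p(2) f(1) f(3)[OF rp]])
  have "rpoly (pderiv f) \<theta> \<noteq> 0"
  proof
    assume "rpoly (pderiv f) \<theta> = 0"
    then have "f dvd pderiv f" by (rule f(3))
    moreover have "degree f \<noteq> 0"
    proof
      assume "degree f = 0"
      then obtain c where "f = [:c:]" by (rule degree_eq_zeroE)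
      then show False using f(1,2) by (simp add: map_poly_pCons)
    qed
    ultimately show False
      using dvd_imp_degree_le[of f "pderiv f"] by (simp add: pderiv_eq_0_iff degree_pderiv)
  qed
  moreover have "map_poly of_rat (pderiv f) = pderiv (map_poly of_int F :: real poly)"
    by (rule poly_eqI) (simp add: F(1) coeff_map_poly coeff_pderiv of_rat_mult of_rat_add)
  moreover have "norm z < 1" if "poly (map_poly of_int F) z = 0" "z \<noteq> complex_of_real \<theta>" for z :: complex
  proof -
    have "conjugate_over_rat \<theta> z"
      unfolding conjugate_over_rat_def using f that(1) by (intro exI[of _ f]) (simp add: F rpoly_of_int_poly)
    then show ?thesis using assms that(2) by (auto simp: pisot_def)
  qed
  ultimately show thesis using that[of F] f F by (simp add: rpoly_of_int_poly)
qed

lemma pisot_factorization: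
  assumes "pisot \<theta>"
  obtains F :: "int poly" and B :: "complex multiset" where
    "lead_coeff F = 1" "poly (map_poly of_int F) \<theta> = 0"
    "\<And>h. rpoly h \<theta> = 0 \<Longrightarrow> map_poly of_int F dvd h" "irreducible (map_poly of_int F :: rat poly)"
    "map_poly of_int F = [:- complex_of_real \<theta>, 1:] * (\<Prod>x\<in>#B. [:-x, 1:])"
    "\<And>x. x \<in># B \<Longrightarrow> norm x < 1" "degree F = Suc (size B)"
proof -
  obtain F :: "int poly" where F: "lead_coeff F = 1" "poly (map_poly of_int F) \<theta> = 0"
    "\<And>z :: complex. poly (map_poly of_int F) z = 0 \<Longrightarrow> z \<noteq> complex_of_real \<theta> \<Longrightarrow> norm z < 1"
    "poly (pderiv (map_poly of_int F)) \<theta> \<noteq> 0"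
    "\<And>h. rpoly h \<theta> = 0 \<Longrightarrow> map_poly of_int F dvd h" "irreducible (map_poly of_int F :: rat poly)"
    using pisot_min_poly[OF assms] by metis
  let ?Q = "map_poly of_int F :: complex poly"
  have lc: "lead_coeff ?Q = 1" using F(1) by (simp add: coeff_map_poly degree_map_poly)
  have "?Q \<noteq> 0" using lc by auto
  then obtain A where A: "size A = degree ?Q" "?Q = smult (lead_coeff ?Q) (\<Prod>x\<in>#A. [:-x, 1:])"
    using alg_closed_imp_factorization by blast
  have Q: "?Q = (\<Prod>x\<in>#A. [:-x, 1:])" using A(2) lc by simp
  have root: "poly ?Q z = 0 \<longleftrightarrow> z \<in># A" for z
    by (auto simp: Q poly_prod_mset prod_mset_zero_iff)
  have "poly ?Q (complex_of_real \<theta>) = 0" using F(2) by (simp add: poly_of_int_poly_of_real)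
  then obtain B where B: "A = add_mset (complex_of_real \<theta>) B" using root by (metis insert_DiffM)
  then have QB: "?Q = [:- complex_of_real \<theta>, 1:] * (\<Prod>x\<in>#B. [:-x, 1:])" by (simp add: Q)
  have pd: "poly (pderiv ?Q) (complex_of_real \<theta>) \<noteq> 0"
  proof -
    have "pderiv ?Q = map_poly of_int (pderiv F)" "pderiv (map_poly of_int F) = (map_poly of_int (pderiv F) :: real poly)"
      by (rule poly_eqI; simp add: coeff_map_poly coeff_pderiv)+
    then have "poly (pderiv ?Q) (complex_of_real \<theta>) = complex_of_real (poly (pderiv (map_poly of_int F)) \<theta>)"
      by (simp add: poly_of_int_poly_of_real)
    then show ?thesis using F(4) by simp
  qed
  have "complex_of_real \<theta> \<notin># B"
  proof
    assume "complex_of_real \<theta> \<in># B"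
    then have "poly (\<Prod>x\<in>#B. [:-x, 1:]) (complex_of_real \<theta>) = 0"
      by (auto simp: poly_prod_mset prod_mset_zero_iff)
    then show False using pd unfolding QB pderiv_mult by simp
  qed
  then have "norm x < 1" if "x \<in># B" for x
    using F(3)[of x] root[of x] that by (auto simp: B)
  moreover have "degree F = Suc (size B)" using A(1) by (simp add: B degree_map_poly)
  ultimately show thesis using that F QB by blast
qed

text \<open>If \<theta>^j = w is rational, the minimal polynomial divides X^j - w, so every
  conjugate has modulus \<theta> > 1. The Pisot property then leaves no conjugate besides \<theta>,
  and the minimal polynomial is linear.\<close>

lemma pisot_power_rational:
  assumes "pisot \<theta>" and "j \<ge> 1" and "\<theta> ^ j \<in> \<rat>"
  obtains n :: int where "\<theta> = of_int n"
proof -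
  obtain F B where F: "lead_coeff F = 1" "poly (map_poly of_int F) \<theta> = 0"
    "\<And>h. rpoly h \<theta> = 0 \<Longrightarrow> map_poly of_int F dvd h"
    "map_poly of_int F = [:- complex_of_real \<theta>, 1:] * (\<Prod>x\<in>#B. [:-x, 1:])"
    "\<And>x. x \<in># B \<Longrightarrow> norm x < 1" "degree F = Suc (size B)"
    using pisot_factorization[OF assms(1)] by metis
  obtain w where w: "\<theta> ^ j = of_rat w" using assms(3) by (auto elim: Rats_cases)
  have \<theta>: "\<theta> > 1" using assms(1) by (simp add: pisot_def)
  define h where "h = monom 1 j - [:w:]"
  have h: "rpoly h x = x ^ j - of_rat w" for x :: "'a :: field_char_0"
    by (simp add: h_def rpoly_diff map_poly_monom poly_monom map_poly_pCons)
  have "map_poly of_int F dvd h" by (rule F(3)) (simp add: h w)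
  then obtain g where g: "h = map_poly of_int F * g" by blast
  have "z \<notin># B" for z
  proof
    assume z: "z \<in># B"
    then have "poly (map_poly of_int F) z = 0"
      unfolding F(4) by (auto simp: poly_prod_mset prod_mset_zero_iff)
    then have "rpoly h z = 0" by (simp add: g rpoly_mult rpoly_of_int_poly)
    then have "z ^ j = of_rat w" by (simp add: h)
    also have "\<dots> = complex_of_real (\<theta> ^ j)" unfolding w by (simp add: of_real_of_rat)
    finally have "norm (z ^ j) = \<bar>\<theta> ^ j\<bar>" by (metis norm_of_real)
    then have "norm z ^ j = \<theta> ^ j" using \<theta> by (simp add: norm_power)
    moreover have "norm z ^ j \<le> 1" using F(5)[OF z] by (simp add: power_le_one)
    moreover have "1 < \<theta> ^ j" using \<theta> assms(2) by (simp add: one_less_power)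
    ultimately show False by linarith
  qed
  then have "B = {#}" by (simp add: multiset_eq_iff not_in_iff)
  then have d: "degree F = 1" using F(6) by simp
  then have "F = [:coeff F 0, 1:]"
    using F(1) by (intro poly_eqI) (auto simp: coeff_pCons coeff_eq_0 split: nat.splits)
  then obtain c where "F = [:c, 1:]" by blast
  then have "of_int c + \<theta> = 0" using F(2) by (simp add: map_poly_pCons)
  then show thesis using that[of "- c"] by simp
qed

text \<open>The field generated by \<theta> consists of rational polynomials in \<theta>, with
  inverses from Bezout's identity; q clears denominators. It is 1/r that must be such a polynomial:
  applied to the integer sequence h it yields integers T m with r T m close to q \<kappa>
  \<theta>^m.\<close>

lemma rat_adjoin_inverse:
  assumes pis: "pisot \<theta>" and r: "r \<in> rat_adjoin \<theta>" "r \<noteq> 0"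
  obtains q :: int and R :: "int poly" where "q > 0" "of_int q / r = poly (map_poly of_int R) \<theta>"
proof -
  obtain F :: "int poly" where F: "lead_coeff F = 1" "poly (map_poly of_int F) \<theta> = 0"
    "\<And>h. rpoly h \<theta> = 0 \<Longrightarrow> map_poly of_int F dvd h" "irreducible (map_poly of_int F :: rat poly)"
    using pisot_min_poly[OF pis] by metis
  let ?f = "map_poly of_int F :: rat poly"
  have f0: "rpoly ?f \<theta> = 0" using F(2) by (simp add: rpoly_of_int_poly)
  define L where "L = {rpoly g \<theta> |g. True}"
  have Linv: "inverse x \<in> L" if x: "x \<in> L" "x \<noteq> 0" for x
  proof -
    obtain g where g: "x = rpoly g \<theta>" using x by (auto simp: L_def)
    \<comment> \<open>The nonzero elements of the ideal generated by the minimal polynomial and g;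
      one of least degree divides all of them, and irreducibility makes it a unit.\<close>
    define I where "I = {h. h \<noteq> 0 \<and> (\<exists>u v. h = u * ?f + v * g)}"
    have "g \<noteq> 0" using x g by auto
    moreover have "g = 0 * ?f + 1 * g" by simp
    ultimately have "g \<in> I" unfolding I_def by blast
    then have "\<exists>h. h \<in> I" by blast
    then obtain d where d: "d \<in> I" "\<And>h. h \<in> I \<Longrightarrow> degree d \<le> degree h"
      using ex_has_least_nat[of "\<lambda>h. h \<in> I" _ degree] by metis
    obtain u v where uv: "d = u * ?f + v * g" "d \<noteq> 0" using d(1) by (auto simp: I_def)
    have dd: "d dvd h" if "h = u' * ?f + v' * g" for h u' v'
    proof (rule ccontr)
      assume "\<not> d dvd h"
      then have nz: "h mod d \<noteq> 0" by (auto simp: dvd_eq_mod_eq_0)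
      have "h mod d = h - (h div d) * d" by (simp add: minus_div_mult_eq_mod)
      also have "\<dots> = (u' - (h div d) * u) * ?f + (v' - (h div d) * v) * g"
        unfolding uv(1) by (subst (1) that) (simp add: algebra_simps)
      finally have "h mod d \<in> I" using nz unfolding I_def by blast
      then have "degree d \<le> degree (h mod d)" by (rule d(2))
      then show False using degree_mod_less[OF uv(2), of h] nz by auto
    qed
    have "d dvd ?f" by (rule dd[of _ 1 0]) simp
    moreover have "d dvd g" by (rule dd[of _ 0 1]) simp
    ultimately have "is_unit d"
    proof -
      obtain e where e: "?f = d * e" using \<open>d dvd ?f\<close> by blast
      have "is_unit d \<or> is_unit e" using irreducibleD[OF F(4) e] .
      moreover have "\<not> is_unit e"
      proof
        assume "is_unit e"
        then have "?f dvd d" unfolding e by (metis dvd_refl mult_unit_dvd_iff)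
        then have "?f dvd g" using \<open>d dvd g\<close> dvd_trans by blast
        then have "x = 0" using f0 unfolding g by (auto simp: rpoly_mult)
        then show False using x by simp
      qed
      ultimately show ?thesis by blast
    qed
    then obtain e where e: "d * e = 1" by (metis dvdE)
    have "rpoly (d * e) \<theta> = rpoly (v * e) \<theta> * x"
      unfolding uv(1) rpoly_mult rpoly_add f0 g by simp
    then have "rpoly (v * e) \<theta> * x = 1" by (simp add: e)
    then have "inverse x = rpoly (v * e) \<theta>" by (metis inverse_unique mult.commute)
    then show ?thesis by (auto simp: L_def)
  qed
  have "real_subfield L"
    unfolding real_subfield_def
  proof (intro conjI ballI impI)
    show "0 \<in> L" unfolding L_def by (auto intro!: exI[of _ 0])
    show "1 \<in> L" unfolding L_def by (auto intro!: exI[of _ 1])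
    fix x y assume "x \<in> L" "y \<in> L"
    then obtain g h where gh: "x = rpoly g \<theta>" "y = rpoly h \<theta>" by (auto simp: L_def)
    show "x - y \<in> L" unfolding L_def gh rpoly_diff[symmetric] by blast
    show "x * y \<in> L" unfolding L_def gh rpoly_mult[symmetric] by blast
  qed (rule Linv)
  moreover have "insert \<theta> \<rat> \<subseteq> L"
  proof -
    have "rpoly [:c:] \<theta> = of_rat c" "rpoly [:0, 1:] \<theta> = \<theta>" for c by (simp_all add: map_poly_pCons)
    then show ?thesis unfolding L_def by (auto elim!: Rats_cases) metis+
  qed
  ultimately have "rat_adjoin \<theta> \<subseteq> L" unfolding rat_adjoin_def by (intro hull_minimal)
  then have "inverse r \<in> L" using Linv r by blast
  then obtain g where g: "inverse r = rpoly g \<theta>" by (auto simp: L_def)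
  have "g \<noteq> 0" using g r(2) by auto
  then obtain c G where G: "g = smult c (map_poly of_int G)"
    using rat_poly_eq_smult_primitive by metis
  obtain n m where nm: "quotient_of c = (n, m)" by fastforce
  then have m: "m > 0" "c = of_int n / of_int m"
    using quotient_of_denom_pos quotient_of_div by auto
  have "of_int m / r = of_int m * rpoly g \<theta>" using g by (simp add: divide_inverse)
  also have "\<dots> = of_int n * poly (map_poly of_int G) \<theta>"
    using m by (simp add: G rpoly_smult rpoly_of_int_poly of_rat_divide)
  also have "\<dots> = poly (map_poly of_int (smult n G)) \<theta>"
    by (simp add: map_poly_smult)
  finally show thesis using that m(1) by blast
qed

section \<open>An integer sequence asymptotic to the powers of a Pisot number\<close>

lemma inverse_fps_one_minus: "inverse (fps_of_poly [:1, -a:]) = Abs_fps (\<lambda>n. a ^ n)"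
  for a :: complex
proof (rule fps_inverse_unique)
  show "fps_of_poly [:1, -a:] * Abs_fps (\<lambda>n. a ^ n) = 1"
  proof (rule fps_ext)
    fix n show "fps_nth (fps_of_poly [:1, -a:] * Abs_fps (\<lambda>n. a ^ n)) n = fps_nth 1 n"
      by (cases n) (simp_all add: fps_of_poly_linear' distrib_right mult.assoc)
  qed
qed

text \<open>Each factor convolves the coefficients with the powers of a. A new rate \<sigma>
  strictly above the modulus of a turns the convolution into a convergent geometric sum, so repeated
  roots cost no polynomial factor.\<close>

lemma inverse_fps_coeff_decay:
  fixes A :: "complex multiset"
  assumes "\<And>a. a \<in># A \<Longrightarrow> norm a < 1"
  shows "\<exists>C \<rho>. 0 < \<rho> \<and> \<rho> < 1 \<and> 0 \<le> C \<and>
    (\<forall>n. norm (fps_nth (inverse (fps_of_poly (\<Prod>a\<in>#A. [:1, -a:]))) n) \<le> C * \<rho> ^ n)"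
  using assms
proof (induction A)
  case empty
  have "norm (fps_nth (inverse (fps_of_poly (\<Prod>a\<in>#({#} :: complex multiset). [:1, -a:]))) n) \<le> 1 * (1/2) ^ n" for n :: nat
  proof -
    have "inverse (1 :: complex fps) = 1" by (rule fps_inverse_unique) simp
    then show ?thesis by simp
  qed
  then show ?case by (intro exI[of _ 1] exI[of _ "1/2"]) simp
next
  case (add a A)
  define g where "g = inverse (fps_of_poly (\<Prod>a\<in>#A. [:1, -a:]))"
  obtain C \<rho> where C: "0 < \<rho>" "\<rho> < 1" "0 \<le> C" "\<And>n. norm (fps_nth g n) \<le> C * \<rho> ^ n"
    using add unfolding g_def by force
  define \<sigma> where "\<sigma> = max \<rho> ((1 + norm a) / 2)"
  have a: "norm a < 1" using add by simp
  have \<sigma>: "\<rho> \<le> \<sigma>" "norm a < \<sigma>" "0 < \<sigma>" "\<sigma> < 1"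
    using a C by (auto simp: \<sigma>_def less_max_iff_disj field_simps)
  define D where "D = C * (1 / (1 - norm a / \<sigma>))"
  have q: "norm a / \<sigma> < 1" "0 \<le> norm a / \<sigma>" using \<sigma> by (auto simp: field_simps)
  have inv: "inverse (fps_of_poly (\<Prod>a\<in>#add_mset a A. [:1, -a:])) = Abs_fps (\<lambda>n. a ^ n) * g"
    by (simp only: image_mset_add_mset prod_mset.add_mset fps_of_poly_mult fps_inverse_mult
        inverse_fps_one_minus g_def)
  have "norm (fps_nth (Abs_fps (\<lambda>n. a ^ n) * g) n) \<le> D * \<sigma> ^ n" for n
  proof -
    have "norm (fps_nth (Abs_fps (\<lambda>n. a ^ n) * g) n) \<le> (\<Sum>i=0..n. norm (a ^ i * fps_nth g (n - i)))"
      unfolding fps_mult_nth by (simp add: norm_sum)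
    also have "\<dots> \<le> (\<Sum>i=0..n. (C * \<sigma> ^ n) * (norm a / \<sigma>) ^ i)"
    proof (rule sum_mono)
      fix i assume i: "i \<in> {0..n}"
      have "norm (fps_nth g (n - i)) \<le> C * \<sigma> ^ (n - i)"
        using C(4)[of "n - i"] mult_left_mono[OF power_mono[OF \<sigma>(1), of "n - i"] C(3)] C(1) by linarith
      then have "norm (a ^ i * fps_nth g (n - i)) \<le> norm a ^ i * (C * \<sigma> ^ (n - i))"
        by (simp add: norm_mult norm_power mult_left_mono)
      also have "\<dots> = (C * \<sigma> ^ n) * (norm a / \<sigma>) ^ i"
        using i \<sigma> by (simp add: power_diff power_divide)
      finally show "norm (a ^ i * fps_nth g (n - i)) \<le> (C * \<sigma> ^ n) * (norm a / \<sigma>) ^ i" .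
    qed
    also have "\<dots> = (C * \<sigma> ^ n) * (\<Sum>i\<in>{0..n}. (norm a / \<sigma>) ^ i)" by (simp only: sum_distrib_left)
    also have "\<dots> \<le> (C * \<sigma> ^ n) * (\<Sum>i. (norm a / \<sigma>) ^ i)"
      by (intro mult_left_mono sum_le_suminf) (use q C \<sigma> in auto)
    also have "(\<Sum>i. (norm a / \<sigma>) ^ i) = 1 / (1 - norm a / \<sigma>)" using q by (simp add: suminf_geometric)
    finally show ?thesis by (simp add: D_def mult_ac)
  qed
  moreover have "0 \<le> D" using C q by (simp add: D_def)
  ultimately show ?case using \<sigma> unfolding inv by blast
qed

lemma reflect_poly_linear: "reflect_poly [:-a, 1:] = [:1, -a:]" for a :: complex
  by (rule poly_eqI) (auto simp: coeff_reflect_poly coeff_pCons split: nat.splits)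

lemma reflect_poly_prod_linear:
  "reflect_poly (\<Prod>a\<in>#A. [:-a, 1:]) = (\<Prod>a\<in>#A. [:1, -a:])" for A :: "complex multiset"
  by (induction A) (simp_all add: reflect_poly_mult reflect_poly_linear del: mult_pCons_left mult_pCons_right)

text \<open>\<kappa> is the value of the series g at 1/\<theta>. Up to the factor \<theta>^m the
  coefficient is a partial sum of that value, so the error is the tail of the series.\<close>

lemma fps_geometric_convolution_asymp:
  fixes g :: "complex fps" and \<theta> :: real
  assumes \<theta>: "1 < \<theta>" and \<rho>: "0 < \<rho>" "\<rho> < 1" and g: "\<And>n. norm (fps_nth g n) \<le> C * \<rho> ^ n"
  obtains \<kappa> :: complex where
    "\<And>m. norm (fps_nth (g * Abs_fps (\<lambda>n. complex_of_real \<theta> ^ n)) m - \<kappa> * complex_of_real \<theta> ^ m) \<le> C * (1 / (1 - \<rho>)) * \<rho> ^ m"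
proof -
  let ?t = "complex_of_real \<theta>"
  have C: "0 \<le> C" using order_trans[OF norm_ge_zero g[of 0]] by simp
  have bd: "norm (fps_nth g (n + m) / ?t ^ n) \<le> (C * \<rho> ^ m) * \<rho> ^ n" for n m
  proof -
    have "norm (fps_nth g (n + m) / ?t ^ n) \<le> (C * \<rho> ^ (n + m)) / 1"
      unfolding norm_divide by (rule frac_le) (use g C \<rho> \<theta> in \<open>auto simp: norm_power\<close>)
    then show ?thesis by (simp add: power_add mult_ac)
  qed
  have summ: "summable (\<lambda>n. fps_nth g (n + m) / ?t ^ n)" for m
    by (rule summable_comparison_test'[where N = 0 and g = "\<lambda>n. (C * \<rho> ^ m) * \<rho> ^ n"])
      (use bd \<rho> in \<open>auto intro: summable_mult summable_geometric\<close>)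
  define \<kappa> where "\<kappa> = (\<Sum>n. fps_nth g n / ?t ^ n)"
  have "norm (fps_nth (g * Abs_fps (\<lambda>n. ?t ^ n)) m - \<kappa> * ?t ^ m) \<le> C * (1 / (1 - \<rho>)) * \<rho> ^ m" for m
  proof -
    have t0: "?t \<noteq> 0" using \<theta> by simp
    have s0: "summable (\<lambda>n. fps_nth g n / ?t ^ n)" using summ[of 0] by simp
    have "\<kappa> = (\<Sum>n. fps_nth g (n + Suc m) / ?t ^ (n + Suc m)) + (\<Sum>n<Suc m. fps_nth g n / ?t ^ n)"
      unfolding \<kappa>_def by (rule suminf_split_initial_segment[OF s0])
    also have "(\<Sum>n. fps_nth g (n + Suc m) / ?t ^ (n + Suc m)) = (\<Sum>n. fps_nth g (n + Suc m) / ?t ^ n) / ?t ^ Suc m"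
      by (simp only: suminf_divide[OF summ[of "Suc m"], symmetric] power_add divide_divide_eq_left)
    finally have split: "\<kappa> = (\<Sum>n. fps_nth g (n + Suc m) / ?t ^ n) / ?t ^ Suc m + (\<Sum>n<Suc m. fps_nth g n / ?t ^ n)" .
    have "\<kappa> * ?t ^ m = (\<Sum>n. fps_nth g (n + Suc m) / ?t ^ n) / ?t + (\<Sum>n<Suc m. fps_nth g n / ?t ^ n) * ?t ^ m"
      unfolding split distrib_right by (simp add: t0 del: sum.lessThan_Suc)
    moreover have "fps_nth (g * Abs_fps (\<lambda>n. ?t ^ n)) m = (\<Sum>n<Suc m. fps_nth g n / ?t ^ n) * ?t ^ m"
      unfolding fps_mult_nth sum_distrib_right
    proof (rule sum.cong)
      fix i assume "i \<in> {..<Suc m}"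
      then have "?t ^ m = ?t ^ (m - i) * ?t ^ i" by (simp flip: power_add)
      then show "fps_nth g i * fps_nth (Abs_fps (\<lambda>n. ?t ^ n)) (m - i) = fps_nth g i / ?t ^ i * ?t ^ m"
        using t0 by simp
    qed auto
    ultimately have "norm (fps_nth (g * Abs_fps (\<lambda>n. ?t ^ n)) m - \<kappa> * ?t ^ m)
        = norm (\<Sum>n. fps_nth g (n + Suc m) / ?t ^ n) / \<theta>"
      using \<theta> by (simp add: norm_divide)
    also have "\<dots> \<le> (\<Sum>n. (C * \<rho> ^ Suc m) * \<rho> ^ n) / 1"
    proof (rule frac_le)
      show "norm (\<Sum>n. fps_nth g (n + Suc m) / ?t ^ n) \<le> (\<Sum>n. (C * \<rho> ^ Suc m) * \<rho> ^ n)"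
        by (rule norm_suminf_le[OF bd]) (use \<rho> in \<open>auto intro: summable_mult summable_geometric\<close>)
    qed (use \<theta> C \<rho> in \<open>auto intro!: suminf_nonneg summable_mult summable_geometric\<close>)
    also have "\<dots> = C * (1 / (1 - \<rho>)) * \<rho> ^ m * \<rho>"
      using \<rho> by (simp add: suminf_mult summable_geometric suminf_geometric)
    also have "\<dots> \<le> C * (1 / (1 - \<rho>)) * \<rho> ^ m * 1"
      by (intro mult_left_mono) (use C \<rho> in auto)
    finally show ?thesis by simp
  qed
  then show thesis using that by blast
qed

text \<open>p is the reversed minimal polynomial and h the coefficient sequence of its reciprocal
  power series, integral because p 0 = 1. The pole at 1/\<theta> contributes \<kappa> \<theta>^m;
  any other pole lies outside the closed unit disc. If \<kappa> were 0, the integers h m would tend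
  to 0 and eventually vanish, so the reciprocal would be a polynomial although p vanishes at
  1/\<theta>.\<close>

lemma pisot_integer_sequence:
  assumes "pisot \<theta>"
  obtains p h :: "nat \<Rightarrow> int" and d :: nat and \<kappa> C \<rho> :: real where
    "p 0 = 1" "\<And>i. i > d \<Longrightarrow> p i = 0" "(\<Sum>i\<le>d. of_int (p i) / \<theta> ^ i) = 0"
    "\<And>m. (\<Sum>i\<le>m. p i * h (m - i)) = (if m = 0 then 1 else 0)"
    "0 < \<rho>" "\<rho> < 1" "0 \<le> C" "\<And>m. \<bar>of_int (h m) - \<kappa> * \<theta> ^ m\<bar> \<le> C * \<rho> ^ m" "\<kappa> \<noteq> 0"
proof -
  obtain F B where F: "lead_coeff F = 1" "poly (map_poly of_int F) \<theta> = 0"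
    "map_poly of_int F = [:- complex_of_real \<theta>, 1:] * (\<Prod>x\<in>#B. [:-x, 1:])"
    "\<And>x. x \<in># B \<Longrightarrow> norm x < 1"
    using pisot_factorization[OF assms] by metis
  have \<theta>: "\<theta> > 1" using assms by (simp add: pisot_def)
  let ?t = "complex_of_real \<theta>"
  let ?Q = "map_poly of_int F :: complex poly"
  define d where "d = degree F"
  define p where "p = coeff (reflect_poly F)"
  have p0: "p 0 = 1" using F(1) by (simp add: p_def)
  have pd: "p i = 0" if "i > d" for i using that by (simp add: p_def d_def coeff_reflect_poly)
  have degQ: "degree ?Q = d" by (simp add: d_def degree_map_poly)
  have rQ: "coeff (reflect_poly ?Q) i = of_int (p i)" for i
    by (simp add: p_def coeff_reflect_poly degQ d_def coeff_map_poly)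
  have rQ': "reflect_poly ?Q = (\<Prod>x\<in>#B. [:1, -x:]) * [:1, -?t:]"
    unfolding F(3) by (simp only: reflect_poly_mult reflect_poly_linear reflect_poly_prod_linear mult.commute)
  have sum0: "(\<Sum>i\<le>d. of_int (p i) / \<theta> ^ i) = 0"
  proof -
    have "(\<Sum>i\<le>d. of_int (p i) / \<theta> ^ i) = (\<Sum>i\<le>d. of_int (p (d - i)) / \<theta> ^ (d - i))"
      by (rule sum.nat_diff_reindex[symmetric, of "\<lambda>i. of_int (p i) / \<theta> ^ i" "Suc d", simplified lessThan_Suc_atMost diff_Suc_Suc, simplified])
    also have "\<dots> = (\<Sum>i\<le>d. of_int (coeff F i) * \<theta> ^ i) / \<theta> ^ d"
      unfolding sum_divide_distrib
      by (rule sum.cong) (use \<theta> in \<open>auto simp: p_def coeff_reflect_poly d_def power_diff field_simps\<close>)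
    also have "(\<Sum>i\<le>d. of_int (coeff F i) * \<theta> ^ i) = poly (map_poly of_int F) \<theta>"
      by (simp add: poly_altdef degree_map_poly coeff_map_poly d_def)
    finally show ?thesis using F(2) by simp
  qed
  define H where "H = inverse (fps_of_poly (reflect_poly ?Q))"
  have H1: "fps_of_poly (reflect_poly ?Q) * H = 1"
    unfolding H_def by (rule inverse_mult_eq_1') (simp only: fps_of_poly_nth rQ p0 of_int_1 one_neq_zero not_False_eq_True)
  have Hrec: "(\<Sum>i\<le>m. of_int (p i) * fps_nth H (m - i)) = (if m = 0 then 1 else 0)" for m
  proof -
    have "fps_nth (fps_of_poly (reflect_poly ?Q) * H) m = fps_nth 1 m" by (simp only: H1)
    then show ?thesis unfolding fps_mult_nth by (simp add: rQ atLeast0AtMost)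
  qed
  have "fps_nth H m \<in> \<int>" for m
  proof (induction m rule: less_induct)
    case (less m)
    have "(\<Sum>i\<le>m. of_int (p i) * fps_nth H (m - i)) = fps_nth H m + (\<Sum>i\<in>{1..m}. of_int (p i) * fps_nth H (m - i))"
      by (subst sum.remove[of _ 0]) (auto simp: p0 intro!: sum.cong)
    then have "fps_nth H m = (if m = 0 then 1 else 0) - (\<Sum>i\<in>{1..m}. of_int (p i) * fps_nth H (m - i))"
      using Hrec[of m] by (simp add: algebra_simps)
    moreover have "(\<Sum>i\<in>{1..m}. of_int (p i) * fps_nth H (m - i)) \<in> \<int>"
      by (intro Ints_sum Ints_mult less) auto
    ultimately show ?case by (auto intro: Ints_diff)
  qed
  then have "\<forall>m. \<exists>k. fps_nth H m = of_int k" by (blast elim: Ints_cases)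
  then obtain h where h: "\<And>m. fps_nth H m = of_int (h m)" using choice[of "\<lambda>m k. fps_nth H m = of_int k"] by blast
  have hrec: "(\<Sum>i\<le>m. p i * h (m - i)) = (if m = 0 then 1 else 0)" for m
  proof -
    have "complex_of_int (\<Sum>i\<le>m. p i * h (m - i)) = of_int (if m = 0 then 1 else 0)"
      using Hrec[of m] by (simp add: h)
    then show ?thesis by (simp only: of_int_eq_iff)
  qed
  define g where "g = inverse (fps_of_poly (\<Prod>x\<in>#B. [:1, -x:]))"
  have Hg: "H = g * Abs_fps (\<lambda>n. ?t ^ n)"
    unfolding H_def rQ' fps_of_poly_mult fps_inverse_mult inverse_fps_one_minus g_def ..
  obtain C0 \<rho> where C0: "0 < \<rho>" "\<rho> < 1" "0 \<le> C0" "\<And>n. norm (fps_nth g n) \<le> C0 * \<rho> ^ n"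
    using inverse_fps_coeff_decay[OF F(4), of B] unfolding g_def by blast
  define C where "C = C0 * (1 / (1 - \<rho>))"
  obtain \<kappa>c where \<kappa>c: "\<And>m. norm (fps_nth H m - \<kappa>c * ?t ^ m) \<le> C * \<rho> ^ m"
    using fps_geometric_convolution_asymp[OF \<theta> C0(1,2,4)] unfolding Hg C_def by blast
  define \<kappa> where "\<kappa> = Re \<kappa>c"
  have bound: "\<bar>of_int (h m) - \<kappa> * \<theta> ^ m\<bar> \<le> C * \<rho> ^ m" for m
  proof -
    have "Re (fps_nth H m - \<kappa>c * ?t ^ m) = of_int (h m) - \<kappa> * \<theta> ^ m"
      by (simp add: h \<kappa>_def flip: of_real_power)
    then show ?thesis using abs_Re_le_cmod[of "fps_nth H m - \<kappa>c * ?t ^ m"] \<kappa>c[of m] by linarith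
  qed
  have "\<kappa> \<noteq> 0"
  proof
    assume \<kappa>: "\<kappa> = 0"
    have "(\<lambda>m. C * \<rho> ^ m) \<longlonglongrightarrow> 0"
      using tendsto_mult_left[OF LIMSEQ_realpow_zero[of \<rho>], of C] C0 by simp
    then have "eventually (\<lambda>m. C * \<rho> ^ m < 1) sequentially"
      by (rule order_tendstoD) simp
    then obtain N where N: "\<And>m. m \<ge> N \<Longrightarrow> C * \<rho> ^ m < 1" by (auto simp: eventually_sequentially)
    have h0: "h m = 0" if "m \<ge> N" for m
    proof -
      have "\<bar>of_int (h m) :: real\<bar> < 1" using bound[of m] N[OF that] \<kappa> by simp
      then show ?thesis by linarith
    qed
    define P where "P = truncate_fps N H"
    have "fps_of_poly P = H"
      unfolding P_def fps_of_poly_truncate by (rule fps_ext) (simp add: h h0)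
    then have "fps_of_poly (reflect_poly ?Q * P) = fps_of_poly 1"
      using H1 by (simp add: fps_of_poly_mult)
    then have "reflect_poly ?Q * P = 1" by (simp only: fps_of_poly_eq_iff)
    then have "poly (reflect_poly ?Q * P) (1 / ?t) = 1" by simp
    then show False using \<theta> by (simp add: rQ')
  qed
  moreover have "0 \<le> C" using C0 by (simp add: C_def)
  ultimately show thesis using that[OF p0 pd sum0 hrec C0(1,2)] bound by blast
qed

section \<open>The Fourier transform of a Bernoulli convolution\<close>

lemma real_distribution_convolution:
  assumes "real_distribution M" "real_distribution N"
  shows "real_distribution (convolution M N)"
proof -
  interpret M: real_distribution M by fact
  interpret N: real_distribution N by fact
  interpret P: pair_prob_space M N ..
  have "prob_space (convolution M N)"
    unfolding convolution_def
    by (rule P.prob_space_distr) (simp add: borel_measurable_add)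
  then show ?thesis
    by (simp add: real_distribution_def real_distribution_axioms_def)
qed

lemma char_convolution:
  assumes "real_distribution M" "real_distribution N"
  shows "char (convolution M N) t = char M t * char N t"
proof -
  interpret M: real_distribution M by fact
  interpret N: real_distribution N by fact
  interpret P: pair_prob_space M N ..
  have int: "integrable (M \<Otimes>\<^sub>M N) (\<lambda>(x, y). iexp (t * (x + y)))"
    by (rule P.integrable_const_bound[of _ 1]) (auto simp: case_prod_unfold)
  have "char (convolution M N) t = (LINT z|(M \<Otimes>\<^sub>M N). iexp (t * (case z of (x, y) \<Rightarrow> x + y)))"
    unfolding char_def convolution_def by (subst integral_distr) auto
  also have "\<dots> = (LINT x|M. LINT y|N. iexp (t * (x + y)))"
    using P.integral_fst'[OF int] by (simp add: case_prod_unfold)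
  also have "\<dots> = (LINT x|M. LINT y|N. iexp (t * x) * iexp (t * y))"
    by (simp add: distrib_left exp_add)
  also have "\<dots> = char M t * char N t"
    unfolding char_def by simp
  finally show ?thesis .
qed

lemma real_distribution_two_point: "real_distribution (two_point_measure a)"
  unfolding two_point_measure_def real_distribution_def real_distribution_axioms_def
  by (auto intro: measure_pmf.prob_space_distr)

lemma char_two_point:
  assumes "a \<noteq> 0" shows "char (two_point_measure a) t = of_real (cos (t * a))"
proof -
  have "char (two_point_measure a) t = measure_pmf.expectation (pmf_of_set {-a, a}) (\<lambda>x. iexp (t * x))"
    unfolding char_def two_point_measure_def by (subst integral_distr) auto
  also have "\<dots> = (\<Sum>x\<in>{-a, a}. pmf (pmf_of_set {-a, a}) x *\<^sub>R iexp (t * x))"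
    by (rule integral_measure_pmf) auto
  also have "\<dots> = (\<Sum>x\<in>{-a, a}. iexp (t * x)) / 2"
    using assms by (simp add: card_insert_if scaleR_conv_of_real)
  also have "\<dots> = of_real (cos (t * a))"
    using assms by (simp add: exp_eq_polar complex_eq_iff cis.simps)
  finally show ?thesis .
qed

lemma real_distribution_partial: "real_distribution (partial_bernoulli_convolution \<theta> n)"
proof (induction n)
  case 0
  then show ?case
    by (simp add: real_distribution_def real_distribution_axioms_def prob_space_return)
next
  case (Suc n)
  then show ?case by (simp add: real_distribution_convolution real_distribution_two_point)
qed

lemma char_partial:
  assumes "\<theta> > 0"
  shows "char (partial_bernoulli_convolution \<theta> n) t = of_real (\<Prod>k<n. cos (t / \<theta> ^ k))"
proof (induction n)
  case 0
  then show ?case by (simp add: char_def integral_return)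
next
  case (Suc n)
  then show ?case
    using assms char_two_point[of "1 / \<theta> ^ n" t]
    by (simp add: char_convolution real_distribution_partial real_distribution_two_point mult.commute)
qed

text \<open>The radii stay below a convergent geometric series, so a bounded interval carries all
  the partial convolutions; this gives tightness.\<close>

lemma measure_partial_support:
  assumes "\<theta> > 1"
  shows "measure (partial_bernoulli_convolution \<theta> n) {x. \<bar>x\<bar> \<le> (\<Sum>k<n. 1 / \<theta> ^ k)} = 1"
proof (induction n)
  case 0
  then show ?case by (simp add: measure_return indicator_def)
next
  case (Suc n)
  let ?M = "partial_bernoulli_convolution \<theta> n" and ?N = "two_point_measure (1 / \<theta> ^ n)"
  let ?A = "{x. \<bar>x\<bar> \<le> (\<Sum>k<n. 1 / \<theta> ^ k)}" and ?B = "{x. \<bar>x\<bar> \<le> 1 / \<theta> ^ n}"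
  interpret M: real_distribution ?M by (rule real_distribution_partial)
  interpret N: real_distribution ?N by (rule real_distribution_two_point)
  interpret P: pair_prob_space ?M ?N ..
  interpret C: real_distribution "partial_bernoulli_convolution \<theta> (Suc n)" by (rule real_distribution_partial)
  have meas: "{x :: real. \<bar>x\<bar> \<le> c} \<in> sets borel" for c by measurable
  have "measure ?N ?B = measure (measure_pmf (pmf_of_set {- (1 / \<theta> ^ n), 1 / \<theta> ^ n})) ?B"
    unfolding two_point_measure_def by (subst measure_distr) (use meas in auto)
  also have "\<dots> = 1"
    using assms by (subst measure_pmf.prob_eq_1) (auto simp: AE_measure_pmf_iff)
  finally have B: "emeasure ?N ?B = 1" by (simp add: N.emeasure_eq_measure)
  have A: "emeasure ?M ?A = 1" using Suc by (simp add: M.emeasure_eq_measure)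
  let ?S = "{x. \<bar>x\<bar> \<le> (\<Sum>k<Suc n. 1 / \<theta> ^ k)}"
  have "1 = emeasure (?M \<Otimes>\<^sub>M ?N) (?A \<times> ?B)"
    using N.emeasure_pair_measure_Times[of ?A ?M ?B] A B meas by simp
  also have "\<dots> \<le> emeasure (?M \<Otimes>\<^sub>M ?N) ((\<lambda>(x, y). x + y) -` ?S \<inter> space (?M \<Otimes>\<^sub>M ?N))"
  proof (rule emeasure_mono)
    show "?A \<times> ?B \<subseteq> (\<lambda>(x, y). x + y) -` ?S \<inter> space (?M \<Otimes>\<^sub>M ?N)"
      by (auto simp: space_pair_measure)
    show "(\<lambda>(x, y). x + y) -` ?S \<inter> space (?M \<Otimes>\<^sub>M ?N) \<in> sets (?M \<Otimes>\<^sub>M ?N)"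
      by (rule measurable_sets[where A = borel]) (use meas in auto)
  qed
  also have "\<dots> = emeasure (partial_bernoulli_convolution \<theta> (Suc n)) ?S"
    unfolding partial_bernoulli_convolution.simps convolution_def
    by (rule emeasure_distr[symmetric]) (use meas in auto)
  finally have "1 \<le> measure (partial_bernoulli_convolution \<theta> (Suc n)) ?S"
    by (simp only: C.emeasure_eq_measure ennreal_ge_1)
  then show ?case using C.prob_le_1[of ?S] by linarith
qed

lemma tight_partial:
  assumes "\<theta> > 1" shows "tight (partial_bernoulli_convolution \<theta>)"
  unfolding tight_def
proof (intro conjI allI impI)
  fix e :: real assume e: "e > 0"
  define c where "c = 1 / (1 - 1 / \<theta>) + 1"
  have c: "(\<Sum>k<n. 1 / \<theta> ^ k) < c" for n
  proof -
    have "(\<Sum>k<n. (1 / \<theta>) ^ k) \<le> (\<Sum>k. (1 / \<theta>) ^ k)"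
      by (rule sum_le_suminf) (use assms in auto)
    also have "\<dots> = 1 / (1 - 1 / \<theta>)" using assms by (simp add: suminf_geometric)
    finally show ?thesis by (simp add: c_def power_one_over)
  qed
  have "measure (partial_bernoulli_convolution \<theta> n) {-c<..c} > 1 - e" for n
  proof -
    interpret real_distribution "partial_bernoulli_convolution \<theta> n" by (rule real_distribution_partial)
    have "measure (partial_bernoulli_convolution \<theta> n) {x. \<bar>x\<bar> \<le> (\<Sum>k<n. 1 / \<theta> ^ k)}
        \<le> measure (partial_bernoulli_convolution \<theta> n) {-c<..c}"
      by (rule finite_measure_mono) (use c[of n] in auto)
    then show ?thesis using e measure_partial_support[OF assms, of n] by linarith
  qed
  moreover have "-c < c" using c[of 0] by simp
  ultimately show "\<exists>a b. a < b \<and> (\<forall>n. 1 - e < measure (partial_bernoulli_convolution \<theta> n) {a<..b})" by blast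
qed (rule real_distribution_partial)

text \<open>Tightness gives a limit along a subsequence. The characteristic functions of the whole
  sequence converge as infinite products, so Levy continuity makes it the limit of the whole
  sequence; Levy uniqueness settles the definite description.\<close>

lemma bernoulli_convolution_weak_limit:
  assumes \<theta>: "\<theta> > 1"
  shows "real_distribution (bernoulli_convolution \<theta>)"
    and "weak_conv_m (partial_bernoulli_convolution \<theta>) (bernoulli_convolution \<theta>)"
proof -
  let ?M = "partial_bernoulli_convolution \<theta>"
  obtain s M where s: "strict_mono s" "real_distribution M" "weak_conv_m (?M \<circ> id \<circ> s) M"
    using tight_imp_convergent_subsubsequence[OF tight_partial[OF \<theta>], of id] by (auto simp: strict_mono_id)
  have convC: "convergent (\<lambda>n. \<Prod>k<n. cos (t / \<theta> ^ k))" for t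
  proof -
    have "summable (\<lambda>k. norm (cos (t / \<theta> ^ k) - 1))"
    proof (rule summable_comparison_test'[where N = 0])
      show "summable (\<lambda>k. \<bar>t\<bar> * (1 / \<theta>) ^ k)" using \<theta> by (intro summable_mult summable_geometric) auto
      fix k
      have "\<bar>cos (t / \<theta> ^ k) - 1\<bar> \<le> \<bar>t / \<theta> ^ k\<bar>"
      proof -
        have "\<bar>cos x - 1\<bar> \<le> \<bar>x\<bar>" for x :: real
        proof -
          have "\<bar>cos x - 1\<bar> = 2 * (\<bar>sin (x / 2)\<bar> * \<bar>sin (x / 2)\<bar>)"
            using cos_double_sin[of "x / 2"] by (simp add: power2_eq_square)
          also have "\<dots> \<le> 2 * (1 * \<bar>x / 2\<bar>)"
            by (intro mult_left_mono mult_mono abs_sin_x_le_abs_x abs_sin_le_one) auto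
          finally show ?thesis by simp
        qed
        then show ?thesis .
      qed
      then show "norm (norm (cos (t / \<theta> ^ k) - 1)) \<le> \<bar>t\<bar> * (1 / \<theta>) ^ k"
        using \<theta> by (simp add: abs_divide power_one_over abs_mult power_abs)
    qed
    then have "abs_convergent_prod (\<lambda>k. cos (t / \<theta> ^ k))"
      by (simp add: abs_convergent_prod_conv_summable)
    then have "convergent (\<lambda>n. \<Prod>k\<le>n. cos (t / \<theta> ^ k))"
      using abs_convergent_prod_imp_convergent_prod convergent_prod_imp_convergent by blast
    then show ?thesis
      by (subst convergent_Suc_iff[symmetric]) (simp add: lessThan_Suc_atMost)
  qed
  have "(\<lambda>n. char (?M n) t) \<longlonglongrightarrow> char M t" for t
  proof -
    obtain L where L: "(\<lambda>n. \<Prod>k<n. cos (t / \<theta> ^ k)) \<longlonglongrightarrow> L"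
      using convC by (auto simp: convergent_def)
    then have lim: "(\<lambda>n. char (?M n) t) \<longlonglongrightarrow> of_real L"
      using \<theta> tendsto_of_real[OF L, where 'a = complex] by (simp add: char_partial)
    have "(\<lambda>n. char (?M (s n)) t) \<longlonglongrightarrow> char M t"
      using levy_continuity1[OF _ s(2) s(3), of t] by (simp add: real_distribution_partial)
    moreover have "(\<lambda>n. char (?M (s n)) t) \<longlonglongrightarrow> of_real L"
      using LIMSEQ_subseq_LIMSEQ[OF lim s(1)] by (simp add: o_def)
    ultimately have "char M t = of_real L" by (rule LIMSEQ_unique)
    then show ?thesis using lim by simp
  qed
  then have M: "weak_conv_m ?M M" by (intro levy_continuity real_distribution_partial s(2))
  have "bernoulli_convolution \<theta> = M"
    unfolding bernoulli_convolution_def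
  proof (rule the_equality)
    fix N assume N: "real_distribution N \<and> weak_conv_m ?M N"
    have "char N = char M"
    proof
      fix t
      have "(\<lambda>n. char (?M n) t) \<longlonglongrightarrow> char N t" "(\<lambda>n. char (?M n) t) \<longlonglongrightarrow> char M t"
        using N s(2) M by (auto intro!: levy_continuity1 real_distribution_partial)
      then show "char N t = char M t" by (rule LIMSEQ_unique)
    qed
    then show "N = M" using Levy_uniqueness N s(2) by blast
  qed (use s M in blast)
  then show "real_distribution (bernoulli_convolution \<theta>)" "weak_conv_m ?M (bernoulli_convolution \<theta>)"
    using s M by auto
qed

text \<open>The factor 2 matches the pi of \<open>cosprod\<close> with the 2 pi of the transform;
  the zeros at negative k contribute factors 1.\<close>

definition ray :: "real \<Rightarrow> real \<Rightarrow> int \<Rightarrow> real" where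
  "ray \<theta> t k = (if 0 \<le> k then 2 * t / \<theta> ^ nat k else 0)"

lemma fourier_transform_bernoulli:
  assumes \<theta>: "\<theta> > 1"
  obtains y where "fourier_transform (bernoulli_convolution \<theta>) t = of_real y" "\<bar>y\<bar> = cosprod (ray \<theta> t)"
proof -
  let ?f = "\<lambda>n. \<Prod>k<n. cos (2 * pi * t / \<theta> ^ k)"
  have lim: "(\<lambda>n. complex_of_real (?f n)) \<longlonglongrightarrow> fourier_transform (bernoulli_convolution \<theta>) t"
    using levy_continuity1[OF real_distribution_partial bernoulli_convolution_weak_limit[OF \<theta>], of "2 * pi * t"] \<theta>
    by (simp add: char_partial fourier_transform_def)
  have im: "(\<lambda>n. Im (complex_of_real (?f n))) \<longlonglongrightarrow> Im (fourier_transform (bernoulli_convolution \<theta>) t)"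
    using lim by (rule tendsto_Im)
  then have "(\<lambda>n. 0) \<longlonglongrightarrow> Im (fourier_transform (bernoulli_convolution \<theta>) t)"
    by (simp only: Im_complex_of_real)
  then have "Im (fourier_transform (bernoulli_convolution \<theta>) t) = 0"
    by (simp add: LIMSEQ_const_iff)
  moreover define y where "y = Re (fourier_transform (bernoulli_convolution \<theta>) t)"
  ultimately have y: "fourier_transform (bernoulli_convolution \<theta>) t = of_real y"
    by (simp add: complex_eq_iff)
  have "?f \<longlonglongrightarrow> y" using tendsto_Re[OF lim] by (simp only: y_def Re_complex_of_real)
  then have abs: "(\<lambda>n. \<bar>?f n\<bar>) \<longlonglongrightarrow> \<bar>y\<bar>" by (rule tendsto_rabs)
  have "(prod (\<lambda>k. \<bar>cos (pi * ray \<theta> t k)\<bar>) \<longlongrightarrow> cosprod (ray \<theta> t)) (finite_subsets_at_top UNIV)"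
    unfolding cosprod_def by (rule inf_prod_tendsto) auto
  \<comment> \<open>These windows exhaust the integers, so the limit along finite sets can be
    computed along them and compared with the ordered product.\<close>
  moreover have "filterlim (\<lambda>n. {- int n..<int n}) (finite_subsets_at_top UNIV) sequentially"
    unfolding filterlim_finite_subsets_at_top
  proof (intro allI impI)
    fix X :: "int set" assume X: "finite X \<and> X \<subseteq> UNIV"
    define N where "N = nat (Max (insert 0 (abs ` X))) + 1"
    have "\<bar>x\<bar> < int N" if "x \<in> X" for x
    proof -
      have "\<bar>x\<bar> \<le> Max (insert 0 (abs ` X))" using X that by (intro Max_ge) auto
      then show ?thesis unfolding N_def by linarith
    qed
    then have "X \<subseteq> {- int n..<int n}" if "n \<ge> N" for n using that by fastforce
    then show "\<forall>\<^sub>F n in sequentially. finite {- int n..<int n} \<and> X \<subseteq> {- int n..<int n} \<and> {- int n..<int n} \<subseteq> UNIV"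
      by (auto simp: eventually_sequentially)
  qed
  ultimately have "(\<lambda>n. \<Prod>k\<in>{- int n..<int n}. \<bar>cos (pi * ray \<theta> t k)\<bar>) \<longlonglongrightarrow> cosprod (ray \<theta> t)"
    by (rule filterlim_compose)
  moreover have "(\<Prod>k\<in>{- int n..<int n}. \<bar>cos (pi * ray \<theta> t k)\<bar>) = \<bar>?f n\<bar>" for n
  proof -
    have "(\<Prod>k\<in>{- int n..<int n}. \<bar>cos (pi * ray \<theta> t k)\<bar>) = (\<Prod>k\<in>int ` {..<n}. \<bar>cos (pi * ray \<theta> t k)\<bar>)"
    proof (rule prod.mono_neutral_right)
      show "\<forall>i\<in>{- int n..<int n} - int ` {..<n}. \<bar>cos (pi * ray \<theta> t i)\<bar> = 1"
      proof
        fix i assume i: "i \<in> {- int n..<int n} - int ` {..<n}"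
        have "i < 0"
        proof (rule ccontr)
          assume "\<not> i < 0"
          then have "i = int (nat i)" "nat i < n" using i by auto
          then show False using i by blast
        qed
        then show "\<bar>cos (pi * ray \<theta> t i)\<bar> = 1" by (simp add: ray_def)
      qed
    qed auto
    also have "\<dots> = (\<Prod>k<n. \<bar>cos (pi * ray \<theta> t (int k))\<bar>)" by (subst prod.reindex) auto
    also have "\<dots> = \<bar>?f n\<bar>" by (simp add: ray_def abs_prod mult_ac)
    finally show ?thesis .
  qed
  ultimately have "\<bar>y\<bar> = cosprod (ray \<theta> t)" using abs LIMSEQ_unique by fastforce
  then show thesis using that y by blast
qed

lemma abs_fourier_values:
  assumes "\<theta> > 1"
  shows "abs ` fourier_values (bernoulli_convolution \<theta>) r = range (\<lambda>n :: int. cosprod (ray \<theta> (r * of_int n)))"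
proof (intro equalityI subsetI)
  fix x assume "x \<in> abs ` fourier_values (bernoulli_convolution \<theta>) r"
  then obtain n y where n: "complex_of_real y = fourier_transform (bernoulli_convolution \<theta>) (r * of_int n)" "x = \<bar>y\<bar>"
    by (auto simp: fourier_values_def)
  obtain y' where y': "fourier_transform (bernoulli_convolution \<theta>) (r * of_int n) = of_real y'" "\<bar>y'\<bar> = cosprod (ray \<theta> (r * of_int n))"
    by (rule fourier_transform_bernoulli[OF assms])
  then have "y = y'" using n by simp
  then show "x \<in> range (\<lambda>n :: int. cosprod (ray \<theta> (r * of_int n)))" using n y' by auto
next
  fix x assume "x \<in> range (\<lambda>n :: int. cosprod (ray \<theta> (r * of_int n)))"
  then obtain n :: int where n: "x = cosprod (ray \<theta> (r * of_int n))" by auto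
  obtain y' where y': "fourier_transform (bernoulli_convolution \<theta>) (r * of_int n) = of_real y'" "\<bar>y'\<bar> = cosprod (ray \<theta> (r * of_int n))"
    by (rule fourier_transform_bernoulli[OF assms])
  then have "y' \<in> fourier_values (bernoulli_convolution \<theta>) r"
    unfolding fourier_values_def by (intro CollectI exI[of _ n]) simp
  then show "x \<in> abs ` fourier_values (bernoulli_convolution \<theta>) r" using y' n by force
qed

section \<open>Countability of the closure of the transform values\<close>

text \<open>\<rho> is at least 1/\<theta> so that one rate controls both the powers \<theta>^(-k)
  and the errors of h and T. The sequence T ties r to the integers: r T m approximates q \<kappa>
  \<theta>^m.\<close>

locale pisot_sequence =
  fixes \<theta> r \<kappa> C \<rho> :: real and p h T :: "nat \<Rightarrow> int" and d :: nat and q :: int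
  assumes \<theta>: "1 < \<theta>" and r: "0 < r" and q: "0 < q"
    and p0: "p 0 = 1" and pd: "\<And>i. i > d \<Longrightarrow> p i = 0"
    and p_root: "(\<Sum>i\<le>d. of_int (p i) / \<theta> ^ i) = 0"
    and p_inverse: "\<And>m. (\<Sum>i\<le>m. p i * h (m - i)) = (if m = 0 then 1 else 0)"
    and \<rho>: "0 < \<rho>" "\<rho> < 1" "1 / \<theta> \<le> \<rho>" and C: "0 \<le> C" and \<kappa>: "\<kappa> \<noteq> 0"
    and h: "\<And>m. \<bar>of_int (h m) - \<kappa> * \<theta> ^ m\<bar> \<le> C * \<rho> ^ m"
    and T: "\<And>m. \<bar>of_int (T m) - of_int q / r * \<kappa> * \<theta> ^ m\<bar> \<le> C * \<rho> ^ m"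

lemma pisot_sequence_exists:
  assumes pis: "pisot \<theta>" and r: "r \<in> rat_adjoin \<theta>" "r > 0"
  obtains \<kappa> C \<rho> p h T d q where "pisot_sequence \<theta> r \<kappa> C \<rho> p h T d q"
proof -
  obtain p h :: "nat \<Rightarrow> int" and d and \<kappa> C\<^sub>0 \<rho>\<^sub>0 :: real where H:
    "p 0 = 1" "\<And>i. i > d \<Longrightarrow> p i = 0" "(\<Sum>i\<le>d. of_int (p i) / \<theta> ^ i) = 0"
    "\<And>m. (\<Sum>i\<le>m. p i * h (m - i)) = (if m = 0 then 1 else 0)"
    "0 < \<rho>\<^sub>0" "\<rho>\<^sub>0 < 1" "0 \<le> C\<^sub>0" "\<And>m. \<bar>of_int (h m) - \<kappa> * \<theta> ^ m\<bar> \<le> C\<^sub>0 * \<rho>\<^sub>0 ^ m" "\<kappa> \<noteq> 0"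
    by (rule pisot_integer_sequence[OF pis]) (rule that)
  obtain q and R :: "int poly" where q: "q > 0" "of_int q / r = poly (map_poly of_int R) \<theta>"
    using rat_adjoin_inverse[OF pis r(1)] r(2) by (metis less_irrefl)
  have \<theta>: "1 < \<theta>" using pis by (simp add: pisot_def)
  define \<rho> where "\<rho> = max \<rho>\<^sub>0 (1 / \<theta>)"
  define n where "n = degree R"
  define A where "A = (\<Sum>i\<le>n. \<bar>real_of_int (coeff R i)\<bar>)"
  define C where "C = C\<^sub>0 * (1 + A)"
  \<comment> \<open>As q / r = R(\<theta>), applying R to the shift of h multiplies the leading term
    \<kappa> \<theta>^m by q / r and keeps the error decaying.\<close>
  define T where "T m = (\<Sum>i\<le>n. coeff R i * h (m + i))" for m
  have \<rho>: "0 < \<rho>" "\<rho> < 1" "1 / \<theta> \<le> \<rho>" "\<rho>\<^sub>0 \<le> \<rho>" using \<theta> H by (auto simp: \<rho>_def)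
  have A: "0 \<le> A" by (simp add: A_def sum_nonneg)
  have h: "\<bar>of_int (h m) - \<kappa> * \<theta> ^ m\<bar> \<le> C\<^sub>0 * \<rho> ^ m" for m
  proof -
    have "C\<^sub>0 * \<rho>\<^sub>0 ^ m \<le> C\<^sub>0 * \<rho> ^ m" using H \<rho> by (intro mult_left_mono power_mono) auto
    then show ?thesis using H(8)[of m] by linarith
  qed
  have "\<bar>of_int (h m) - \<kappa> * \<theta> ^ m\<bar> \<le> C * \<rho> ^ m" for m
  proof -
    have "C\<^sub>0 * \<rho> ^ m \<le> C * \<rho> ^ m" unfolding C_def
      using H \<rho> A by (intro mult_right_mono) (auto simp: algebra_simps)
    then show ?thesis using h[of m] by linarith
  qed
  moreover have "\<bar>of_int (T m) - of_int q / r * \<kappa> * \<theta> ^ m\<bar> \<le> C * \<rho> ^ m" for m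
  proof -
    have "of_int q / r = (\<Sum>i\<le>n. of_int (coeff R i) * \<theta> ^ i)"
      unfolding q(2) by (simp add: poly_altdef degree_map_poly coeff_map_poly n_def)
    then have "of_int (T m) - of_int q / r * \<kappa> * \<theta> ^ m
        = (\<Sum>i\<le>n. of_int (coeff R i) * (of_int (h (m + i)) - \<kappa> * \<theta> ^ (m + i)))"
      by (simp add: T_def sum_distrib_right sum_distrib_left sum_subtractf right_diff_distrib power_add mult_ac)
    also have "\<bar>\<dots>\<bar> \<le> (\<Sum>i\<le>n. \<bar>of_int (coeff R i) * (of_int (h (m + i)) - \<kappa> * \<theta> ^ (m + i))\<bar>)"
      by (rule sum_abs)
    also have "\<dots> \<le> (\<Sum>i\<le>n. \<bar>real_of_int (coeff R i)\<bar> * (C\<^sub>0 * \<rho> ^ m))"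
    proof (rule sum_mono)
      fix i
      have "C\<^sub>0 * \<rho> ^ (m + i) \<le> C\<^sub>0 * \<rho> ^ m"
        using H \<rho> by (intro mult_left_mono power_decreasing) auto
      then show "\<bar>of_int (coeff R i) * (of_int (h (m + i)) - \<kappa> * \<theta> ^ (m + i))\<bar> \<le> \<bar>real_of_int (coeff R i)\<bar> * (C\<^sub>0 * \<rho> ^ m)"
        unfolding abs_mult using h[of "m + i"] by (intro mult_left_mono) auto
    qed
    also have "\<dots> = A * (C\<^sub>0 * \<rho> ^ m)" by (simp add: A_def sum_distrib_right)
    also have "\<dots> \<le> (1 + A) * (C\<^sub>0 * \<rho> ^ m)"
      using H \<rho> by (intro mult_right_mono) auto
    finally show ?thesis by (simp add: C_def mult_ac)
  qed
  ultimately have "pisot_sequence \<theta> r \<kappa> C \<rho> p h T d q"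
    using H \<rho> \<theta> r q A by unfold_locales (auto simp: C_def)
  then show thesis by (rule that)
qed

section \<open>Green function of the recurrence and charges of a ray\<close>

context pisot_sequence
begin

text \<open>The decaying two-sided fundamental solution: \<kappa> \<theta>^(-k) solves the
  homogeneous recurrence but explodes as k tends to minus infinity, and subtracting h (- k) for k
  \<le> 0 cancels the explosion. The recurrence of p maps it to -1 at k = 0 and to 0
  elsewhere.\<close>

definition green :: "int \<Rightarrow> real" where
  "green k = (if k > 0 then \<kappa> / \<theta> ^ nat k else \<kappa> * \<theta> ^ nat (- k) - of_int (h (nat (- k))))"

lemma inverse_power_\<theta>_le: "1 / \<theta> ^ k \<le> \<rho> ^ k"
  using power_mono[OF \<rho>(3), of k] \<theta> by (simp add: power_one_over)

lemma sqrt_\<rho>: "0 < sqrt \<rho>" "sqrt \<rho> < 1" "(sqrt \<rho>)\<^sup>2 = \<rho>"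
  using \<rho> by auto

lemma green_le: "\<bar>green k\<bar> \<le> (\<bar>\<kappa>\<bar> + C) * \<rho> ^ nat \<bar>k\<bar>"
proof (cases "k > 0")
  case True
  have "\<bar>green k\<bar> = \<bar>\<kappa>\<bar> * (1 / \<theta> ^ nat k)" using True \<theta> by (simp add: green_def abs_divide)
  also have "\<dots> \<le> \<bar>\<kappa>\<bar> * \<rho> ^ nat k" by (intro mult_left_mono inverse_power_\<theta>_le) auto
  also have "\<dots> \<le> (\<bar>\<kappa>\<bar> + C) * \<rho> ^ nat k" using C \<rho> by (intro mult_right_mono) auto
  finally show ?thesis using True by simp
next
  case False
  then have "\<bar>green k\<bar> \<le> C * \<rho> ^ nat (- k)"
    using h[of "nat (- k)"] by (simp add: green_def abs_minus_commute)
  also have "\<dots> \<le> (\<bar>\<kappa>\<bar> + C) * \<rho> ^ nat (- k)" using C \<rho> by (intro mult_right_mono) auto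
  finally show ?thesis using False by simp
qed

sublocale decay_kernel "sqrt \<rho>" "\<bar>\<kappa>\<bar> + C" green
  by unfold_locales (use sqrt_\<rho> C green_le in auto)

definition tail :: "nat \<Rightarrow> real" where
  "tail l = of_int q / r * \<kappa> * \<theta> ^ l - of_int (T l)"

text \<open>The term with \<open>tail\<close> comes from the endpoint \<open>k = 0\<close> of the product: the coefficient of
  the mode \<open>\<theta>\<^sup>-\<^sup>k\<close> is \<open>r/q\<close> times an integer, up to a correction localized at \<open>0\<close>.\<close>

definition ray_kernel :: "int \<Rightarrow> int \<Rightarrow> real" where
  "ray_kernel k l = (if 0 \<le> k then green (k - l) - r / of_int q * tail (nat l) / \<theta> ^ nat k else 0)"

definition ray_mode :: "int \<Rightarrow> int \<Rightarrow> real" where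
  "ray_mode N k = (if 0 \<le> k then r / of_int q * of_int N / \<theta> ^ nat k else 0)"

lemma tail_le: "\<bar>tail l\<bar> \<le> C * \<rho> ^ l"
  using T[of l] by (simp add: tail_def abs_minus_commute)

text \<open>For k \<ge> 0 the difference is the tail term, a decay in k times a decay in l. For k <
  0 \<le> l it is the Green function alone, and the distance of k and l is the sum of their
  moduli.\<close>

lemma ray_kernel_le:
  assumes "0 \<le> l"
  shows "\<bar>ray_kernel k l - green (k - l)\<bar> \<le> (\<bar>\<kappa>\<bar> + C + r / of_int q * C) * \<rho> ^ (nat \<bar>k\<bar> + nat \<bar>l\<bar>)"
proof (cases "0 \<le> k")
  case True
  have "\<bar>ray_kernel k l - green (k - l)\<bar> = r / of_int q * (\<bar>tail (nat l)\<bar> * (1 / \<theta> ^ nat k))"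
    using True r q \<theta> by (simp add: ray_kernel_def abs_mult abs_divide)
  also have "\<dots> \<le> r / of_int q * ((C * \<rho> ^ nat l) * \<rho> ^ nat k)"
    by (intro mult_left_mono mult_mono tail_le inverse_power_\<theta>_le) (use r q \<theta> C \<rho> in auto)
  also have "\<dots> = r / of_int q * C * \<rho> ^ (nat \<bar>k\<bar> + nat \<bar>l\<bar>)"
    using True assms by (simp add: power_add)
  also have "\<dots> \<le> (\<bar>\<kappa>\<bar> + C + r / of_int q * C) * \<rho> ^ (nat \<bar>k\<bar> + nat \<bar>l\<bar>)"
    by (intro mult_right_mono) (use C \<rho> in auto)
  finally show ?thesis .
next
  case False
  have "\<bar>ray_kernel k l - green (k - l)\<bar> \<le> (\<bar>\<kappa>\<bar> + C) * \<rho> ^ nat \<bar>k - l\<bar>"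
    using False green_le[of "k - l"] by (simp add: ray_kernel_def)
  also have "nat \<bar>k - l\<bar> = nat \<bar>k\<bar> + nat \<bar>l\<bar>" using False assms by linarith
  also have "(\<bar>\<kappa>\<bar> + C) * \<rho> ^ (nat \<bar>k\<bar> + nat \<bar>l\<bar>) \<le> (\<bar>\<kappa>\<bar> + C + r / of_int q * C) * \<rho> ^ (nat \<bar>k\<bar> + nat \<bar>l\<bar>)"
    by (intro mult_right_mono) (use C \<rho> r q in auto)
  finally show ?thesis .
qed

lemma ray_mode_le:
  assumes "\<bar>N\<bar> \<le> N\<^sub>0" shows "\<bar>ray_mode N k\<bar> \<le> r / of_int q * of_int N\<^sub>0 * \<rho> ^ nat \<bar>k\<bar>"
proof (cases "0 \<le> k")
  case True
  have "\<bar>ray_mode N k\<bar> = r / of_int q * \<bar>of_int N\<bar> * (1 / \<theta> ^ nat k)"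
    using True r q \<theta> by (simp add: ray_mode_def abs_mult abs_divide)
  also have "\<dots> \<le> r / of_int q * of_int N\<^sub>0 * \<rho> ^ nat k"
  proof (rule mult_mono[OF _ inverse_power_\<theta>_le])
    have "\<bar>of_int N :: real\<bar> \<le> of_int N\<^sub>0" using assms by linarith
    then show "r / of_int q * \<bar>of_int N\<bar> \<le> r / of_int q * of_int N\<^sub>0"
      using r q by (intro mult_left_mono) auto
  qed (use r q \<theta> assms in auto)
  finally show ?thesis using True by simp
qed (use r q \<rho> assms in \<open>auto simp: ray_mode_def\<close>)

text \<open>The l1 norm of p: it bounds the charges, and rounding errors up to 1/(2
  \<open>total_p\<close>) force the integer charge they produce to be 0.\<close>

definition total_p :: int where "total_p = (\<Sum>i\<le>d. \<bar>p i\<bar>)"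

lemma total_p_ge_1: "1 \<le> total_p"
  using member_le_sum[of 0 "{..d}" "\<lambda>i. \<bar>p i\<bar>"] p0 by (simp add: total_p_def)

text \<open>As e vanishes far out, the recurrence can be solved backwards from infinity. Regrouping
  the double sum by j = m + i produces the convolution of p and h, which leaves only j = 0.\<close>

lemma convolution_inverse:
  assumes e: "\<And>j. j \<ge> M \<Longrightarrow> e j = (0 :: int)"
  shows "e k = (\<Sum>m\<le>M. h m * (\<Sum>i\<le>d. p i * e (k + m + i)))"
proof -
  have inner: "(\<Sum>i\<le>d. p i * e (k + m + i)) = (\<Sum>i\<le>M - m. p i * e (k + m + i))" if "m \<le> M" for m
  proof -
    have "(\<Sum>i\<le>d. p i * e (k + m + i)) = (\<Sum>i\<le>max d (M - m). p i * e (k + m + i))"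
      by (rule sum.mono_neutral_left) (auto simp: pd)
    also have "\<dots> = (\<Sum>i\<le>M - m. p i * e (k + m + i))"
      by (rule sum.mono_neutral_right) (use that in \<open>auto simp: e\<close>)
    finally show ?thesis .
  qed
  have "(\<Sum>m\<le>M. h m * (\<Sum>i\<le>d. p i * e (k + m + i))) = (\<Sum>m\<le>M. \<Sum>i\<le>M - m. h m * p i * e (k + m + i))"
    by (intro sum.cong refl) (simp add: inner sum_distrib_left mult.assoc)
  also have "\<dots> = (\<Sum>(m, i)\<in>(SIGMA m:{..M}. {..M - m}). h m * p i * e (k + m + i))"
    by (rule sum.Sigma) auto
  also have "(SIGMA m:{..M}. {..M - m}) = {(m, i). i + m \<le> M}" by auto
  also have "(\<Sum>(m, i)\<in>{(m, i). i + m \<le> M}. h m * p i * e (k + m + i))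
      = (\<Sum>(i, m)\<in>{(i, m). i + m \<le> M}. h m * p i * e (k + m + i))"
    by (rule sum.reindex_bij_witness[of _ "\<lambda>(i, m). (m, i)" "\<lambda>(m, i). (i, m)"]) auto
  also have "\<dots> = (\<Sum>j\<le>M. \<Sum>i\<le>j. h (j - i) * p i * e (k + (j - i) + i))"
    by (rule sum.triangle_reindex_eq)
  also have "\<dots> = (\<Sum>j\<le>M. e (k + j) * (\<Sum>i\<le>j. p i * h (j - i)))"
    by (intro sum.cong refl) (simp add: sum_distrib_left mult_ac)
  also have "\<dots> = (\<Sum>j\<le>M. e (k + j) * (if j = 0 then 1 else 0))" by (simp only: p_inverse)
  also have "\<dots> = e k" by (simp add: if_distrib cong: if_cong)
  finally show ?thesis by simp
qed

text \<open>The nearest integers to \<open>2rn\<theta>\<^sup>-\<^sup>k\<close> satisfy the recurrence of \<open>p\<close> up to the charges \<open>a\<close>;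
  solving this inhomogeneous recurrence expresses the rounding errors through \<open>a\<close>.\<close>

lemma ray_representation:
  fixes n :: int
  assumes M: "\<And>F. (\<And>k. k \<in> F \<Longrightarrow> \<bar>cos (pi * ray \<theta> (r * of_int n) k)\<bar> \<le> cos (pi / (2 * of_int total_p))) \<Longrightarrow>
      finite F \<and> card F \<le> M"
  obtains N a where "a \<in> charges total_p ((d + 1) * M)" "supp a \<subseteq> {0..}"
    "\<bar>of_int N\<bar> \<le> of_int q / r * (1 + of_int total_p * ((\<bar>\<kappa>\<bar> + C) * (2 / (1 - \<rho>)))) + of_int total_p * (C * (2 / (1 - \<rho>)))"
    "cosprod (ray \<theta> (r * of_int n)) = cosprod (\<lambda>k. ray_mode N k + response ray_kernel a k)"
proof -
  define y where "y k = 2 * (r * of_int n) / \<theta> ^ k" for k :: nat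
  define e where "e k = round (y k)" for k
  define err where "err k = y k - of_int (e k)" for k
  define a where "a l = (if 0 \<le> l then \<Sum>i\<le>d. p i * e (nat l + i) else 0)" for l
  have err: "\<bar>err k\<bar> \<le> 1 / 2" for k
    using of_int_round_abs_le[of "y k"] by (simp add: err_def e_def abs_minus_commute)
  have "(\<lambda>k. y k) \<longlonglongrightarrow> 0"
    unfolding y_def divide_inverse using \<theta>
    by (auto intro!: tendsto_mult_right_zero LIMSEQ_inverse_realpow_zero)
  then have "eventually (\<lambda>k. dist (y k) 0 < 1 / 2) sequentially" by (rule tendstoD) simp
  then have "eventually (\<lambda>k. \<bar>y k\<bar> < 1 / 2) sequentially" by (simp only: dist_real_def diff_0_right)
  then obtain J where J: "\<And>k. k \<ge> J \<Longrightarrow> \<bar>y k\<bar> < 1 / 2" by (auto simp: eventually_sequentially)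
  have e0: "e k = 0" if "k \<ge> J" for k
    unfolding e_def using J[OF that] by (intro round_unique') simp
  have suppJ: "supp a \<subseteq> {0..<int J}"
  proof
    fix l assume "l \<in> supp a"
    then have l: "a l \<noteq> 0" by (simp add: supp_def)
    have "nat l < J"
    proof (rule ccontr)
      assume "\<not> nat l < J"
      then have "a l = 0" by (auto simp: a_def e0)
      then show False using l by simp
    qed
    then show "l \<in> {0..<int J}" using l by (auto simp: a_def split: if_splits)
  qed
  then have fin: "finite (supp a)" and pos: "supp a \<subseteq> {0..}" using finite_subset by auto
  \<comment> \<open>The exact numbers y satisfy the recurrence because 1/\<theta> is a root of p, so
    the charges are combinations of rounding errors alone.\<close>
  have a_err: "of_int (a (int l)) = - (\<Sum>i\<le>d. of_int (p i) * err (l + i))" for l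
  proof -
    have "(\<Sum>i\<le>d. of_int (p i) * y (l + i)) = y l * (\<Sum>i\<le>d. of_int (p i) / \<theta> ^ i)"
      unfolding sum_distrib_left by (rule sum.cong) (simp_all add: y_def power_add)
    then have "(\<Sum>i\<le>d. of_int (p i) * y (l + i)) = 0" by (simp add: p_root)
    then show ?thesis by (simp add: a_def err_def right_diff_distrib sum_subtractf)
  qed
  have sum_err: "\<bar>of_int (a (int l)) :: real\<bar> \<le> of_int total_p * c" if "\<And>i. i \<le> d \<Longrightarrow> \<bar>err (l + i)\<bar> \<le> c" for l c
  proof -
    have "\<bar>of_int (a (int l)) :: real\<bar> \<le> (\<Sum>i\<le>d. \<bar>of_int (p i) * err (l + i)\<bar>)"
      unfolding a_err abs_minus_cancel by (rule sum_abs)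
    also have "\<dots> \<le> (\<Sum>i\<le>d. \<bar>of_int (p i)\<bar> * c)"
      unfolding abs_mult using that by (intro sum_mono mult_left_mono) auto
    also have "\<dots> = of_int total_p * c" by (simp add: total_p_def sum_distrib_right)
    finally show ?thesis .
  qed
  have bound: "\<bar>a l\<bar> \<le> total_p" for l
  proof (cases "0 \<le> l")
    case True
    then have "\<bar>of_int (a l) :: real\<bar> \<le> of_int total_p * (1 / 2)" using sum_err[of "nat l" "1/2"] err by simp
    then show ?thesis using total_p_ge_1 by linarith
  next
    case False
    then show ?thesis using total_p_ge_1 by (simp add: a_def)
  qed
  have ray: "ray \<theta> (r * of_int n) (int k) = err k + of_int (e k)" for k
    by (simp add: ray_def err_def y_def)
  \<comment> \<open>If the errors at l, ..., l + d are all at most \<delta>, then the charge at l is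
    at most 1/2 in modulus, hence 0. A nonzero charge therefore sees a factor at most cos (pi
    \<delta>) among these d + 1 places, and one such factor accounts for at most d + 1
    charges.\<close>
  define \<delta> where "\<delta> = 1 / (2 * real_of_int total_p)"
  have \<delta>: "0 < \<delta>" "\<delta> \<le> 1 / 2" using total_p_ge_1 by (auto simp: \<delta>_def field_simps)
  define F where "F = {k. \<bar>cos (pi * ray \<theta> (r * of_int n) k)\<bar> \<le> cos (pi * \<delta>)}"
  have F: "finite F" "card F \<le> M" using M[of F] by (auto simp: F_def \<delta>_def)
  have "supp a \<subseteq> (\<Union>i\<in>{..d}. (\<lambda>k. k - int i) ` F)"
  proof
    fix l assume l: "l \<in> supp a"
    then have l0: "0 \<le> l" "a l \<noteq> 0" using pos by (auto simp: supp_def)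
    have "\<exists>i\<le>d. \<delta> < \<bar>err (nat l + i)\<bar>"
    proof (rule ccontr)
      assume "\<not> ?thesis"
      then have "\<bar>of_int (a l) :: real\<bar> \<le> of_int total_p * \<delta>" using sum_err[of "nat l" \<delta>] l0 by force
      also have "\<dots> = 1 / 2" using total_p_ge_1 by (simp add: \<delta>_def)
      finally show False using l0(2) by linarith
    qed
    then obtain i where i: "i \<le> d" "\<delta> < \<bar>err (nat l + i)\<bar>" by blast
    have "\<bar>cos (pi * ray \<theta> (r * of_int n) (int (nat l + i)))\<bar> = \<bar>cos (pi * err (nat l + i))\<bar>"
      unfolding ray by (rule abs_cos_add_pi_of_int)
    also have "\<dots> = \<bar>cos (pi * \<bar>err (nat l + i)\<bar>)\<bar>"
      by (cases "err (nat l + i) \<ge> 0") simp_all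
    also have "\<dots> = cos (pi * \<bar>err (nat l + i)\<bar>)"
      using err[of "nat l + i"] by (intro abs_of_nonneg cos_ge_zero) (auto intro: order_trans[of _ 0])
    also have "\<dots> \<le> cos (pi * \<delta>)"
      using i \<delta> err[of "nat l + i"] by (intro cos_monotone_0_pi_le) auto
    finally have "int (nat l + i) \<in> F" by (simp add: F_def)
    then show "l \<in> (\<Union>i\<in>{..d}. (\<lambda>k. k - int i) ` F)"
      using i l0 by (intro UN_I[of i] image_eqI[of _ _ "int (nat l + i)"]) auto
  qed
  then have "card (supp a) \<le> card (\<Union>i\<in>{..d}. (\<lambda>k. k - int i) ` F)"
    using F by (intro card_mono) auto
  also have "\<dots> \<le> (\<Sum>i\<le>d. card ((\<lambda>k. k - int i) ` F))" by (rule card_UN_le) simp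
  also have "\<dots> \<le> (\<Sum>i\<le>d. M)" by (intro sum_mono order_trans[OF card_image_le F(2)] F)
  finally have "card (supp a) \<le> (d + 1) * M" by simp
  then have charges: "a \<in> charges total_p ((d + 1) * M)" using fin bound by (simp add: charges_def)
  \<comment> \<open>The coefficient of \<theta>^(-k) that remains in the error once the decaying
    Green response is split off.\<close>
  define S where "S = 2 * r * of_int n - \<kappa> * (\<Sum>l\<in>supp a. of_int (a l) * \<theta> ^ nat l)"
  have e_eq: "of_int (e k) = \<kappa> / \<theta> ^ k * (\<Sum>l\<in>supp a. of_int (a l) * \<theta> ^ nat l) - response (\<lambda>k l. green (k - l)) a (int k)" for k
  proof -
    have "e k = (\<Sum>m\<le>J. h m * a (int (k + m)))"
      using convolution_inverse[of J e k] e0 by (simp add: a_def nat_add_distrib add.assoc)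
    also have "\<dots> = (\<Sum>l\<in>(\<lambda>m. int (k + m)) ` {..J}. h (nat (l - int k)) * a l)"
      by (subst sum.reindex) (auto simp: inj_on_def)
    also have "\<dots> = (\<Sum>l\<in>supp a \<inter> {int k..}. h (nat (l - int k)) * a l)"
    proof (rule sum.mono_neutral_right)
      show "supp a \<inter> {int k..} \<subseteq> (\<lambda>m. int (k + m)) ` {..J}"
      proof
        fix l assume l: "l \<in> supp a \<inter> {int k..}"
        then have "l < int J" using suppJ by auto
        then show "l \<in> (\<lambda>m. int (k + m)) ` {..J}"
          using l by (intro image_eqI[of _ _ "nat (l - int k)"]) auto
      qed
    qed (auto simp: supp_def)
    finally have "of_int (e k) = (\<Sum>l\<in>supp a \<inter> {int k..}. of_int (h (nat (l - int k))) * of_int (a l) :: real)"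
      by simp
    also have "\<dots> = (\<Sum>l\<in>supp a. if l \<in> {int k..} then of_int (h (nat (l - int k))) * of_int (a l) else 0)"
      by (rule sum.inter_restrict[OF fin])
    \<comment> \<open>For l \<ge> k the Green function is the power term minus h; for l < k there is
      no h and the Green function equals the power term. One formula thus covers both cases and
      removes the restriction on l.\<close>
    also have "\<dots> = (\<Sum>l\<in>supp a. of_int (a l) * (\<kappa> * \<theta> ^ nat l / \<theta> ^ k - green (int k - l)))"
    proof (rule sum.cong[OF refl])
      fix l assume "l \<in> supp a"
      then have l: "0 \<le> l" using pos by auto
      show "(if l \<in> {int k..} then of_int (h (nat (l - int k))) * of_int (a l) else 0)
          = of_int (a l) * (\<kappa> * \<theta> ^ nat l / \<theta> ^ k - green (int k - l))"
      proof (cases "int k \<le> l")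
        case True
        then have "\<theta> ^ nat l = \<theta> ^ nat (l - int k) * \<theta> ^ k" by (simp add: nat_diff_distrib flip: power_add)
        then show ?thesis using True \<theta> by (simp add: green_def)
      next
        case False
        then have "k = nat (int k - l) + nat l" using l by linarith
        then have "\<theta> ^ k = \<theta> ^ nat (int k - l) * \<theta> ^ nat l" by (metis power_add)
        then show ?thesis using False \<theta> by (simp add: green_def)
      qed
    qed
    also have "\<dots> = \<kappa> / \<theta> ^ k * (\<Sum>l\<in>supp a. of_int (a l) * \<theta> ^ nat l) - response (\<lambda>k l. green (k - l)) a (int k)"
      by (simp add: response_def right_diff_distrib sum_subtractf sum_distrib_left mult_ac)
    finally show ?thesis .
  qed
  have err_eq: "err k = S / \<theta> ^ k + response (\<lambda>k l. green (k - l)) a (int k)" for k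
    unfolding err_def e_eq y_def S_def by (simp add: diff_divide_distrib)
  \<comment> \<open>Replacing (q / r) \<kappa> \<theta>^l by the integer T l turns (q / r) S into an
    integer up to a sum of tails. The error at k = 0 is at most 1/2, which bounds S and with it
    N.\<close>
  define N where "N = 2 * q * n - (\<Sum>l\<in>supp a. a l * T (nat l))"
  have S_eq: "S = r / of_int q * (of_int N - (\<Sum>l\<in>supp a. of_int (a l) * tail (nat l)))"
  proof -
    have "(\<Sum>l\<in>supp a. of_int (a l) * tail (nat l))
        = of_int q / r * \<kappa> * (\<Sum>l\<in>supp a. of_int (a l) * \<theta> ^ nat l) - (\<Sum>l\<in>supp a. of_int (a l) * of_int (T (nat l)))"
      by (simp add: tail_def right_diff_distrib sum_subtractf sum_distrib_left mult_ac)
    then show ?thesis using q r by (simp add: S_def N_def field_simps)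
  qed
  have geo: "(\<Sum>l\<in>supp a. \<rho> ^ nat \<bar>l\<bar>) \<le> 2 / (1 - \<rho>)"
    using sum_geometric_int_le[OF \<rho>(1,2) fin, of 0] by simp
  have "\<bar>S\<bar> \<le> 1 + of_int total_p * ((\<bar>\<kappa>\<bar> + C) * (2 / (1 - \<rho>)))"
  proof -
    have "\<bar>response (\<lambda>k l. green (k - l)) a 0\<bar> \<le> of_int total_p * (\<Sum>l\<in>supp a. (\<bar>\<kappa>\<bar> + C) * \<rho> ^ nat \<bar>l\<bar>)"
      by (rule abs_response_le[OF charges]) (use green_le[of "- _"] in auto)
    also have "\<dots> \<le> of_int total_p * ((\<bar>\<kappa>\<bar> + C) * (2 / (1 - \<rho>)))"
      unfolding sum_distrib_left[symmetric] using total_p_ge_1 C by (intro mult_left_mono geo) auto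
    finally have *: "\<bar>response (\<lambda>k l. green (k - l)) a 0\<bar> \<le> of_int total_p * ((\<bar>\<kappa>\<bar> + C) * (2 / (1 - \<rho>)))" .
    have "err 0 = S + response (\<lambda>k l. green (k - l)) a 0" using err_eq[of 0] by simp
    then show ?thesis using err[of 0] * by linarith
  qed
  moreover have "\<bar>\<Sum>l\<in>supp a. of_int (a l) * tail (nat l)\<bar> \<le> of_int total_p * (C * (2 / (1 - \<rho>)))"
  proof -
    have "\<bar>response (\<lambda>k l. tail (nat l)) a 0\<bar> \<le> of_int total_p * (\<Sum>l\<in>supp a. C * \<rho> ^ nat \<bar>l\<bar>)"
      by (rule abs_response_le[OF charges]) (use tail_le pos in force)
    also have "\<dots> \<le> of_int total_p * (C * (2 / (1 - \<rho>)))"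
      unfolding sum_distrib_left[symmetric] using total_p_ge_1 C by (intro mult_left_mono geo) auto
    finally show ?thesis by (simp add: response_def)
  qed
  moreover have "of_int N = of_int q / r * S + (\<Sum>l\<in>supp a. of_int (a l) * tail (nat l))"
    using S_eq q r by simp
  ultimately have "\<bar>of_int N\<bar> \<le> of_int q / r * (1 + of_int total_p * ((\<bar>\<kappa>\<bar> + C) * (2 / (1 - \<rho>)))) + of_int total_p * (C * (2 / (1 - \<rho>)))"
    using q r by (simp only:) (intro order_trans[OF abs_triangle_ineq] add_mono; simp add: abs_mult mult_left_mono del: times_divide_eq_left times_divide_eq_right)
  moreover have "cosprod (ray \<theta> (r * of_int n)) = cosprod (\<lambda>k. ray_mode N k + response ray_kernel a k)"
  proof (rule cosprod_cong_int)
    fix k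
    show "\<exists>m. ray \<theta> (r * of_int n) k = ray_mode N k + response ray_kernel a k + of_int m"
    proof (cases "0 \<le> k")
      case True
      then obtain j where j: "k = int j" by (metis nonneg_int_cases)
      have "response ray_kernel a k = response (\<lambda>k l. green (k - l)) a k - r / of_int q * (\<Sum>l\<in>supp a. of_int (a l) * tail (nat l)) / \<theta> ^ j"
        by (simp add: response_def ray_kernel_def j right_diff_distrib sum_subtractf sum_distrib_left sum_divide_distrib mult_ac)
      then have "err j = ray_mode N k + response ray_kernel a k"
        unfolding err_eq S_eq by (simp add: ray_mode_def j diff_divide_distrib right_diff_distrib)
      then show ?thesis using ray[of j] j by auto
    next
      case False
      then show ?thesis by (intro exI[of _ 0]) (simp add: ray_def ray_mode_def response_def ray_kernel_def)
    qed
  qed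
  ultimately show thesis using that charges pos by blast
qed

text \<open>Above a threshold \<epsilon> the number of charges and N are bounded uniformly in n, so
  \<open>countable_closure_values\<close> applies with finitely many modes as boundary terms. Only 0
  can escape all thresholds, and it adds a single point.\<close>

lemma countable_closure_ray_values:
  "countable (closure (range (\<lambda>n :: int. cosprod (ray \<theta> (r * of_int n)))))" (is "countable (closure ?V)")
proof -
  have part: "countable (closure ({\<epsilon><..} \<inter> ?V))" if \<epsilon>: "0 < \<epsilon>" for \<epsilon>
  proof -
    have c: "0 \<le> cos (pi / (2 * of_int total_p))" "cos (pi / (2 * of_int total_p)) < 1"
    proof -
      have tp: "1 \<le> real_of_int total_p" using total_p_ge_1 by simp
      then have "0 < pi / (2 * of_int total_p)" "pi / (2 * of_int total_p) \<le> pi / 2"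
        by (auto simp: field_simps)
      then show "0 \<le> cos (pi / (2 * of_int total_p))" "cos (pi / (2 * of_int total_p)) < 1"
        using cos_monotone_0_pi[of 0 "pi / (2 * of_int total_p)"] by (auto intro!: cos_ge_zero)
    qed
    obtain M where M: "\<And>f F. (\<And>k. 0 \<le> f k) \<Longrightarrow> (\<And>k :: int. f k \<le> 1) \<Longrightarrow> \<epsilon> < inf_prod f \<Longrightarrow>
      (\<And>k. k \<in> F \<Longrightarrow> f k \<le> cos (pi / (2 * of_int total_p))) \<Longrightarrow> finite F \<and> card F \<le> M"
      using card_le_of_inf_prod_gt[OF c \<epsilon>] by blast
    define B where "B = of_int q / r * (1 + of_int total_p * ((\<bar>\<kappa>\<bar> + C) * (2 / (1 - \<rho>)))) + of_int total_p * (C * (2 / (1 - \<rho>)))"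
    define N\<^sub>0 where "N\<^sub>0 = \<lceil>B\<rceil>"
    have "0 \<le> B" unfolding B_def using q r total_p_ge_1 C \<rho>
      by (intro add_nonneg_nonneg mult_nonneg_nonneg) auto
    then have N0: "0 \<le> N\<^sub>0" by (simp add: N\<^sub>0_def)
    define c\<^sub>1 where "c\<^sub>1 = (\<bar>\<kappa>\<bar> + C + r / of_int q * C) + r / of_int q * of_int N\<^sub>0"
    define W where "W = {cosprod (\<lambda>k. ray_mode N k + response ray_kernel a k) |N a.
      N \<in> {-N\<^sub>0..N\<^sub>0} \<and> a \<in> charges total_p ((d + 1) * M) \<and> supp a \<subseteq> {0..}}"
    have "countable (closure W)" unfolding W_def
    proof (rule countable_closure_values[where c\<^sub>1 = c\<^sub>1])
      show "0 \<le> c\<^sub>1" using C r q N0 by (simp add: c\<^sub>1_def)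
      show "\<bar>ray_mode N k\<bar> \<le> c\<^sub>1 * ((sqrt \<rho>)\<^sup>2) ^ nat \<bar>k\<bar>" if "N \<in> {-N\<^sub>0..N\<^sub>0}" for N k
      proof -
        have "\<bar>N\<bar> \<le> N\<^sub>0" using that by auto
        then have "\<bar>ray_mode N k\<bar> \<le> r / of_int q * of_int N\<^sub>0 * \<rho> ^ nat \<bar>k\<bar>" by (rule ray_mode_le)
        also have "\<dots> \<le> c\<^sub>1 * \<rho> ^ nat \<bar>k\<bar>"
          using C r q \<rho> by (intro mult_right_mono) (auto simp: c\<^sub>1_def)
        finally show ?thesis by (simp only: sqrt_\<rho>)
      qed
      show "\<bar>ray_kernel k l - green (k - l)\<bar> \<le> c\<^sub>1 * ((sqrt \<rho>)\<^sup>2) ^ (nat \<bar>k\<bar> + nat \<bar>l\<bar>)" if "0 \<le> l" for k l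
      proof -
        have "\<bar>ray_kernel k l - green (k - l)\<bar> \<le> (\<bar>\<kappa>\<bar> + C + r / of_int q * C) * \<rho> ^ (nat \<bar>k\<bar> + nat \<bar>l\<bar>)"
          using that by (rule ray_kernel_le)
        also have "\<dots> \<le> c\<^sub>1 * \<rho> ^ (nat \<bar>k\<bar> + nat \<bar>l\<bar>)"
          using r q \<rho> N0 by (intro mult_right_mono) (auto simp: c\<^sub>1_def)
        finally show ?thesis by (simp only: sqrt_\<rho>)
      qed
    qed (use total_p_ge_1 countable_closure_free_values in auto)
    have "{\<epsilon><..} \<inter> ?V \<subseteq> W"
    proof
      fix v assume "v \<in> {\<epsilon><..} \<inter> ?V"
      then obtain n :: int where v: "v = cosprod (ray \<theta> (r * of_int n))" "\<epsilon> < v" by auto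
      obtain N a where Na: "a \<in> charges total_p ((d + 1) * M)" "supp a \<subseteq> {0..}" "\<bar>of_int N\<bar> \<le> B"
        "cosprod (ray \<theta> (r * of_int n)) = cosprod (\<lambda>k. ray_mode N k + response ray_kernel a k)"
      proof (rule ray_representation[of n M])
        show "finite F \<and> card F \<le> M"
          if "\<And>k. k \<in> F \<Longrightarrow> \<bar>cos (pi * ray \<theta> (r * of_int n) k)\<bar> \<le> cos (pi / (2 * of_int total_p))" for F
          using v that by (intro M[of "\<lambda>k. \<bar>cos (pi * ray \<theta> (r * of_int n) k)\<bar>"]) (auto simp: cosprod_def)
      qed (auto simp: B_def)
      then have "N \<in> {-N\<^sub>0..N\<^sub>0}" unfolding N\<^sub>0_def by (auto simp: abs_le_iff) linarith+
      then show "v \<in> W" unfolding W_def v(1) using Na by blast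
    qed
    then have "closure ({\<epsilon><..} \<inter> ?V) \<subseteq> closure W" by (rule closure_mono)
    then show ?thesis using \<open>countable (closure W)\<close> by (rule countable_subset)
  qed
  have "closure ?V \<subseteq> {0} \<union> (\<Union>j::nat. closure ({1 / real (Suc j)<..} \<inter> ?V))"
  proof
    fix x assume x: "x \<in> closure ?V"
    have "?V \<subseteq> {0..}" by (auto simp: cosprod_nonneg)
    then have "closure ?V \<subseteq> {0..}" by (rule closure_minimal) simp
    then have "x = 0 \<or> 0 < x" using x by auto
    then show "x \<in> {0} \<union> (\<Union>j::nat. closure ({1 / real (Suc j)<..} \<inter> ?V))"
    proof
      assume "0 < x"
      then obtain j where "1 / real (Suc j) < x" using nat_approx_posE by metis
      then have "x \<in> closure ({1 / real (Suc j)<..} \<inter> ?V)"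
        using x open_Int_closure_subset[of "{1 / real (Suc j)<..}" ?V] by auto
      then show ?thesis by blast
    qed simp
  qed
  moreover have "countable ({0} \<union> (\<Union>j::nat. closure ({1 / real (Suc j)<..} \<inter> ?V)))"
    by (intro countable_Un countable_UN part) auto
  ultimately show ?thesis by (rule countable_subset)
qed

end

section \<open>Limit points of the transform values\<close>

lemma abs_sin_add_pi_of_int: "\<bar>sin (pi * (x + of_int n))\<bar> = \<bar>sin (pi * x)\<bar>"
proof -
  have "\<bar>cos (pi * of_int n)\<bar> = 1"
    using abs_cos_add_pi_of_int[of 0 n] by simp
  moreover have "sin (pi * (x + of_int n)) = sin (pi * x) * cos (pi * of_int n)"
    by (simp add: distrib_left sin_add sin_int_times_real mult.commute)
  ultimately show ?thesis by (simp add: abs_mult)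
qed

lemma abs_sin_pi_le: "\<bar>sin (pi * x)\<bar> \<le> pi * \<bar>x\<bar>"
  using abs_sin_x_le_abs_x[of "pi * x"] by (simp add: abs_mult)

lemma sin_pi_nonzero:
  assumes "0 < \<bar>x\<bar>" "\<bar>x\<bar> < 1" shows "sin (pi * x) \<noteq> 0"
proof -
  have "0 < sin (pi * \<bar>x\<bar>)" using assms by (intro sin_gt_zero) auto
  then show ?thesis by (cases "0 \<le> x") auto
qed

lemma one_minus_abs_cos_le: "1 - \<bar>cos x\<bar> \<le> \<bar>sin x\<bar>" for x :: real
  using abs_cos_diff_le_sin[of 0 x] by simp

lemma cosprod_pos:
  assumes \<rho>: "0 < \<rho>" "\<rho> < 1" and B: "0 \<le> B" and nz: "\<And>k. cos (pi * x k) \<noteq> 0"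
    and x: "\<And>k. \<bar>sin (pi * x k)\<bar> \<le> B * \<rho> ^ nat \<bar>k\<bar>"
  shows "0 < cosprod x"
  unfolding cosprod_def
proof (rule inf_prod_pos)
  have "(\<Sum>k\<in>F. 1 - \<bar>cos (pi * x k)\<bar>) \<le> B * (2 / (1 - \<rho>))" if "finite F" for F
  proof -
    have "(\<Sum>k\<in>F. 1 - \<bar>cos (pi * x k)\<bar>) \<le> (\<Sum>k\<in>F. B * \<rho> ^ nat \<bar>k - 0\<bar>)"
      by (intro sum_mono order_trans[OF one_minus_abs_cos_le]) (simp add: x)
    also have "\<dots> \<le> B * (2 / (1 - \<rho>))"
      unfolding sum_distrib_left[symmetric] by (intro mult_left_mono sum_geometric_int_le \<rho> that B)
    finally show ?thesis .
  qed
  then show "(\<lambda>k. 1 - \<bar>cos (pi * x k)\<bar>) summable_on UNIV"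
    by (intro nonneg_bdd_above_summable_on bdd_aboveI2) auto
qed (use nz in auto)

lemma cosprod_add_decay:
  fixes x y :: "int \<Rightarrow> real"
  assumes t: "0 < t" "t < 1"
    and x: "\<And>k. \<bar>sin (pi * x k)\<bar> \<le> B * (t\<^sup>2) ^ nat \<bar>k - l\<bar>"
    and y: "\<And>k. \<bar>sin (pi * y k)\<bar> \<le> B' * (t\<^sup>2) ^ nat \<bar>k - l'\<bar>"
  shows "\<bar>cosprod (\<lambda>k. x k + y k) - cosprod x * cosprod y\<bar> \<le> B * B' * (2 / (1 - t)) * t ^ nat \<bar>l - l'\<bar>"
proof (rule cosprod_add_le)
  fix F :: "int set" assume F: "finite F"
  have B: "0 \<le> B" "0 \<le> B'"
    using order_trans[OF abs_ge_zero x[of l]] order_trans[OF abs_ge_zero y[of l']] by auto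
  have "(\<Sum>k\<in>F. \<bar>sin (pi * x k)\<bar> * \<bar>sin (pi * y k)\<bar>)
      \<le> (\<Sum>k\<in>F. (B * (t\<^sup>2) ^ nat \<bar>k - l\<bar>) * (B' * (t\<^sup>2) ^ nat \<bar>k - l'\<bar>))"
    by (intro sum_mono mult_mono x y) (use B in auto)
  also have "\<dots> = B * B' * (\<Sum>k\<in>F. (t\<^sup>2) ^ nat \<bar>k - l\<bar> * (t\<^sup>2) ^ nat \<bar>k - l'\<bar>)"
    by (simp add: sum_distrib_left mult_ac)
  also have "\<dots> \<le> B * B' * (2 / (1 - t) * t ^ nat \<bar>l - l'\<bar>)"
    by (intro mult_left_mono sum_geometric_int_product_le t F) (use B in auto)
  finally show "(\<Sum>k\<in>F. \<bar>sin (pi * x k)\<bar> * \<bar>sin (pi * y k)\<bar>) \<le> B * B' * (2 / (1 - t)) * t ^ nat \<bar>l - l'\<bar>"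
    by (simp only: mult.assoc)
qed

lemma cosprod_diff_decay:
  assumes \<rho>: "0 < \<rho>" "\<rho> < 1" and B: "0 \<le> B"
    and x: "\<And>k. \<bar>sin (pi * (x k - y k))\<bar> \<le> B * \<rho> ^ nat \<bar>k\<bar>"
  shows "\<bar>cosprod x - cosprod y\<bar> \<le> B * (2 / (1 - \<rho>))"
proof (rule cosprod_diff_le)
  fix F :: "int set" assume F: "finite F"
  have "(\<Sum>k\<in>F. \<bar>sin (pi * (x k - y k))\<bar>) \<le> (\<Sum>k\<in>F. B * \<rho> ^ nat \<bar>k - 0\<bar>)"
    by (intro sum_mono) (simp add: x)
  also have "\<dots> \<le> B * (2 / (1 - \<rho>))"
    unfolding sum_distrib_left[symmetric] by (intro mult_left_mono sum_geometric_int_le \<rho> F B)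
  finally show "(\<Sum>k\<in>F. \<bar>sin (pi * (x k - y k))\<bar>) \<le> B * (2 / (1 - \<rho>))" .
qed

section \<open>Full lines of cosines and their action on the transform values\<close>

context pisot_sequence
begin

definition line :: "real \<Rightarrow> int \<Rightarrow> real" where
  "line c k = 2 * c * \<theta> powi (- k)"

text \<open>Closeness to integers makes the factors of \<open>line c\<close> tend to 1 at negative
  k; closeness to r times integers lets c \<theta>^j be imitated by an actual argument of the
  transform.\<close>

definition admissible :: "real \<Rightarrow> bool" where
  "admissible c \<longleftrightarrow> (\<exists>w v :: nat \<Rightarrow> int. \<exists>D.
     (\<forall>j. \<bar>c * \<theta> ^ j - of_int (w j)\<bar> \<le> D * \<rho> ^ j) \<and> (\<forall>j. \<bar>c * \<theta> ^ j - r * of_int (v j)\<bar> \<le> D * \<rho> ^ j))"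

text \<open>Both q h j and r T j approximate q \<kappa> \<theta>^j, with errors governed by q C and
  r C; the sum (q + r) C serves for both.\<close>

lemma admissible_base: "admissible (of_int q * \<kappa>)"
  unfolding admissible_def
proof (intro exI conjI allI)
  fix j
  have "of_int q * \<kappa> * \<theta> ^ j - of_int (q * h j) = - of_int q * (of_int (h j) - \<kappa> * \<theta> ^ j)"
    by (simp add: algebra_simps)
  then have "\<bar>of_int q * \<kappa> * \<theta> ^ j - of_int (q * h j)\<bar> = of_int q * \<bar>of_int (h j) - \<kappa> * \<theta> ^ j\<bar>"
    using q by (simp add: abs_mult)
  also have "\<dots> \<le> (of_int q + r) * (C * \<rho> ^ j)"
    using q r C \<rho> by (intro mult_mono h) auto
  finally show "\<bar>of_int q * \<kappa> * \<theta> ^ j - of_int (q * h j)\<bar> \<le> ((of_int q + r) * C) * \<rho> ^ j" by (simp add: mult.assoc)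
  have "of_int q * \<kappa> * \<theta> ^ j - r * of_int (T j) = - r * (of_int (T j) - of_int q / r * \<kappa> * \<theta> ^ j)"
    using r by (simp add: field_simps)
  then have "\<bar>of_int q * \<kappa> * \<theta> ^ j - r * of_int (T j)\<bar> = r * \<bar>of_int (T j) - of_int q / r * \<kappa> * \<theta> ^ j\<bar>"
    using r by (simp add: abs_mult)
  also have "\<dots> \<le> (of_int q + r) * (C * \<rho> ^ j)"
    using q r C \<rho> by (intro mult_mono T) auto
  finally show "\<bar>of_int q * \<kappa> * \<theta> ^ j - r * of_int (T j)\<bar> \<le> ((of_int q + r) * C) * \<rho> ^ j" by (simp add: mult.assoc)
qed

lemma admissible_add:
  assumes "admissible c" "admissible c'" shows "admissible (c + c')"
proof -
  obtain w v D where 1: "\<And>j. \<bar>c * \<theta> ^ j - of_int (w j)\<bar> \<le> D * \<rho> ^ j" "\<And>j. \<bar>c * \<theta> ^ j - r * of_int (v j)\<bar> \<le> D * \<rho> ^ j"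
    using assms(1) unfolding admissible_def by blast
  obtain w' v' D' where 2: "\<And>j. \<bar>c' * \<theta> ^ j - of_int (w' j)\<bar> \<le> D' * \<rho> ^ j" "\<And>j. \<bar>c' * \<theta> ^ j - r * of_int (v' j)\<bar> \<le> D' * \<rho> ^ j"
    using assms(2) unfolding admissible_def by blast
  show ?thesis unfolding admissible_def
  proof (intro exI conjI allI)
    fix j
    show "\<bar>(c + c') * \<theta> ^ j - of_int (w j + w' j)\<bar> \<le> (D + D') * \<rho> ^ j"
      using 1(1)[of j] 2(1)[of j] unfolding of_int_add distrib_right by linarith
    show "\<bar>(c + c') * \<theta> ^ j - r * of_int (v j + v' j)\<bar> \<le> (D + D') * \<rho> ^ j"
      using 1(2)[of j] 2(2)[of j] unfolding of_int_add distrib_right distrib_left by linarith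
  qed
qed

lemma admissible_minus:
  assumes "admissible c" shows "admissible (- c)"
proof -
  obtain w v D where 1: "\<And>j. \<bar>c * \<theta> ^ j - of_int (w j)\<bar> \<le> D * \<rho> ^ j" "\<And>j. \<bar>c * \<theta> ^ j - r * of_int (v j)\<bar> \<le> D * \<rho> ^ j"
    using assms(1) unfolding admissible_def by blast
  show ?thesis unfolding admissible_def
  proof (intro exI conjI allI)
    fix j
    show "\<bar>- c * \<theta> ^ j - of_int (- w j)\<bar> \<le> D * \<rho> ^ j" using 1(1)[of j] by (simp add: abs_minus_commute)
    show "\<bar>- c * \<theta> ^ j - r * of_int (- v j)\<bar> \<le> D * \<rho> ^ j" using 1(2)[of j] by (simp add: abs_minus_commute)
  qed
qed

lemma admissible_power:
  assumes "admissible c" shows "admissible (c * \<theta> ^ i)"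
proof -
  obtain w v D where 1: "\<And>j. \<bar>c * \<theta> ^ j - of_int (w j)\<bar> \<le> D * \<rho> ^ j" "\<And>j. \<bar>c * \<theta> ^ j - r * of_int (v j)\<bar> \<le> D * \<rho> ^ j"
    using assms(1) unfolding admissible_def by blast
  show ?thesis unfolding admissible_def
  proof (intro exI conjI allI)
    fix j
    show "\<bar>c * \<theta> ^ i * \<theta> ^ j - of_int (w (i + j))\<bar> \<le> (D * \<rho> ^ i) * \<rho> ^ j"
      using 1(1)[of "i + j"] by (simp add: power_add mult.assoc)
    show "\<bar>c * \<theta> ^ i * \<theta> ^ j - r * of_int (v (i + j))\<bar> \<le> (D * \<rho> ^ i) * \<rho> ^ j"
      using 1(2)[of "i + j"] by (simp add: power_add mult.assoc)
  qed
qed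

lemma admissible_two_power: "admissible (2 ^ i * (of_int q * \<kappa>))"
proof (induction i)
  case (Suc i)
  then have "admissible (2 ^ i * (of_int q * \<kappa>) + 2 ^ i * (of_int q * \<kappa>))" by (intro admissible_add)
  moreover have "2 ^ i * (of_int q * \<kappa>) + 2 ^ i * (of_int q * \<kappa>) = 2 ^ Suc i * (of_int q * \<kappa>)" by simp
  ultimately show ?case by (simp only:)
qed (simp add: admissible_base)

lemma line_shift: "line (c * \<theta> ^ j) k = line c (k - int j)"
proof -
  have "\<theta> powi (- (k - int j)) = \<theta> powi (- k + int j)" by (rule arg_cong) simp
  also have "\<dots> = \<theta> powi (- k) * \<theta> ^ j" using \<theta> by (subst power_int_add) auto
  finally show ?thesis by (simp add: line_def)
qed

lemma cosprod_line_shift: "cosprod (line (c * \<theta> ^ j)) = cosprod (line c)"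
proof -
  have "line (c * \<theta> ^ j) = (\<lambda>k. line c (k + - int j))" by (simp add: fun_eq_iff line_shift)
  then show ?thesis by (simp only: cosprod_shift)
qed

lemma line_nonneg: "0 \<le> k \<Longrightarrow> line c k = 2 * c / \<theta> ^ nat k"
  by (cases "k = 0") (simp_all add: line_def power_int_def power_inverse divide_inverse)

lemma sin_line_decay:
  assumes "admissible c"
  obtains B where "0 \<le> B" "\<And>k. \<bar>sin (pi * line c k)\<bar> \<le> B * \<rho> ^ nat \<bar>k\<bar>"
proof -
  obtain w v D where 1: "\<And>j. \<bar>c * \<theta> ^ j - of_int (w j)\<bar> \<le> D * \<rho> ^ j"
    using assms(1) unfolding admissible_def by blast
  have D: "0 \<le> D" using order_trans[OF abs_ge_zero 1[of 0]] by simp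
  show thesis
  proof (rule that[of "2 * pi * (\<bar>c\<bar> + D)"])
    fix k
    show "\<bar>sin (pi * line c k)\<bar> \<le> 2 * pi * (\<bar>c\<bar> + D) * \<rho> ^ nat \<bar>k\<bar>"
    proof (cases "0 \<le> k")
      case True
      have "\<bar>sin (pi * line c k)\<bar> \<le> pi * \<bar>line c k\<bar>" by (rule abs_sin_pi_le)
      also have "\<dots> = 2 * pi * \<bar>c\<bar> * (1 / \<theta> ^ nat k)" using True \<theta> by (simp add: line_nonneg abs_mult abs_divide)
      also have "\<dots> \<le> 2 * pi * (\<bar>c\<bar> + D) * \<rho> ^ nat k"
        using D \<theta> by (intro mult_mono inverse_power_\<theta>_le) auto
      finally show ?thesis using True by simp
    next
      case False
      define j where "j = nat (- k)"
      have k: "line c k = 2 * (c * \<theta> ^ j - of_int (w j)) + of_int (2 * w j)"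
        using False by (simp add: line_def j_def power_int_def)
      have "\<bar>sin (pi * line c k)\<bar> = \<bar>sin (pi * (2 * (c * \<theta> ^ j - of_int (w j))))\<bar>"
        unfolding k by (rule abs_sin_add_pi_of_int)
      also have "\<dots> \<le> pi * \<bar>2 * (c * \<theta> ^ j - of_int (w j))\<bar>" by (rule abs_sin_pi_le)
      also have "\<dots> = 2 * pi * \<bar>c * \<theta> ^ j - of_int (w j)\<bar>" by (simp only: abs_mult)
      also have "\<dots> \<le> 2 * pi * (D * \<rho> ^ j)" by (intro mult_left_mono 1) auto
      also have "\<dots> \<le> 2 * pi * ((\<bar>c\<bar> + D) * \<rho> ^ j)"
        using \<rho> by (intro mult_left_mono mult_right_mono) auto
      finally show ?thesis using False by (simp add: j_def mult.assoc)
    qed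
  qed (use D in simp)
qed

lemma sin_ray_le: "\<bar>sin (pi * ray \<theta> s k)\<bar> \<le> 2 * pi * \<bar>s\<bar> * \<rho> ^ nat \<bar>k\<bar>"
proof (cases "0 \<le> k")
  case True
  have "\<bar>sin (pi * ray \<theta> s k)\<bar> \<le> pi * \<bar>ray \<theta> s k\<bar>" by (rule abs_sin_pi_le)
  also have "\<dots> = 2 * pi * \<bar>s\<bar> * (1 / \<theta> ^ nat k)" using True \<theta> by (simp add: ray_def abs_mult abs_divide)
  also have "\<dots> \<le> 2 * pi * \<bar>s\<bar> * \<rho> ^ nat k" by (intro mult_left_mono inverse_power_\<theta>_le) auto
  finally show ?thesis using True by simp
qed (use \<rho> in \<open>simp add: ray_def\<close>)

text \<open>Adding v j to n superposes on the ray of r n a copy of \<open>line c\<close>, translated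
  by j and cut off at 0. As j grows the copy moves away, so the product factorizes, and the cut
  falls where the line is close to even integers.\<close>

lemma ray_values_tendsto:
  assumes "admissible c"
  obtains v :: "nat \<Rightarrow> int" where
    "\<And>n :: int. (\<lambda>j. cosprod (ray \<theta> (r * of_int (n + v j)))) \<longlonglongrightarrow> cosprod (ray \<theta> (r * of_int n)) * cosprod (line c)"
proof -
  obtain w v D where v: "\<And>j. \<bar>c * \<theta> ^ j - r * of_int (v j)\<bar> \<le> D * \<rho> ^ j"
    using assms(1) unfolding admissible_def by blast
  have D: "0 \<le> D" using order_trans[OF abs_ge_zero v[of 0]] by simp
  obtain B where B: "0 \<le> B" "\<And>k. \<bar>sin (pi * line c k)\<bar> \<le> B * \<rho> ^ nat \<bar>k\<bar>"
    using sin_line_decay[OF assms] by blast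
  let ?t = "sqrt \<rho>"
  have "(\<lambda>j. cosprod (ray \<theta> (r * of_int (n + v j)))) \<longlonglongrightarrow> cosprod (ray \<theta> (r * of_int n)) * cosprod (line c)" for n
  proof -
    let ?x = "ray \<theta> (r * of_int n)"
    \<comment> \<open>One term each for replacing r v j by c \<theta>^j, for the interaction with
      the ray of r n, and for the cut at 0.\<close>
    define E where "E j = 2 * pi * D * (2 / (1 - \<rho>)) * \<rho> ^ j
      + 2 * pi * \<bar>r * of_int n\<bar> * B * (2 / (1 - ?t)) * ?t ^ j + B * (2 / (1 - \<rho>)) * \<rho> ^ j" for j
    have "\<bar>cosprod (ray \<theta> (r * of_int (n + v j))) - cosprod ?x * cosprod (line c)\<bar> \<le> E j" for j
    proof -
      let ?y = "ray \<theta> (c * \<theta> ^ j)"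
      have 1: "\<bar>cosprod (ray \<theta> (r * of_int (n + v j))) - cosprod (\<lambda>k. ?x k + ?y k)\<bar> \<le> (2 * pi * D * \<rho> ^ j) * (2 / (1 - \<rho>))"
      proof (rule cosprod_diff_decay[OF \<rho>(1,2)])
        fix k
        have "ray \<theta> (r * of_int (n + v j)) k - (?x k + ?y k) = ray \<theta> (- (c * \<theta> ^ j - r * of_int (v j))) k"
          by (simp add: ray_def distrib_left right_diff_distrib add_divide_distrib diff_divide_distrib)
        then have "\<bar>sin (pi * (ray \<theta> (r * of_int (n + v j)) k - (?x k + ?y k)))\<bar> \<le> 2 * pi * \<bar>c * \<theta> ^ j - r * of_int (v j)\<bar> * \<rho> ^ nat \<bar>k\<bar>"
          using sin_ray_le[of "- (c * \<theta> ^ j - r * of_int (v j))" k] by (simp only: abs_minus_cancel)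
        also have "\<dots> \<le> 2 * pi * (D * \<rho> ^ j) * \<rho> ^ nat \<bar>k\<bar>"
          using \<rho> by (intro mult_right_mono mult_left_mono v) auto
        finally show "\<bar>sin (pi * (ray \<theta> (r * of_int (n + v j)) k - (?x k + ?y k)))\<bar> \<le> 2 * pi * D * \<rho> ^ j * \<rho> ^ nat \<bar>k\<bar>"
          by (simp only: mult.assoc)
      qed (use D \<rho> in auto)
      have y: "?y k = (if 0 \<le> k then line c (k - int j) else 0)" for k
        using line_nonneg[of k "c * \<theta> ^ j"] by (simp add: ray_def line_shift[symmetric] mult.assoc)
      have "\<bar>cosprod (\<lambda>k. ?x k + ?y k) - cosprod ?x * cosprod ?y\<bar> \<le> (2 * pi * \<bar>r * of_int n\<bar>) * B * (2 / (1 - ?t)) * ?t ^ nat \<bar>0 - int j\<bar>"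
      proof (rule cosprod_add_decay[OF sqrt_\<rho>(1,2), unfolded sqrt_\<rho>])
        show "\<bar>sin (pi * ?x k)\<bar> \<le> 2 * pi * \<bar>r * of_int n\<bar> * \<rho> ^ nat \<bar>k - 0\<bar>" for k
          using sin_ray_le by simp
        show "\<bar>sin (pi * ?y k)\<bar> \<le> B * \<rho> ^ nat \<bar>k - int j\<bar>" for k
          unfolding y using B \<rho> by auto
      qed
      then have 2: "\<bar>cosprod (\<lambda>k. ?x k + ?y k) - cosprod ?x * cosprod ?y\<bar> \<le> (2 * pi * \<bar>r * of_int n\<bar>) * B * (2 / (1 - ?t)) * ?t ^ j"
        by simp
      have "\<bar>cosprod ?y - cosprod (line (c * \<theta> ^ j))\<bar> \<le> (B * \<rho> ^ j) * (2 / (1 - \<rho>))"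
      proof (rule cosprod_diff_decay[OF \<rho>(1,2)])
        fix k
        show "\<bar>sin (pi * (?y k - line (c * \<theta> ^ j) k))\<bar> \<le> B * \<rho> ^ j * \<rho> ^ nat \<bar>k\<bar>"
        proof (cases "0 \<le> k")
          case True then show ?thesis using B \<rho> by (simp add: y line_shift)
        next
          case False
          then have "nat \<bar>k - int j\<bar> = j + nat \<bar>k\<bar>" by linarith
          then show ?thesis using False B(2)[of "k - int j"] by (simp add: y line_shift power_add mult.assoc)
        qed
      qed (use B \<rho> in auto)
      then have "\<bar>cosprod ?y - cosprod (line c)\<bar> \<le> (B * \<rho> ^ j) * (2 / (1 - \<rho>))"
        by (simp only: cosprod_line_shift)
      then have "\<bar>cosprod ?x * cosprod ?y - cosprod ?x * cosprod (line c)\<bar> \<le> (B * \<rho> ^ j) * (2 / (1 - \<rho>))"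
        using mult_left_le_one_le[of "\<bar>cosprod ?y - cosprod (line c)\<bar>" "cosprod ?x"] cosprod_nonneg[of ?x] cosprod_le_1[of ?x]
        by (simp flip: right_diff_distrib add: abs_mult)
      then show ?thesis using 1 2 unfolding E_def by (simp only: mult_ac)
    qed
    then have le: "\<forall>\<^sub>F j in sequentially. norm (cosprod (ray \<theta> (r * of_int (n + v j))) - cosprod ?x * cosprod (line c)) \<le> E j"
      by (intro always_eventually allI) (simp only: real_norm_def)
    have "E \<longlonglongrightarrow> 0"
    proof -
      have "(\<lambda>j. a * \<rho> ^ j) \<longlonglongrightarrow> 0" "(\<lambda>j. a * ?t ^ j) \<longlonglongrightarrow> 0" for a
        using tendsto_mult_left[OF LIMSEQ_realpow_zero[of \<rho>], of a] tendsto_mult_left[OF LIMSEQ_realpow_zero[of ?t], of a] \<rho> sqrt_\<rho>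
        by simp_all
      then show ?thesis unfolding E_def by (intro tendsto_add_zero)
    qed
    with le have "(\<lambda>j. cosprod (ray \<theta> (r * of_int (n + v j))) - cosprod ?x * cosprod (line c)) \<longlonglongrightarrow> 0"
      by (rule Lim_null_comparison)
    then show ?thesis by (rule LIM_zero_cancel)
  qed
  then show thesis by (rule that)
qed

end

section \<open>Nonvanishing and accumulation of the full-line products\<close>

context pisot_sequence
begin

lemma line_double: "line (2 * c) k = 2 * line c k"
  by (simp add: line_def)

text \<open>If the product of \<open>c\<^sub>i = 2\<^sup>i q \<kappa>\<close> vanishes for every \<open>i\<close>, then \<open>4 c\<^sub>i \<theta>\<^sup>-\<^sup>k\<close> is an odd integer for some
  \<open>k = k\<^sub>i\<close>. Comparing \<open>i\<close> with \<open>i + 1\<close> shows that a power of \<open>\<theta>\<close> is rational and that \<open>k\<^sub>i\<close> is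
  strictly increasing, which for \<open>\<theta> > 2\<close> forces a nonzero integer below \<open>1\<close>.\<close>

lemma exists_nonvanishing:
  assumes big: "\<forall>j\<ge>1. \<theta> ^ j \<in> \<rat> \<longrightarrow> (\<exists>n::int. \<theta> = of_int n \<and> 2 < n)"
  obtains c where "admissible c" "c \<noteq> 0" "0 < cosprod (line c)"
proof (rule ccontr)
  assume none: "\<not> thesis"
  define c where "c i = 2 ^ i * (of_int q * \<kappa>)" for i :: nat
  have adm: "admissible (c i)" for i unfolding c_def by (rule admissible_two_power)
  have c0: "c i \<noteq> 0" for i using q \<kappa> by (simp add: c_def)
  have "\<exists>k m. odd m \<and> 2 * line (c i) k = of_int m" for i
  proof (rule ccontr)
    assume no: "\<not> ?thesis"
    have "cos (pi * line (c i) k) \<noteq> 0" for k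
    proof
      assume "cos (pi * line (c i) k) = 0"
      then obtain m :: int where m: "odd m" "pi * line (c i) k = of_int m * (pi / 2)"
        by (auto simp: cos_zero_iff_int)
      then have "pi * (2 * line (c i) k) = pi * of_int m" by simp
      then have "2 * line (c i) k = of_int m" by (simp only: mult_left_cancel pi_neq_zero not_False_eq_True)
      then show False using no m(1) by blast
    qed
    moreover obtain B where "0 \<le> B" "\<And>k. \<bar>sin (pi * line (c i) k)\<bar> \<le> B * \<rho> ^ nat \<bar>k\<bar>"
      using sin_line_decay[OF adm] by blast
    ultimately have "0 < cosprod (line (c i))" using cosprod_pos[OF \<rho>(1,2)] by blast
    then show False using none that adm c0 by blast
  qed
  then obtain k m where km: "\<And>i. odd (m i)" "\<And>i. 2 * line (c i) (k i) = of_int (m i)"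
    by metis
  have m0: "m i \<noteq> 0" for i using km(1)[of i] by auto
  \<comment> \<open>As \<open>c (Suc i)\<close> is twice \<open>c i\<close>, eliminating it between
    the two exceptional indices leaves 2 times a power of \<theta> as the ratio of two odd
    integers.\<close>
  have rel: "of_int (m (Suc i)) * \<theta> powi (k (Suc i) - k i) = 2 * real_of_int (m i)" for i
  proof -
    have "of_int (m (Suc i)) = 2 * (2 * line (c i) (k (Suc i)))"
      using km(2)[of "Suc i"] line_double[of "c i" "k (Suc i)"] by (simp add: c_def mult.assoc)
    also have "\<dots> * \<theta> powi (k (Suc i) - k i) = 2 * (2 * line (c i) (k i))"
    proof -
      have "\<theta> powi (- k (Suc i)) * \<theta> powi (k (Suc i) - k i) = \<theta> powi (- k i)"
        using \<theta> by (subst power_int_add[symmetric]) auto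
      then show ?thesis by (simp add: line_def)
    qed
    finally show ?thesis by (simp add: km(2))
  qed
  have step: "k i < k (Suc i) \<and> (\<exists>n::int. \<theta> = of_int n \<and> 2 < n)" for i
  proof -
    \<comment> \<open>The first two cases make \<open>m (Suc i)\<close> even, the second one after
      \<open>big\<close> has shown \<theta> to be an integer; the third is the claim itself.\<close>
    consider "k (Suc i) = k i" | "k (Suc i) < k i" | "k i < k (Suc i)" by linarith
    then show ?thesis
    proof cases
      case 1
      then have "of_int (m (Suc i)) = real_of_int (2 * m i)" using rel[of i] by simp
      then have "m (Suc i) = 2 * m i" by (simp only: of_int_eq_iff)
      then show ?thesis using km(1)[of "Suc i"] by simp
    next
      case 2
      define j where "j = nat (k i - k (Suc i))"
      have j: "k (Suc i) - k i = - int j" "j \<ge> 1" using 2 by (auto simp: j_def)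
      have eq: "of_int (m (Suc i)) = 2 * real_of_int (m i) * \<theta> ^ j"
        using rel[of i] \<theta> unfolding j(1) by (simp add: power_int_minus field_simps)
      then have "\<theta> ^ j = of_int (m (Suc i)) / (2 * of_int (m i))" using m0[of i] by (simp add: field_simps)
      then have "\<theta> ^ j \<in> \<rat>" by auto
      then obtain n :: int where "\<theta> = of_int n" using big j(2) by blast
      then have "of_int (m (Suc i)) = real_of_int (2 * m i * n ^ j)" using eq by simp
      then have "m (Suc i) = 2 * m i * n ^ j" by (simp only: of_int_eq_iff)
      then show ?thesis using km(1)[of "Suc i"] by simp
    next
      case 3
      define j where "j = nat (k (Suc i) - k i)"
      have j: "k (Suc i) - k i = int j" "j \<ge> 1" using 3 by (auto simp: j_def)
      have "of_int (m (Suc i)) * \<theta> ^ j = 2 * real_of_int (m i)" using rel[of i] unfolding j(1) by simp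
      then have "\<theta> ^ j = 2 * of_int (m i) / of_int (m (Suc i))" using m0[of "Suc i"] by (simp add: field_simps)
      then have "\<theta> ^ j \<in> \<rat>" by auto
      then show ?thesis using big j(2) 3 by blast
    qed
  qed
  then have \<theta>2: "\<theta> > 2" by fastforce
  have grow: "k 0 + int i \<le> k i" for i
  proof (induction i)
    case (Suc i)
    then show ?case using step[of i] by simp
  qed simp
  define A where "A = 4 * \<bar>of_int q * \<kappa>\<bar> * \<theta> powi (- k 0)"
  \<comment> \<open>\<open>c i\<close> grows like 2^i, while \<open>k i\<close> has increased by at
    least i and contributes a factor of at most \<theta>^(-i).\<close>
  have small: "\<bar>of_int (m i)\<bar> \<le> A * (2 / \<theta>) ^ i" for i
  proof -
    have "\<bar>of_int (m i)\<bar> = 4 * \<bar>of_int q * \<kappa>\<bar> * 2 ^ i * \<theta> powi (- k i)"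
      using \<theta> by (simp add: km(2)[symmetric] line_def c_def abs_mult power_abs)
    also have "\<dots> \<le> 4 * \<bar>of_int q * \<kappa>\<bar> * 2 ^ i * \<theta> powi (- k 0 - int i)"
      using grow[of i] \<theta> by (intro mult_left_mono power_int_increasing) auto
    also have "\<theta> powi (- k 0 - int i) = \<theta> powi (- k 0) / \<theta> ^ i"
      using \<theta> by (simp add: power_int_diff)
    finally show ?thesis by (simp add: A_def power_divide mult_ac)
  qed
  have "(\<lambda>i. A * (2 / \<theta>) ^ i) \<longlonglongrightarrow> 0"
    using tendsto_mult_left[OF LIMSEQ_realpow_zero[of "2 / \<theta>"], of A] \<theta>2 by simp
  then have "eventually (\<lambda>i. A * (2 / \<theta>) ^ i < 1) sequentially" by (rule order_tendstoD) simp
  then obtain i where "A * (2 / \<theta>) ^ i < 1" by (auto simp: eventually_sequentially)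
  then have "\<bar>real_of_int (m i)\<bar> < 1" using small[of i] by linarith
  then show False using m0[of i] by linarith
qed

text \<open>Since \<open>cos (a + b) cos (a - b) = cos\<^sup>2 a cos\<^sup>2 b - sin\<^sup>2 a sin\<^sup>2 b\<close>, the values at \<open>c\<theta>\<^sup>j + c\<close> and \<open>c\<theta>\<^sup>j - c\<close>
  cannot both equal their common limit.\<close>

lemma exists_limit_point:
  assumes c: "admissible c" "c \<noteq> 0" and pos: "0 < cosprod (line c)" and e: "0 < e"
  shows "\<exists>c'. admissible c' \<and> cosprod (line c') \<noteq> cosprod (line c) ^ 2 \<and> \<bar>cosprod (line c') - cosprod (line c) ^ 2\<bar> < e"
proof -
  define L where "L = cosprod (line c)"
  obtain B where B: "0 \<le> B" "\<And>k. \<bar>sin (pi * line c k)\<bar> \<le> B * \<rho> ^ nat \<bar>k\<bar>"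
    using sin_line_decay[OF c(1)] by blast
  let ?t = "sqrt \<rho>"
  have near: "\<bar>cosprod (line (c * \<theta> ^ j + s * c)) - L ^ 2\<bar> \<le> B * B * (2 / (1 - ?t)) * ?t ^ j"
    if s: "s = 1 \<or> s = -1" for j and s :: real
  proof -
    have "\<bar>cosprod (\<lambda>k. line (c * \<theta> ^ j) k + line (s * c) k) - cosprod (line (c * \<theta> ^ j)) * cosprod (line (s * c))\<bar>
        \<le> B * B * (2 / (1 - ?t)) * ?t ^ nat \<bar>int j - 0\<bar>"
    proof (rule cosprod_add_decay[OF sqrt_\<rho>(1,2), unfolded sqrt_\<rho>])
      show "\<bar>sin (pi * line (c * \<theta> ^ j) k)\<bar> \<le> B * \<rho> ^ nat \<bar>k - int j\<bar>" for k
        unfolding line_shift by (rule B)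
      show "\<bar>sin (pi * line (s * c) k)\<bar> \<le> B * \<rho> ^ nat \<bar>k - 0\<bar>" for k
        using s B(2)[of k] by (auto simp: line_def)
    qed
    moreover have "(\<lambda>k. line (c * \<theta> ^ j) k + line (s * c) k) = line (c * \<theta> ^ j + s * c)"
      by (simp add: line_def fun_eq_iff algebra_simps)
    moreover have "cosprod (line (s * c)) = L"
      using s by (auto simp: L_def cosprod_def line_def)
    ultimately show ?thesis by (simp add: cosprod_line_shift L_def power2_eq_square)
  qed
  have "(\<lambda>j. B * B * (2 / (1 - ?t)) * ?t ^ j) \<longlonglongrightarrow> 0" "(\<lambda>j. B * B * \<rho> ^ j) \<longlonglongrightarrow> 0"
    using tendsto_mult_left[OF LIMSEQ_realpow_zero[of \<rho>], of "B * B"]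
      tendsto_mult_left[OF LIMSEQ_realpow_zero[of ?t], of "B * B * (2 / (1 - ?t))"] \<rho> sqrt_\<rho> by simp_all
  \<comment> \<open>The first bound puts both values within e of L^2. The second gives s \<le> g
    further down, so that f equals g - s without an absolute value.\<close>
  then have "eventually (\<lambda>j. B * B * (2 / (1 - ?t)) * ?t ^ j < e) sequentially" "eventually (\<lambda>j. B * B * \<rho> ^ j < L ^ 2) sequentially"
    using e pos by (auto intro!: order_tendstoD(2) simp: L_def)
  then have "eventually (\<lambda>j. B * B * (2 / (1 - ?t)) * ?t ^ j < e \<and> B * B * \<rho> ^ j < L ^ 2) sequentially"
    by (rule eventually_conj)
  then obtain j where j: "B * B * (2 / (1 - ?t)) * ?t ^ j < e" "B * B * \<rho> ^ j < L ^ 2"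
    by (auto simp: eventually_sequentially)
  define x where "x k = pi * line c k" for k
  define y where "y k = pi * line (c * \<theta> ^ j) k" for k
  define f where "f k = \<bar>cos (y k + x k)\<bar> * \<bar>cos (y k - x k)\<bar>" for k
  define g where "g k = (\<bar>cos (y k)\<bar> * \<bar>cos (y k)\<bar>) * (\<bar>cos (x k)\<bar> * \<bar>cos (x k)\<bar>)" for k
  have Lx: "L \<le> \<bar>cos (x k)\<bar>" for k
    unfolding L_def cosprod_def x_def by (rule inf_prod_le_factor[of "\<lambda>k. \<bar>cos (pi * line c k)\<bar>"]) simp
  have Ly: "L \<le> \<bar>cos (y k)\<bar>" for k using Lx[of "k - int j"] by (simp add: x_def y_def line_shift)
  have L0: "0 < L" using pos by (simp add: L_def)
  define s where "s k = (sin (y k) * sin (x k))\<^sup>2" for k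
  have f_eq: "f k = \<bar>g k - s k\<bar>" for k
  proof -
    have "cos (y k + x k) * cos (y k - x k) = (cos (y k) * cos (y k)) * (cos (x k) * cos (x k)) - (sin (y k) * sin (x k))\<^sup>2"
      by (simp add: cos_add cos_diff power2_eq_square algebra_simps)
    then show ?thesis unfolding f_def g_def s_def by (simp flip: abs_mult)
  qed
  have s_le: "s k \<le> g k" for k
  proof -
    have "\<bar>sin (y k)\<bar> * \<bar>sin (x k)\<bar> \<le> (B * \<rho> ^ nat \<bar>k - int j\<bar>) * (B * \<rho> ^ nat \<bar>k\<bar>)"
      unfolding x_def y_def line_shift by (intro mult_mono B) (use B \<rho> in auto)
    also have "\<dots> = B * B * \<rho> ^ (nat \<bar>k - int j\<bar> + nat \<bar>k\<bar>)" by (simp add: power_add)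
    also have "\<dots> \<le> B * B * \<rho> ^ j"
      by (intro mult_left_mono power_decreasing) (use B \<rho> in auto)
    also have "\<dots> \<le> L * L" using j(2) by (simp add: power2_eq_square)
    also have "\<dots> \<le> \<bar>cos (y k)\<bar> * \<bar>cos (x k)\<bar>" by (intro mult_mono Lx Ly) (use L0 in auto)
    finally have "(\<bar>sin (y k)\<bar> * \<bar>sin (x k)\<bar>)\<^sup>2 \<le> (\<bar>cos (y k)\<bar> * \<bar>cos (x k)\<bar>)\<^sup>2"
      by (intro power_mono) auto
    then show ?thesis by (simp add: s_def g_def power2_eq_square mult_ac abs_mult)
  qed
  have f_le: "f k = g k - s k" for k using s_le[of k] by (simp add: f_eq)
  have ge_1: "g k \<le> 1" for k unfolding g_def by (intro mult_le_one mult_nonneg_nonneg) auto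
  have cos_prod: "inf_prod (\<lambda>k. \<bar>cos (x k)\<bar>) = L" by (simp add: x_def L_def cosprod_def)
  have cos_prod_y: "inf_prod (\<lambda>k. \<bar>cos (y k)\<bar>) = L"
    using cosprod_line_shift[of c j] by (simp add: y_def L_def cosprod_def)
  have sq: "inf_prod (\<lambda>k. \<bar>cos (z k)\<bar> * \<bar>cos (z k)\<bar>) = inf_prod (\<lambda>k. \<bar>cos (z k)\<bar>) * inf_prod (\<lambda>k. \<bar>cos (z k)\<bar>)" for z :: "int \<Rightarrow> real"
    by (rule inf_prod_mult) auto
  have "inf_prod g = inf_prod (\<lambda>k. \<bar>cos (y k)\<bar> * \<bar>cos (y k)\<bar>) * inf_prod (\<lambda>k. \<bar>cos (x k)\<bar> * \<bar>cos (x k)\<bar>)"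
    unfolding g_def
    by (rule inf_prod_mult) (intro mult_le_one mult_nonneg_nonneg abs_cos_le_one abs_ge_zero)+
  also have "\<dots> = (L * L) * (L * L)" by (simp only: sq cos_prod cos_prod_y)
  finally have g: "inf_prod g = L ^ 2 * L ^ 2" by (simp only: power2_eq_square)
  have f: "inf_prod f = cosprod (line (c * \<theta> ^ j + 1 * c)) * cosprod (line (c * \<theta> ^ j + (-1) * c))"
  proof -
    have "inf_prod f = inf_prod (\<lambda>k. \<bar>cos (y k + x k)\<bar>) * inf_prod (\<lambda>k. \<bar>cos (y k - x k)\<bar>)"
      unfolding f_def by (rule inf_prod_mult) auto
    then show ?thesis
      by (simp add: cosprod_def x_def y_def line_def algebra_simps)
  qed
  have "inf_prod f < inf_prod g"
  proof -
    \<comment> \<open>At k = n + j both \<open>line c k\<close> and the translated value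
      \<open>line c n\<close> lie strictly between 0 and 1 in modulus, so neither sine vanishes and
      one factor drops strictly.\<close>
    obtain n where n: "2 * \<bar>c\<bar> < \<theta> ^ n" using real_arch_pow[OF \<theta>] by blast
    define k where "k = int (n + j)"
    have small: "0 < \<bar>line c (int i)\<bar> \<and> \<bar>line c (int i)\<bar> < 1" if "n \<le> i" for i
    proof -
      have "\<theta> ^ n \<le> \<theta> ^ i" using that \<theta> by (intro power_increasing) auto
      then have "2 * \<bar>c\<bar> < \<theta> ^ i" using n by linarith
      then show ?thesis using c(2) \<theta> by (simp add: line_nonneg abs_mult abs_divide)
    qed
    have "sin (x k) \<noteq> 0"
      unfolding x_def k_def using small[of "n + j"] by (intro sin_pi_nonzero) auto
    moreover have "sin (y k) \<noteq> 0"
      unfolding y_def line_shift k_def using small[of n] by (intro sin_pi_nonzero) auto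
    ultimately have "0 < s k" by (simp add: s_def)
    then show ?thesis
    proof (intro inf_prod_less[where ?k0.0 = k])
      show "0 \<le> f k" for k by (simp add: f_def)
      show "f k \<le> g k" for k by (simp add: f_le s_def)
      show "0 < inf_prod g" using L0 by (simp add: g)
    qed (simp_all add: f_le ge_1)
  qed
  then have "cosprod (line (c * \<theta> ^ j + 1 * c)) * cosprod (line (c * \<theta> ^ j + (-1) * c)) \<noteq> L ^ 2 * L ^ 2"
    by (simp only: f g)
  then have "\<exists>s. (s = 1 \<or> s = -1) \<and> cosprod (line (c * \<theta> ^ j + s * c)) \<noteq> L ^ 2" by metis
  then obtain s where s: "s = 1 \<or> s = -1" "cosprod (line (c * \<theta> ^ j + s * c)) \<noteq> L ^ 2" by blast
  moreover have "\<bar>cosprod (line (c * \<theta> ^ j + s * c)) - L ^ 2\<bar> < e" using near[OF s(1), of j] j(1) by linarith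
  moreover have "admissible (c * \<theta> ^ j + s * c)"
    using s(1) admissible_add[OF admissible_power[OF c(1), of j], of "s * c"] c(1) admissible_minus[OF c(1)]
    by fastforce
  ultimately show ?thesis unfolding L_def by blast
qed

end

section \<open>Iterated derived sets\<close>

lemma derived_set_of_euclidean: "euclidean derived_set_of S = {x. x islimpt S}"
  by (rule set_eqI) (simp add: in_derived_set_of islimpt_def, blast)

lemma iterated_derived_set_Suc:
  "iterated_derived_set (Suc n) E = {x. x islimpt iterated_derived_set n E}"
  by (simp add: iterated_derived_set_def derived_set_of_euclidean)

lemma iterated_derived_set_0: "iterated_derived_set 0 E = E"
  by (simp add: iterated_derived_set_def)



lemma iterated_derived_set_subset_closure: "iterated_derived_set n E \<subseteq> closure E"
proof (induction n)
  case (Suc n)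
  show ?case
  proof
    fix x assume "x \<in> iterated_derived_set (Suc n) E"
    then have "x islimpt iterated_derived_set n E" by (simp add: iterated_derived_set_Suc)
    then have "x islimpt closure E" using Suc by (rule islimpt_subset)
    then have "x islimpt E" by (simp only: limpt_of_closure)
    then show "x \<in> closure E" by (simp add: closure_def)
  qed
qed (simp add: iterated_derived_set_0 closure_subset)

lemma islimpt_uminus: "x islimpt uminus ` S \<longleftrightarrow> - x islimpt S" for x :: real
proof -
  have *: "- x islimpt S" if x: "x islimpt uminus ` S" for x :: real and S
    unfolding islimpt_approachable
  proof (intro allI impI)
    fix e :: real assume "0 < e"
    then obtain s where s: "s \<in> S" "- s \<noteq> x" "dist (- s) x < e"
      using x unfolding islimpt_approachable by blast
    moreover have "dist s (- x) = dist (- s) x" by (simp add: dist_real_def abs_minus_commute)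
    ultimately show "\<exists>s\<in>S. s \<noteq> - x \<and> dist s (- x) < e" by (intro bexI[of _ s]) auto
  qed
  show ?thesis using *[of x S] *[of "- x" "uminus ` S"] by (auto simp: image_image)
qed

text \<open>This carries infinitude from the moduli back to the signed values: a limit point of a
  union is a limit point of one part, and reflection commutes with taking limit points.\<close>

lemma iterated_derived_set_abs:
  fixes F :: "real set"
  shows "iterated_derived_set n (abs ` F) \<subseteq> iterated_derived_set n F \<union> uminus ` iterated_derived_set n F"
proof (induction n)
  case 0
  show ?case by (auto simp: iterated_derived_set_0 abs_if)
next
  case (Suc n)
  show ?case
  proof
    fix x assume "x \<in> iterated_derived_set (Suc n) (abs ` F)"
    then have "x islimpt iterated_derived_set n (abs ` F)" by (simp add: iterated_derived_set_Suc)
    then have "x islimpt iterated_derived_set n F \<or> - x islimpt iterated_derived_set n F"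
      using islimpt_subset[OF _ Suc] by (simp add: islimpt_Un islimpt_uminus)
    then show "x \<in> iterated_derived_set (Suc n) F \<union> uminus ` iterated_derived_set (Suc n) F"
      by (auto simp: iterated_derived_set_Suc intro: image_eqI[of x uminus "- x"])
  qed
qed

lemma countable_closure_of_abs:
  fixes F :: "real set"
  assumes "countable (closure (abs ` F))" shows "countable (closure F)"
proof -
  have "closure F \<subseteq> closure (abs ` F) \<union> uminus ` closure (abs ` F)"
  proof (rule closure_minimal)
    show "F \<subseteq> closure (abs ` F) \<union> uminus ` closure (abs ` F)"
    proof
      fix x assume "x \<in> F"
      then have a: "\<bar>x\<bar> \<in> closure (abs ` F)" by (intro subsetD[OF closure_subset] imageI)
      show "x \<in> closure (abs ` F) \<union> uminus ` closure (abs ` F)"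
      proof (cases "0 \<le> x")
        case True
        then show ?thesis using a by simp
      next
        case False
        then have "x = - \<bar>x\<bar>" by simp
        then have "x \<in> uminus ` closure (abs ` F)" using a by (rule image_eqI)
        then show ?thesis ..
      qed
    qed
    show "closed (closure (abs ` F) \<union> uminus ` closure (abs ` F))"
      by (intro closed_Un closed_closure closed_negations)
  qed
  then show ?thesis by (rule countable_subset) (use assms in auto)
qed

text \<open>For \<open>x \<noteq> 0\<close>, the multiples of \<open>x\<close> by points of \<open>M\<close> near \<open>L\<close> are distinct points accumulating at \<open>L x\<close>.\<close>

lemma power_in_iterated_derived_set:
  fixes L :: real
  assumes act: "\<And>v x. v \<in> M \<Longrightarrow> x \<in> closure V \<Longrightarrow> v * x \<in> closure V"
    and L: "L \<noteq> 0" "L islimpt M"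
    and x: "x \<in> closure V" "x \<noteq> 0"
  shows "L ^ Suc n * x \<in> iterated_derived_set (Suc n) V"
  using x
proof (induction n arbitrary: x)
  have lim: "c * (L * x) islimpt S"
    if "c \<noteq> 0" "x \<noteq> 0" "\<And>v. v \<in> M \<Longrightarrow> v \<noteq> 0 \<Longrightarrow> c * (v * x) \<in> S" for c x S
    unfolding islimpt_approachable
  proof (intro allI impI)
    fix e :: real assume e: "0 < e"
    \<comment> \<open>The bound by the modulus of L keeps v away from 0, so that the induction
      hypothesis applies to v * x.\<close>
    define e' where "e' = min \<bar>L\<bar> (e / (\<bar>c\<bar> * \<bar>x\<bar>))"
    have "0 < e'" using e that L by (simp add: e'_def)
    then obtain v where v: "v \<in> M" "v \<noteq> L" "dist v L < e'"
      using L(2) unfolding islimpt_approachable by blast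
    have "v \<noteq> 0" using v(3) by (auto simp: e'_def dist_real_def)
    moreover have "dist (c * (v * x)) (c * (L * x)) < e"
    proof -
      have "dist (c * (v * x)) (c * (L * x)) = (\<bar>c\<bar> * \<bar>x\<bar>) * \<bar>v - L\<bar>"
        by (simp add: dist_real_def abs_mult[symmetric] algebra_simps)
      also have "\<dots> < (\<bar>c\<bar> * \<bar>x\<bar>) * (e / (\<bar>c\<bar> * \<bar>x\<bar>))"
        using v(3) that by (intro mult_strict_left_mono) (auto simp: e'_def dist_real_def)
      also have "\<dots> = e" using that by simp
      finally show ?thesis .
    qed
    moreover have "c * (v * x) \<noteq> c * (L * x)" using that v(2) by simp
    ultimately show "\<exists>x'\<in>S. x' \<noteq> c * (L * x) \<and> dist x' (c * (L * x)) < e"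
      using that(3)[OF v(1)] by blast
  qed
  {
    case 0
    have "1 * (L * x) islimpt closure V"
      by (rule lim) (use act 0 in auto)
    then show ?case by (simp add: iterated_derived_set_Suc iterated_derived_set_0 limpt_of_closure)
  next
    case (Suc n)
    have "L ^ Suc n * (L * x) islimpt iterated_derived_set (Suc n) V"
      by (rule lim) (use act Suc L in auto)
    then show ?case by (simp add: iterated_derived_set_Suc[of "Suc n"] mult_ac)
  }
qed

text \<open>The argument 0 gives the value 1, so M lies in the closure of the values, which is
  therefore infinite. Multiplication by L^(n+1) is injective and sends its nonzero points into the
  derived set.\<close>

lemma (in pisot_sequence) infinite_iterated_derived_set:
  assumes big: "\<forall>j\<ge>1. \<theta> ^ j \<in> \<rat> \<longrightarrow> (\<exists>n::int. \<theta> = of_int n \<and> 2 < n)"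
  shows "infinite (iterated_derived_set (Suc n) (range (\<lambda>n :: int. cosprod (ray \<theta> (r * of_int n)))))"
    (is "infinite (iterated_derived_set _ ?V)")
proof -
  define M where "M = {cosprod (line c) |c. admissible c}"
  have act: "v * x \<in> closure ?V" if v: "v \<in> M" and x: "x \<in> closure ?V" for v x
  proof -
    have "(\<lambda>x. v * x) ` closure ?V \<subseteq> closure ?V"
    proof (rule image_closure_subset)
      show "(\<lambda>x. v * x) ` ?V \<subseteq> closure ?V"
      proof (intro image_subsetI)
        fix x assume "x \<in> ?V"
        then obtain n :: int where x: "x = cosprod (ray \<theta> (r * of_int n))" by auto
        obtain c where c: "v = cosprod (line c)" "admissible c" using v by (auto simp: M_def)
        obtain s :: "nat \<Rightarrow> int" where s: "\<And>n :: int. (\<lambda>j. cosprod (ray \<theta> (r * of_int (n + s j)))) \<longlonglongrightarrow> cosprod (ray \<theta> (r * of_int n)) * cosprod (line c)"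
          using ray_values_tendsto[OF c(2)] by blast
        have "cosprod (ray \<theta> (r * of_int (n + s j))) \<in> ?V" for j by (rule rangeI)
        then show "v * x \<in> closure ?V"
          unfolding closure_sequential x c(1) using s[of n]
          by (intro exI[of _ "\<lambda>j. cosprod (ray \<theta> (r * of_int (n + s j)))"]) (simp add: mult.commute)
      qed
    qed (auto intro!: continuous_intros)
    then show ?thesis using x by blast
  qed
  obtain c where c: "admissible c" "c \<noteq> 0" "0 < cosprod (line c)"
    using exists_nonvanishing[OF big] by blast
  define L where "L = cosprod (line c) ^ 2"
  have L: "L \<noteq> 0" using c(3) by (simp add: L_def)
  have lim: "L islimpt M"
    unfolding islimpt_approachable M_def L_def dist_real_def using exists_limit_point[OF c] by blast
  have "cosprod (ray \<theta> (r * of_int 0)) \<in> closure ?V"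
    by (rule subsetD[OF closure_subset rangeI])
  moreover have "cosprod (ray \<theta> (r * of_int 0)) = 1"
  proof -
    have "ray \<theta> (r * of_int 0) = (\<lambda>_. 0)" by (simp add: ray_def fun_eq_iff)
    moreover have "{F :: int set. finite F} \<noteq> {}" using finite.emptyI by blast
    ultimately show ?thesis by (simp add: cosprod_def inf_prod_def)
  qed
  ultimately have "1 \<in> closure ?V" by simp
  then have "M \<subseteq> closure ?V" using act[of _ 1] by auto
  then have "L islimpt closure ?V" using lim by (rule islimpt_subset[rotated])
  then have "infinite (closure ?V)" using islimpt_finite by blast
  then have "infinite (closure ?V - {0})" by simp
  moreover have "inj_on (\<lambda>x. L ^ Suc n * x) (closure ?V - {0})" using L by (auto simp: inj_on_def)
  ultimately have "infinite ((\<lambda>x. L ^ Suc n * x) ` (closure ?V - {0}))" using finite_imageD by blast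
  moreover have "(\<lambda>x. L ^ Suc n * x) ` (closure ?V - {0}) \<subseteq> iterated_derived_set (Suc n) ?V"
    using power_in_iterated_derived_set[OF act L lim] by blast
  ultimately show ?thesis using finite_subset by blast
qed

theorem theorem1p5:
  fixes \<theta> r :: real
  assumes "pisot \<theta>"
    and "\<theta> \<noteq> 2"
    and "r \<in> rat_adjoin \<theta>"
    and "r > 0"
  shows "\<forall>n::nat. n \<ge> 1 \<longrightarrow>
           (let D = iterated_derived_set n (fourier_values (bernoulli_convolution \<theta>) r)
            in countable D \<and> infinite D)"
proof (intro allI impI)
  fix n :: nat assume "n \<ge> 1"
  then obtain m where m: "n = Suc m" by (cases n) auto
  obtain \<kappa> C \<rho> p h T d q where P: "pisot_sequence \<theta> r \<kappa> C \<rho> p h T d q"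
    using pisot_sequence_exists[OF assms(1,3,4)] by blast
  have \<theta>: "1 < \<theta>" using assms(1) by (simp add: pisot_def)
  \<comment> \<open>Here \<theta> \<noteq> 2 enters: a rational power makes \<theta> an integer
    above 1, hence above 2.\<close>
  have big: "\<forall>j\<ge>1. \<theta> ^ j \<in> \<rat> \<longrightarrow> (\<exists>n::int. \<theta> = of_int n \<and> 2 < n)"
  proof (intro allI impI)
    fix j :: nat assume j: "j \<ge> 1" "\<theta> ^ j \<in> \<rat>"
    obtain n :: int where n: "\<theta> = of_int n" using pisot_power_rational[OF assms(1) j] by blast
    then have "2 < n" using \<theta> assms(2) by (cases "n = 2") auto
    then show "\<exists>n::int. \<theta> = of_int n \<and> 2 < n" using n by blast
  qed
  let ?F = "fourier_values (bernoulli_convolution \<theta>) r"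
  note V = abs_fourier_values[OF \<theta>, of r]
  have "countable (closure ?F)"
    by (rule countable_closure_of_abs) (simp only: V pisot_sequence.countable_closure_ray_values[OF P])
  then have "countable (iterated_derived_set n ?F)"
    using iterated_derived_set_subset_closure countable_subset by blast
  moreover have "infinite (iterated_derived_set n ?F)"
  proof
    assume "finite (iterated_derived_set n ?F)"
    then have "finite (iterated_derived_set n (abs ` ?F))"
      by (intro finite_subset[OF iterated_derived_set_abs]) auto
    then show False using pisot_sequence.infinite_iterated_derived_set[OF P big, of m] by (simp only: V m)
  qed
  ultimately show "let D = iterated_derived_set n ?F in countable D \<and> infinite D" by (simp add: Let_def)
qed

end
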